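(* Let $\omega$ be Diophantine with constants $C_{\mathrm{dio}}>0,\tau>1$, and suppose that $f$ is $C_{\mathrm{reg}}$-regular at every $x\in(-1/2,1/2)$ (with the same constant $C_{\mathrm{reg}}$) and that $D_{\min}(x)\ge1$ for all $x\in(-1/2,1/2)$. There exists $\varepsilon_0>0$ such that for all $0<\varepsilon<\varepsilon_0$ and all $x_0\in(-1/2,1/2)\setminus(\mathbb Z+1/2+\mathbb Z^d\cdot\omega)$ the following holds. For $\mathbf n\in\mathbb Z^d$ put $\psi[\mathbf n]_{\mathbf m}:=\psi(x_0+\mathbf n\cdot\omega)_{\mathbf m-\mathbf n}$ and $\lambda_{\mathbf n}:=\lambda(x_0+\mathbf n\cdot\omega)$, where $\lambda(x)$ and $\psi(x)$ are the sums of the Rayleigh--Schr\"odinger perturbation series of $H(x)$ started at the origin. Then $$H(x_0)\psi[\mathbf n]=\lambda_{\mathbf n}\psi[\mathbf n],\qquad\mathbf n\in\mathbb Z^d,$$ the spectrum of $H(x_0)$ is pure point, and the eigenvectors $\psi[\mathbf n]$, $\mathbf n\in\mathbb Z^d$, form a complete system in $\ell^2(\mathbb Z^d)$.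
   Context: Operator: $(H(x)\psi)_{\mathbf n}=\varepsilon\sum_{\mathbf m\in\mathbb Z^d}\varphi_{\mathbf n-\mathbf m}\psi_{\mathbf m}+f(x+\mathbf n\cdot\omega)\psi_{\mathbf n}$ on $\ell^2(\mathbb Z^d)$, $x\in\mathbb R\setminus(\mathbb Z+1/2+\mathbb Z^d\cdot\omega)$; $\varphi$ has finite support, $\varphi_{\mathbf 0}=0$, $\varphi_{-\mathbf n}=\overline{\varphi_{\mathbf n}}$. $\omega\in(-1/2,1/2)^d$ satisfies $\|\mathbf n\cdot\omega\|:=\mathrm{dist}(\mathbf n\cdot\omega,\mathbb Z)\ge C_{\mathrm{dio}}|\mathbf n|^{-\tau}$ for all $\mathbf n\neq\mathbf 0$. Note that $H(x+1)=H(x)$, so $\lambda(x),\psi(x)$ are $1$-periodic in $x$. Regularity: $f\colon(-1/2,1/2)\to\mathbb R$ is continuous with $f(-1/2+0)=-\infty$, $f(1/2-0)=+\infty$, extended $1$-periodically to $\mathbb R\setminus(\mathbb Z+1/2)$. Where a derivative does not exist, bounds on it are required for all derivative numbers (limits of difference quotients along sequences), and infima are over all derivative numbers. $f$ is $C_{\mathrm{reg}}$-regular at $x_0\in(-1/2,1/2)$ if: (cr0) $f^{-1}((f(x_0)-2,f(x_0)+2))\cap(-1/2,1/2)$ is an open interval $(a,b)$, mapped by $f$ one-to-one onto $(f(x_0)-2,f(x_0)+2)$; (cr1) with $D_{\min}(x_0):=\inf_{x\in(a,b)}f'(x)$, one has $D_{\min}(x_0)\le f'(x)\le C_{\mathrm{reg}}D_{\min}(x_0)$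 on $(a,b)$; (cr2) with $(a_1,b_1)=f^{-1}((f(x_0)-1,f(x_0)+1))\cap(-1/2,1/2)$ and $g(x)=\frac1{f(x_0)-f(x)}$ on $(b_1,a_1+1)$, extended by $g(1/2)=0$, one has $|g'(x)|\le C_{\mathrm{reg}}D_{\min}(x_0)$ on $(b_1,a_1+1)$. Perturbation series of $H(x)=V+\varepsilon\Phi$ (with $V$ the diagonal part and $\Phi$ the convolution with $\varphi$) started at the origin: $\lambda(x)=\sum_s\varepsilon^s\lambda_s$, $\psi(x)=\sum_s\varepsilon^s\psi_s$ (componentwise), where $\lambda_0=f(x)$, $\psi_0=e_{\mathbf 0}$, $\psi_s\perp e_{\mathbf 0}$ for $s>0$, and the remaining $\lambda_s,\psi_s$ are uniquely determined by equating coefficients at each power of $\varepsilon$ in $(V+\varepsilon\Phi)(\psi_0+\varepsilon\psi_1+\dots)=(\lambda_0+\varepsilon\lambda_1+\dots)(\psi_0+\varepsilon\psi_1+\dots)$. For small $\varepsilon$ these series converge under the stated hypotheses. *)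

theory Defs
  imports "HOL-Analysis.Analysis"
begin

section \<open>The Hilbert space of square-summable families\<close>

definition ell2 :: "('a \<Rightarrow> complex) set" where
  "ell2 = {u. (\<lambda>n. (cmod (u n))\<^sup>2) summable_on UNIV}"

definition ell2_inner :: "('a \<Rightarrow> complex) \<Rightarrow> ('a \<Rightarrow> complex) \<Rightarrow> complex" where
  "ell2_inner u v = (\<Sum>\<^sub>\<infinity>n. u n * cnj (v n))"

definition ell2_norm :: "('a \<Rightarrow> complex) \<Rightarrow> real" where
  "ell2_norm u = sqrt (\<Sum>\<^sub>\<infinity>n. (cmod (u n))\<^sup>2)"

definition basis_vec :: "'a \<Rightarrow> 'a \<Rightarrow> complex" where
  "basis_vec k = (\<lambda>n. if n = k then 1 else 0)"

text \<open>The linear span of the system is dense in \<^term>\<open>ell2\<close>.\<close>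

definition complete_system :: "('i \<Rightarrow> 'a \<Rightarrow> complex) \<Rightarrow> bool" where
  "complete_system v \<longleftrightarrow> (\<forall>i. v i \<in> ell2) \<and>
     (\<forall>u\<in>ell2. \<forall>\<delta>>0. \<exists>F c. finite F \<and> ell2_norm (\<lambda>n. u n - (\<Sum>i\<in>F. c i * v i n)) < \<delta>)"


section \<open>Eigenvectors and pure point spectrum\<close>

text \<open>An unbounded operator is given by its domain \<open>D\<close> and a map \<open>A\<close>, of which only the
  values on \<open>D\<close> matter.\<close>

definition is_eigenvector ::
  "('a \<Rightarrow> complex) set \<Rightarrow> (('a \<Rightarrow> complex) \<Rightarrow> 'a \<Rightarrow> complex) \<Rightarrow> complex \<Rightarrow> ('a \<Rightarrow> complex) \<Rightarrow> bool"
where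
  "is_eigenvector D A l u \<longleftrightarrow> u \<in> D \<and> u \<noteq> (\<lambda>_. 0) \<and> A u = (\<lambda>n. l * u n)"

text \<open>The spectral measure of a self-adjoint operator at the vector \<open>u\<close>, characterized by its
  Borel transform \<open>\<langle>(A - z)\<inverse> u, u\<rangle> = \<integral> 1 / (t - z) d\<mu>(t)\<close> off the real axis, which determines
  \<open>\<mu>\<close> uniquely (Stieltjes inversion).  The vector \<open>v\<close> below is \<open>(A - z)\<inverse> u\<close>.\<close>

definition is_spectral_measure ::
  "('a \<Rightarrow> complex) set \<Rightarrow> (('a \<Rightarrow> complex) \<Rightarrow> 'a \<Rightarrow> complex) \<Rightarrow> ('a \<Rightarrow> complex) \<Rightarrow> real measure \<Rightarrow> bool"
where
  "is_spectral_measure D A u \<mu> \<longleftrightarrow> finite_measure \<mu> \<and> sets \<mu> = sets borel \<and>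
     (\<forall>z. Im z \<noteq> 0 \<longrightarrow>
        (\<exists>v\<in>D. (\<lambda>n. A v n - z * v n) = u \<and>
           ell2_inner v u = (\<integral>t. 1 / (complex_of_real t - z) \<partial>\<mu>)))"

text \<open>All spectral measures are pure point, i.e. carried by countable sets.\<close>

definition pure_point_spectrum ::
  "('a \<Rightarrow> complex) set \<Rightarrow> (('a \<Rightarrow> complex) \<Rightarrow> 'a \<Rightarrow> complex) \<Rightarrow> bool"
where
  "pure_point_spectrum D A \<longleftrightarrow>
     (\<forall>u\<in>ell2. \<exists>\<mu>. is_spectral_measure D A u \<mu> \<and> (\<exists>S. countable S \<and> emeasure \<mu> (UNIV - S) = 0))"


section \<open>The quasiperiodic operator\<close>

definition real_vec :: "int ^ 'd \<Rightarrow> real ^ 'd" where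
  "real_vec n = (\<chi> i. real_of_int (n $ i))"

definition diophantine :: "real \<Rightarrow> real \<Rightarrow> real ^ 'd \<Rightarrow> bool" where
  "diophantine C \<tau> \<omega> \<longleftrightarrow>
     (\<forall>n. n \<noteq> 0 \<longrightarrow> infdist (real_vec n \<bullet> \<omega>) \<int> \<ge> C * norm (real_vec n) powr (- \<tau>))"

definition half_integers :: "real set" where
  "half_integers = {real_of_int k + 1/2 | k. True}"

text \<open>\<open>\<int> + 1/2 + \<int>\<^sup>d \<cdot> \<omega>\<close>\<close>

definition singular_phases :: "real ^ 'd \<Rightarrow> real set" where
  "singular_phases \<omega> = {h + real_vec n \<bullet> \<omega> | h n. h \<in> half_integers}"

definition potential_op ::
  "(real \<Rightarrow> real) \<Rightarrow> real ^ 'd \<Rightarrow> real \<Rightarrow> (int ^ 'd \<Rightarrow> complex) \<Rightarrow> int ^ 'd \<Rightarrow> complex" where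
  "potential_op f \<omega> x u = (\<lambda>n. complex_of_real (f (x + real_vec n \<bullet> \<omega>)) * u n)"

definition conv_op ::
  "(int ^ 'd \<Rightarrow> complex) \<Rightarrow> (int ^ 'd \<Rightarrow> complex) \<Rightarrow> int ^ 'd \<Rightarrow> complex" where
  "conv_op \<phi> u = (\<lambda>n. \<Sum>\<^sub>\<infinity>m. \<phi> (n - m) * u m)"

definition H_op ::
  "real \<Rightarrow> (int ^ 'd \<Rightarrow> complex) \<Rightarrow> (real \<Rightarrow> real) \<Rightarrow> real ^ 'd \<Rightarrow> real \<Rightarrow>
   (int ^ 'd \<Rightarrow> complex) \<Rightarrow> int ^ 'd \<Rightarrow> complex" where
  "H_op \<epsilon> \<phi> f \<omega> x u = (\<lambda>n. complex_of_real \<epsilon> * conv_op \<phi> u n + potential_op f \<omega> x u n)"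

text \<open>The convolution part is bounded, so \<open>H(x)\<close> is self-adjoint on the natural domain of its
  diagonal part.\<close>

definition H_dom :: "(real \<Rightarrow> real) \<Rightarrow> real ^ 'd \<Rightarrow> real \<Rightarrow> (int ^ 'd \<Rightarrow> complex) set" where
  "H_dom f \<omega> x = {u \<in> ell2. potential_op f \<omega> x u \<in> ell2}"


section \<open>Regularity of the potential\<close>

text \<open>Derivative numbers may be infinite; at a point of differentiability the derivative is the
  only one.\<close>

definition derivative_numbers :: "(real \<Rightarrow> real) \<Rightarrow> real \<Rightarrow> ereal set" where
  "derivative_numbers f x =
     {L. \<exists>h. (\<forall>k::nat. h k \<noteq> 0) \<and> h \<longlonglongrightarrow> 0 \<and>
             (\<lambda>k. ereal ((f (x + h k) - f x) / h k)) \<longlonglongrightarrow> L}"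

definition level_nbhd :: "(real \<Rightarrow> real) \<Rightarrow> real \<Rightarrow> real \<Rightarrow> real set" where
  "level_nbhd f x0 r = f -` {f x0 - r<..<f x0 + r} \<inter> {-1/2<..<1/2}"

definition D_min :: "(real \<Rightarrow> real) \<Rightarrow> real \<Rightarrow> ereal" where
  "D_min f x0 = Inf (\<Union>x\<in>level_nbhd f x0 2. derivative_numbers f x)"

text \<open>Here \<open>f\<close> is already extended periodically: the values on \<open>(1/2, a1 + 1)\<close> enter the last
  condition.\<close>

definition regular_at :: "real \<Rightarrow> (real \<Rightarrow> real) \<Rightarrow> real \<Rightarrow> bool" where
  "regular_at C f x0 \<longleftrightarrow>
     (\<exists>a b. a < b \<and> level_nbhd f x0 2 = {a<..<b} \<and>
        bij_betw f {a<..<b} {f x0 - 2<..<f x0 + 2} \<and>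
        (\<forall>x\<in>{a<..<b}. \<forall>L\<in>derivative_numbers f x. D_min f x0 \<le> L \<and> L \<le> ereal C * D_min f x0)) \<and>
     (\<exists>a1 b1. a1 < b1 \<and> level_nbhd f x0 1 = {a1<..<b1} \<and>
        (let g = (\<lambda>x. if x = 1/2 then 0 else 1 / (f x0 - f x))
         in \<forall>x\<in>{b1<..<a1 + 1}. \<forall>L\<in>derivative_numbers g x. \<bar>L\<bar> \<le> ereal C * D_min f x0))"


section \<open>The Rayleigh--Schroedinger perturbation series\<close>

text \<open>\<open>l s\<close> and \<open>p s\<close> are the coefficients of \<open>\<epsilon>\<^sup>s\<close> in the formal eigenvalue and eigenvector; the
  last two conjuncts equate the coefficients of \<open>\<epsilon>\<^sup>0\<close> and \<open>\<epsilon>\<^sup>s\<^sup>+\<^sup>1\<close> in the eigenvalue equation.\<close>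

definition is_RS_series ::
  "(int ^ 'd \<Rightarrow> complex) \<Rightarrow> (real \<Rightarrow> real) \<Rightarrow> real ^ 'd \<Rightarrow> real \<Rightarrow>
   (nat \<Rightarrow> complex) \<Rightarrow> (nat \<Rightarrow> int ^ 'd \<Rightarrow> complex) \<Rightarrow> bool" where
  "is_RS_series \<phi> f \<omega> x l p \<longleftrightarrow>
     l 0 = complex_of_real (f x) \<and> p 0 = basis_vec 0 \<and>
     (\<forall>s>0. ell2_inner (p s) (basis_vec 0) = 0) \<and>
     (\<forall>n. potential_op f \<omega> x (p 0) n = l 0 * p 0 n) \<and>
     (\<forall>s n. potential_op f \<omega> x (p (Suc s)) n + conv_op \<phi> (p s) n
              = (\<Sum>j\<le>Suc s. l j * p (Suc s - j) n))"

definition RS_coeffs ::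
  "(int ^ 'd \<Rightarrow> complex) \<Rightarrow> (real \<Rightarrow> real) \<Rightarrow> real ^ 'd \<Rightarrow> real \<Rightarrow>
   (nat \<Rightarrow> complex) \<times> (nat \<Rightarrow> int ^ 'd \<Rightarrow> complex)" where
  "RS_coeffs \<phi> f \<omega> x = (THE (l, p). is_RS_series \<phi> f \<omega> x l p)"

definition RS_lambda_term ::
  "real \<Rightarrow> (int ^ 'd \<Rightarrow> complex) \<Rightarrow> (real \<Rightarrow> real) \<Rightarrow> real ^ 'd \<Rightarrow> real \<Rightarrow> nat \<Rightarrow> complex" where
  "RS_lambda_term \<epsilon> \<phi> f \<omega> x s = complex_of_real \<epsilon> ^ s * fst (RS_coeffs \<phi> f \<omega> x) s"

definition RS_psi_term ::
  "real \<Rightarrow> (int ^ 'd \<Rightarrow> complex) \<Rightarrow> (real \<Rightarrow> real) \<Rightarrow> real ^ 'd \<Rightarrow> real \<Rightarrow> int ^ 'd \<Rightarrow> nat \<Rightarrow> complex" where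
  "RS_psi_term \<epsilon> \<phi> f \<omega> x m s = complex_of_real \<epsilon> ^ s * snd (RS_coeffs \<phi> f \<omega> x) s m"

definition RS_lambda ::
  "real \<Rightarrow> (int ^ 'd \<Rightarrow> complex) \<Rightarrow> (real \<Rightarrow> real) \<Rightarrow> real ^ 'd \<Rightarrow> real \<Rightarrow> complex" where
  "RS_lambda \<epsilon> \<phi> f \<omega> x = (\<Sum>s. RS_lambda_term \<epsilon> \<phi> f \<omega> x s)"

definition RS_psi ::
  "real \<Rightarrow> (int ^ 'd \<Rightarrow> complex) \<Rightarrow> (real \<Rightarrow> real) \<Rightarrow> real ^ 'd \<Rightarrow> real \<Rightarrow> int ^ 'd \<Rightarrow> complex" where
  "RS_psi \<epsilon> \<phi> f \<omega> x m = (\<Sum>s. RS_psi_term \<epsilon> \<phi> f \<omega> x m s)"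

definition shifted_psi ::
  "real \<Rightarrow> (int ^ 'd \<Rightarrow> complex) \<Rightarrow> (real \<Rightarrow> real) \<Rightarrow> real ^ 'd \<Rightarrow> real \<Rightarrow>
   int ^ 'd \<Rightarrow> int ^ 'd \<Rightarrow> complex" where
  "shifted_psi \<epsilon> \<phi> f \<omega> x n m = RS_psi \<epsilon> \<phi> f \<omega> (x + real_vec n \<bullet> \<omega>) (m - n)"

end

theory Submission
  imports Defs "HOL-Complex_Analysis.Complex_Analysis"
begin

text \<open>Fix the phase \<open>x0\<close> and put \<open>v n = f (x0 + n \<bullet> \<omega>)\<close>.  The potential enters the argument only
through two properties of the sequence \<open>v\<close>.  Its values are separated,
\<open>\<bar>v m - v n\<bar> \<ge> c \<bar>m - n\<bar>\<^sup>-\<^sup>\<tau>\<close>, because \<open>f\<close> has slope at least one and \<open>\<omega>\<close> is Diophantine.  And \<open>v\<close>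
is Lipschitz under translations in a chordal sense (\<open>chordal_lipschitz\<close>):
\<open>\<bar>v (m + j) - v (n + j)\<bar> \<le> C \<bar>v m - v n\<bar> (1 + \<bar>v (m + j) - v m\<bar>) (1 + \<bar>v (n + j) - v n\<bar>)\<close>.
This is regularity in a symmetric form: near the level \<open>f x\<close> the derivative of \<open>f\<close> is
comparable to the minimal slope, and far from it the same holds for \<open>1 / (f x - f)\<close>, a
coordinate in which the pole of \<open>f\<close> is an ordinary point.

The operator \<open>V + \<epsilon>\<Phi>\<close> is diagonalized by a similarity, not necessarily unitary, for all complex
\<open>\<epsilon>\<close> in a fixed disc.  One step of a Newton (KAM) iteration (\<open>kam_step\<close>) removes the
off-diagonal entries of range at most \<open>N\<close> and leaves a quadratically small remainder plus the
exponentially small entries of longer range.  It divides by differences of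
approximate levels at sites at distance at most \<open>N\<close>, so the iteration rests on a lower bound for
these (\<open>level_gap\<close>).  The bound is a discrete Hellmann--Feynman formula.  Pair an approximate
eigenvector centred at \<open>m\<close> with one centred at \<open>n\<close>, translated onto each other: the convolution
cancels, and the difference of the levels becomes a sum over \<open>j\<close> of \<open>v (m + j) - v (n + j)\<close>
weighted by products of eigenvector components.  The term \<open>j = 0\<close> is close to \<open>v m - v n\<close>; for
\<open>j \<noteq> 0\<close> the eigenvalue equation makes each component smaller by a factor
\<open>1 + \<bar>v (m + j) - v m\<bar>\<close>, which is exactly what the chordal estimate costs.  Hence levels are
separated as well as the values of \<open>v\<close>, up to the size of the current remainder, and this
error is harmless at distances up to \<open>N\<close>.  No regularity of the levels in the phase has to be
carried through the iteration.  For complex \<open>\<epsilon>\<close> the left eigenvectors needed in the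
pairing are the complex conjugates of right eigenvectors at the conjugate parameter.

In the limit (\<open>kam_diagonalization\<close>) there is a matrix \<open>T\<close> close to \<open>1\<close>, with exponentially
decaying entries that are holomorphic in \<open>\<epsilon>\<close>, such that \<open>(V + \<epsilon>\<Phi>) T = T \<Lambda>\<close> with \<open>\<Lambda>\<close> diagonal
with distinct entries.  The column of \<open>T\<close> at \<open>n\<close>, normalized at \<open>n\<close>, and its eigenvalue are then
holomorphic in \<open>\<epsilon>\<close>.  Their Taylor coefficients satisfy the recursion of the
Rayleigh--Schroedinger series, whose solution is unique, so the perturbation series converge
to them (\<open>RS_series_of_holomorphic_eigenpair\<close>).  For real \<open>\<epsilon>\<close> the operator is symmetric with
distinct eigenvalues, hence the columns are pairwise orthogonal; they are complete because \<open>T\<close> maps \<open>\<ell>\<^sup>2\<close> onto itself; and the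
resulting expansion gives the resolvent and all spectral measures explicitly
(\<open>diagonalized_operator\<close>).\<close>

(* The notation is reserved for unordered sums; the notion for Lebesgue integrals is qualified. *)
no_notation Infinite_Set_Sum.abs_summable_on (infix "abs'_summable'_on" 50)


section \<open>Summation over the lattice\<close>

definition lnorm :: "int ^ 'd \<Rightarrow> real" where
  "lnorm n = norm (real_vec n)"

lemma real_vec_add: "real_vec (m + n) = real_vec m + real_vec n"
  by (simp add: real_vec_def vec_eq_iff)

lemma real_vec_diff: "real_vec (m - n) = real_vec m - real_vec n"
  by (simp add: real_vec_def vec_eq_iff)

lemma lnorm_nonneg [simp]: "0 \<le> lnorm n"
  by (simp add: lnorm_def)

lemma lnorm_zero [simp]: "lnorm 0 = 0"
  by (simp add: lnorm_def real_vec_def vec_eq_iff norm_eq_zero)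

lemma lnorm_minus_commute: "lnorm (m - n) = lnorm (n - m)"
  by (simp add: lnorm_def real_vec_diff norm_minus_commute)

lemma lnorm_triangle: "lnorm (m - n) \<le> lnorm (m - k) + lnorm (k - n)"
  unfolding lnorm_def real_vec_diff by (metis norm_triangle_ineq diff_add_cancel add_diff_eq)

lemma component_le_lnorm: "real_of_int \<bar>n $ i\<bar> \<le> lnorm n"
  using component_le_norm_cart[of "real_vec n" i] by (simp add: lnorm_def real_vec_def)

lemma lnorm_ge_1: "n \<noteq> 0 \<Longrightarrow> 1 \<le> lnorm n"
proof -
  assume "n \<noteq> 0"
  then obtain i where "n $ i \<noteq> 0" by (auto simp: vec_eq_iff)
  then have "1 \<le> real_of_int \<bar>n $ i\<bar>" by linarith
  then show ?thesis using component_le_lnorm[of n i] by linarith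
qed

lemma exp_abs_int_sum_bounded:
  assumes "c > (0::real)"
  shows "\<exists>B. \<forall>F::int set. finite F \<longrightarrow> (\<Sum>k\<in>F. exp (- (c * real_of_int \<bar>k\<bar>))) \<le> B"
proof -
  have q: "exp (- c) < 1" "0 < exp (-c)" using assms by auto
  have "(\<lambda>n. exp (- (c * real n))) = (\<lambda>n. exp (- c) ^ n)"
    by (auto simp: exp_of_nat_mult[symmetric] mult.commute)
  then have s: "summable (\<lambda>n. exp (- (c * real n)))" using q by (simp add: summable_geometric)
  define B where "B = (\<Sum>n. exp (- (c * real n)))"
  have "(\<Sum>k\<in>F. exp (- (c * real_of_int \<bar>k\<bar>))) \<le> 2 * B" if "finite F" for F :: "int set"
  proof -
    have "(\<Sum>k\<in>F. exp (- (c * real_of_int \<bar>k\<bar>))) \<le>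
      (\<Sum>k\<in>F \<inter> {0..}. exp (- (c * real_of_int \<bar>k\<bar>))) + (\<Sum>k\<in>F \<inter> {..0}. exp (- (c * real_of_int \<bar>k\<bar>)))"
    proof -
      have "F = (F \<inter> {0..}) \<union> (F \<inter> {..0})" by auto
      then have "(\<Sum>k\<in>F. exp (- (c * real_of_int \<bar>k\<bar>))) =
         (\<Sum>k\<in>(F \<inter> {0..}) \<union> (F \<inter> {..0}). exp (- (c * real_of_int \<bar>k\<bar>)))" by simp
      also have "\<dots> \<le> (\<Sum>k\<in>F \<inter> {0..}. exp (- (c * real_of_int \<bar>k\<bar>))) + (\<Sum>k\<in>F \<inter> {..0}. exp (- (c * real_of_int \<bar>k\<bar>)))"
        using that by (subst sum.union_inter[symmetric]) (auto intro!: sum_nonneg)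
      finally show ?thesis .
    qed
    moreover have "(\<Sum>k\<in>F \<inter> {0..}. exp (- (c * real_of_int \<bar>k\<bar>))) = (\<Sum>n\<in>nat ` (F \<inter> {0..}). exp (- (c * real n)))"
      by (subst sum.reindex) (auto simp: inj_on_def intro!: sum.cong)
    moreover have "(\<Sum>n\<in>nat ` (F \<inter> {0..}). exp (- (c * real n))) \<le> B"
      unfolding B_def using that by (intro sum_le_suminf s) auto
    moreover have "(\<Sum>k\<in>F \<inter> {..0}. exp (- (c * real_of_int \<bar>k\<bar>))) = (\<Sum>n\<in>(nat \<circ> uminus) ` (F \<inter> {..0}). exp (- (c * real n)))"
      by (subst sum.reindex) (auto simp: inj_on_def intro!: sum.cong)
    moreover have "(\<Sum>n\<in>(nat \<circ> uminus) ` (F \<inter> {..0}). exp (- (c * real n))) \<le> B"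
      unfolding B_def using that by (intro sum_le_suminf s) auto
    ultimately show ?thesis by linarith
  qed
  then show ?thesis by blast
qed

text \<open>The norm dominates the average of the \<open>\<bar>n $ i\<bar>\<close>, so the exponential is at most a product over the
coordinates, and the sum over a box factorizes into one-dimensional geometric sums.\<close>

lemma exp_lnorm_sum_bounded:
  assumes "c > (0::real)"
  shows "\<exists>B. \<forall>F::(int ^ 'd) set. finite F \<longrightarrow> (\<Sum>n\<in>F. exp (- (c * lnorm n))) \<le> B"
proof -
  define c' where "c' = c / real CARD('d)"
  have c': "c' > 0" using assms by (simp add: c'_def)
  obtain B where B: "\<And>F::int set. finite F \<Longrightarrow> (\<Sum>k\<in>F. exp (- (c' * real_of_int \<bar>k\<bar>))) \<le> B"
    using exp_abs_int_sum_bounded[OF c'] by blast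
  have pt: "exp (- (c * lnorm n)) \<le> (\<Prod>i\<in>UNIV. exp (- (c' * real_of_int \<bar>n $ i\<bar>)))" for n :: "int^'d"
  proof -
    have "(\<Sum>i\<in>(UNIV::'d set). c' * real_of_int \<bar>n $ i\<bar>) \<le> (\<Sum>i\<in>(UNIV::'d set). c' * lnorm n)"
      using c' component_le_lnorm[of n] by (intro sum_mono mult_left_mono) auto
    also have "\<dots> = c * lnorm n" by (simp add: c'_def)
    finally have "- (c * lnorm n) \<le> (\<Sum>i\<in>UNIV. - (c' * real_of_int \<bar>n $ i\<bar>))" by (simp add: sum_negf)
    then show ?thesis by (metis exp_sum exp_le_cancel_iff finite)
  qed
  have "(\<Sum>n\<in>F. exp (- (c * lnorm n))) \<le> B ^ CARD('d)" if F: "finite F" for F :: "(int^'d) set"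
  proof -
    define K where "K = (\<Union>i. (\<lambda>n. n $ i) ` F)"
    have K: "finite K" using F by (simp add: K_def)
    define G where "G = PiE (UNIV::'d set) (\<lambda>_. K)"
    have G: "finite G" unfolding G_def using K by (intro finite_PiE) auto
    have "(\<Sum>n\<in>F. exp (- (c * lnorm n))) \<le> (\<Sum>n\<in>F. \<Prod>i\<in>UNIV. exp (- (c' * real_of_int \<bar>n $ i\<bar>)))"
      using pt by (rule sum_mono)
    also have "\<dots> = (\<Sum>g\<in>vec_nth ` F. \<Prod>i\<in>UNIV. exp (- (c' * real_of_int \<bar>g i\<bar>)))"
      by (subst sum.reindex) (auto simp: inj_on_def vec_nth_inject)
    also have "\<dots> \<le> (\<Sum>g\<in>G. \<Prod>i\<in>UNIV. exp (- (c' * real_of_int \<bar>g i\<bar>)))"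
      using G by (intro sum_mono2) (auto simp: G_def K_def intro!: prod_nonneg)
    also have "\<dots> = (\<Prod>i\<in>(UNIV::'d set). \<Sum>k\<in>K. exp (- (c' * real_of_int \<bar>k\<bar>)))"
      unfolding G_def by (subst prod_sum_PiE[OF finite K]) simp
    also have "\<dots> \<le> (\<Prod>i\<in>(UNIV::'d set). B)"
      using B[OF K] by (intro prod_mono conjI sum_nonneg) auto
    finally show ?thesis by simp
  qed
  then show ?thesis by blast
qed

lemma abs_summable_on_if_bounded:
  fixes f :: "'a \<Rightarrow> 'b::banach"
  assumes "\<And>F. finite F \<Longrightarrow> (\<Sum>x\<in>F. norm (f x)) \<le> B"
  shows "f abs_summable_on UNIV" "(\<Sum>\<^sub>\<infinity>x. norm (f x)) \<le> B"
proof -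
  show *: "f abs_summable_on UNIV"
    by (rule nonneg_bdd_above_summable_on) (auto intro!: bdd_aboveI2[of _ _ B] assms)
  show "(\<Sum>\<^sub>\<infinity>x. norm (f x)) \<le> B"
    using * assms by (intro infsum_le_finite_sums) auto
qed

lemma exp_lnorm_summable:
  assumes "c > (0::real)"
  shows "(\<lambda>n::int^'d. exp (- (c * lnorm n))) summable_on UNIV"
proof -
  obtain B where B: "\<And>F::(int^'d) set. finite F \<Longrightarrow> (\<Sum>n\<in>F. exp (- (c * lnorm n))) \<le> B"
    using exp_lnorm_sum_bounded[OF assms] by blast
  show ?thesis
    by (rule nonneg_bdd_above_summable_on) (auto intro!: bdd_aboveI2[of _ _ B] B)
qed

lemma exp_lnorm_diff_summable:
  assumes "c > (0::real)"
  shows "(\<lambda>n::int^'d. exp (- (c * lnorm (m - n)))) summable_on UNIV"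
  using summable_on_reindex_bij_betw[of "\<lambda>n. m - n" UNIV UNIV "\<lambda>n. exp (- (c * lnorm n))"]
    exp_lnorm_summable[OF assms] bij_diff by (auto simp: comp_def)

lemma has_sum_finite_sum:
  fixes f :: "'i \<Rightarrow> 'a \<Rightarrow> 'b::topological_comm_monoid_add"
  assumes "finite I" "\<And>i. i \<in> I \<Longrightarrow> (f i has_sum s i) A"
  shows "((\<lambda>x. \<Sum>i\<in>I. f i x) has_sum (\<Sum>i\<in>I. s i)) A"
  using assms by (induction rule: finite_induct) (auto intro!: has_sum_add)

lemma infsum_finite_sum:
  fixes f :: "'i \<Rightarrow> 'a \<Rightarrow> 'b::{topological_comm_monoid_add, t2_space}"
  assumes "finite I" "\<And>i. i \<in> I \<Longrightarrow> f i summable_on A"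
  shows "(\<Sum>\<^sub>\<infinity>x\<in>A. \<Sum>i\<in>I. f i x) = (\<Sum>i\<in>I. \<Sum>\<^sub>\<infinity>x\<in>A. f i x)"
    "(\<lambda>x. \<Sum>i\<in>I. f i x) summable_on A"
  using has_sum_finite_sum[of I f A "\<lambda>i. infsum (f i) A"] assms
  by (auto intro: infsumI simp: summable_on_def)


section \<open>Matrices with exponentially decaying rows\<close>

text \<open>The weighted row sums are submultiplicative with constant one for every rate \<open>\<rho> \<ge> 0\<close>
(\<open>row_bound_matmul\<close>), so products lose neither decay nor constants.  Columns need no separate
condition, since a row bound with positive rate already makes each entry exponentially small
in \<open>\<bar>m - n\<bar>\<close>.  Quantifying over finite sets lets the bound pass to entrywise limits.\<close>

definition row_bound :: "real \<Rightarrow> real \<Rightarrow> (int ^ 'd \<Rightarrow> int ^ 'd \<Rightarrow> complex) \<Rightarrow> bool" where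
  "row_bound \<rho> a M \<longleftrightarrow>
     (\<forall>m F. finite F \<longrightarrow> (\<Sum>n\<in>F. cmod (M m n) * exp (\<rho> * lnorm (m - n))) \<le> a)"

definition matmul :: "('a \<Rightarrow> 'b \<Rightarrow> complex) \<Rightarrow> ('b \<Rightarrow> 'c \<Rightarrow> complex) \<Rightarrow> 'a \<Rightarrow> 'c \<Rightarrow> complex" where
  "matmul M N m n = (\<Sum>\<^sub>\<infinity>k. M m k * N k n)"

lemma row_boundD: "row_bound \<rho> a M \<Longrightarrow> finite F \<Longrightarrow> (\<Sum>n\<in>F. cmod (M m n) * exp (\<rho> * lnorm (m - n))) \<le> a"
  by (simp add: row_bound_def)

lemma row_bound_nonneg: "row_bound \<rho> a M \<Longrightarrow> 0 \<le> a"
  using row_boundD[of \<rho> a M "{}"] by simp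

lemma row_bound_mono:
  assumes "row_bound \<rho> a M" "\<rho>' \<le> \<rho>" "a \<le> a'"
  shows "row_bound \<rho>' a' M"
  unfolding row_bound_def
proof (intro allI impI)
  fix m :: "int^'a" and F :: "(int^'a) set" assume "finite F"
  have "(\<Sum>n\<in>F. cmod (M m n) * exp (\<rho>' * lnorm (m - n))) \<le> (\<Sum>n\<in>F. cmod (M m n) * exp (\<rho> * lnorm (m - n)))"
    using assms(2) by (intro sum_mono mult_left_mono) (auto intro: mult_right_mono)
  then show "(\<Sum>n\<in>F. cmod (M m n) * exp (\<rho>' * lnorm (m - n))) \<le> a'"
    using row_boundD[OF assms(1) \<open>finite F\<close>, of m] assms(3) by linarith
qed

lemma row_bound_dominated:
  assumes "row_bound \<rho> a M" "\<And>m n. cmod (M' m n) * exp (\<rho>' * lnorm (m - n)) \<le> \<kappa> * (cmod (M m n) * exp (\<rho> * lnorm (m - n)))"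
    and "0 \<le> \<kappa>"
  shows "row_bound \<rho>' (\<kappa> * a) M'"
  unfolding row_bound_def
proof (intro allI impI)
  fix m :: "int^'a" and F :: "(int^'a) set" assume "finite F"
  have "(\<Sum>n\<in>F. cmod (M' m n) * exp (\<rho>' * lnorm (m - n))) \<le> \<kappa> * (\<Sum>n\<in>F. cmod (M m n) * exp (\<rho> * lnorm (m - n)))"
    unfolding sum_distrib_left using assms(2) by (intro sum_mono) auto
  also have "\<dots> \<le> \<kappa> * a" using row_boundD[OF assms(1) \<open>finite F\<close>] assms(3) by (intro mult_left_mono)
  finally show "(\<Sum>n\<in>F. cmod (M' m n) * exp (\<rho>' * lnorm (m - n))) \<le> \<kappa> * a" .
qed

lemma row_bound_entry:
  assumes "row_bound \<rho> a M"
  shows "cmod (M m n) \<le> a * exp (- (\<rho> * lnorm (m - n)))"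
  using row_boundD[OF assms, of "{n}" m] by (simp add: exp_minus field_simps)

lemma row_bound_entry0:
  assumes "row_bound \<rho> a M" "0 \<le> \<rho>"
  shows "cmod (M m n) \<le> a"
  using row_bound_entry[OF row_bound_mono[OF assms(1) assms(2) order_refl], of m n] by simp

lemma row_bound_abs_summable:
  assumes "row_bound \<rho> a M" "0 \<le> \<rho>"
  shows "(\<lambda>n. M m n) abs_summable_on UNIV" "(\<Sum>\<^sub>\<infinity>n. cmod (M m n)) \<le> a"
    "(\<lambda>n. cmod (M m n) * exp (\<rho> * lnorm (m - n))) summable_on UNIV"
    "(\<Sum>\<^sub>\<infinity>n. cmod (M m n) * exp (\<rho> * lnorm (m - n))) \<le> a"
proof -
  have *: "(\<Sum>n\<in>F. norm (M m n)) \<le> a" if "finite F" for F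
    using row_boundD[OF row_bound_mono[OF assms order_refl] that, of m] by simp
  show "(\<lambda>n. M m n) abs_summable_on UNIV" "(\<Sum>\<^sub>\<infinity>n. cmod (M m n)) \<le> a"
    using abs_summable_on_if_bounded[OF *] by auto
  have **: "(\<Sum>n\<in>F. norm (cmod (M m n) * exp (\<rho> * lnorm (m - n)))) \<le> a" if "finite F" for F
    using row_boundD[OF assms(1) that, of m] by simp
  show "(\<lambda>n. cmod (M m n) * exp (\<rho> * lnorm (m - n))) summable_on UNIV"
    "(\<Sum>\<^sub>\<infinity>n. cmod (M m n) * exp (\<rho> * lnorm (m - n))) \<le> a"
    using abs_summable_on_if_bounded[OF **] by auto
qed

lemma abs_summable_mult_bounded:
  fixes f g :: "'a \<Rightarrow> complex"
  assumes "f abs_summable_on UNIV" "\<And>k. cmod (g k) \<le> b"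
  shows "(\<lambda>k. f k * g k) abs_summable_on UNIV"
proof (rule Infinite_Sum.abs_summable_on_comparison_test)
  show "(\<lambda>k. complex_of_real b * f k) abs_summable_on UNIV"
    using assms(1) by (simp add: norm_mult summable_on_cmult_right)
  show "norm (f k * g k) \<le> norm (complex_of_real b * f k)" for k
    using mult_right_mono[OF assms(2)[of k] norm_ge_zero[of "f k"]]
      order.trans[OF norm_ge_zero assms(2)[of k]]
    by (simp add: norm_mult mult.commute)
qed

lemma matmul_abs_summable:
  assumes "row_bound \<rho> a M" "0 \<le> \<rho>" "row_bound \<rho>' b N" "0 \<le> \<rho>'"
  shows "(\<lambda>k. M m k * N k n) abs_summable_on UNIV"
  by (rule abs_summable_mult_bounded[OF row_bound_abs_summable(1)[OF assms(1,2)] row_bound_entry0[OF assms(3,4)]])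

lemma row_bound_matmul:
  assumes M: "row_bound \<rho> a M" and N: "row_bound \<rho> b N" and \<rho>: "0 \<le> \<rho>"
  shows "row_bound \<rho> (a * b) (matmul M N)"
  unfolding row_bound_def
proof (intro allI impI)
  fix m :: "int^'a" and F :: "(int^'a) set" assume F: "finite F"
  define w where "w = (\<lambda>k. cmod (M m k) * exp (\<rho> * lnorm (m - k)))"
  have w: "w summable_on UNIV" "infsum w UNIV \<le> a" "\<And>k. 0 \<le> w k"
    using row_bound_abs_summable(3,4)[OF M \<rho>, of m] by (auto simp: w_def)
  define u where "u k n = cmod (M m k * N k n) * exp (\<rho> * lnorm (m - n))" for k n
  have us: "(\<lambda>k. u k n) summable_on UNIV" for n
    unfolding u_def using matmul_abs_summable[OF M \<rho> N \<rho>] by (intro summable_on_cmult_left) auto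
  have "(\<Sum>n\<in>F. cmod (matmul M N m n) * exp (\<rho> * lnorm (m - n))) \<le> (\<Sum>n\<in>F. \<Sum>\<^sub>\<infinity>k. u k n)"
  proof (rule sum_mono)
    fix n
    have "cmod (matmul M N m n) \<le> (\<Sum>\<^sub>\<infinity>k. cmod (M m k * N k n))"
      unfolding matmul_def using matmul_abs_summable[OF M \<rho> N \<rho>] by (rule norm_infsum_bound)
    then show "cmod (matmul M N m n) * exp (\<rho> * lnorm (m - n)) \<le> (\<Sum>\<^sub>\<infinity>k. u k n)"
      unfolding u_def using matmul_abs_summable[OF M \<rho> N \<rho>]
      by (subst infsum_cmult_left) auto
  qed
  also have "\<dots> = (\<Sum>\<^sub>\<infinity>k. \<Sum>n\<in>F. u k n)" using us F by (subst infsum_finite_sum(1)) auto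
  also have "\<dots> \<le> (\<Sum>\<^sub>\<infinity>k. w k * b)"
  proof (rule infsum_mono)
    show "(\<lambda>k. \<Sum>n\<in>F. u k n) summable_on UNIV" using us F by (intro infsum_finite_sum(2))
    show "(\<lambda>k. w k * b) summable_on UNIV" using w by (intro summable_on_cmult_left)
    fix k
    have "(\<Sum>n\<in>F. u k n) \<le> (\<Sum>n\<in>F. w k * (cmod (N k n) * exp (\<rho> * lnorm (k - n))))"
    proof (rule sum_mono)
      fix n
      have "exp (\<rho> * lnorm (m - n)) \<le> exp (\<rho> * lnorm (m - k)) * exp (\<rho> * lnorm (k - n))"
        using \<rho> lnorm_triangle[of m n k] by (simp add: exp_add[symmetric] distrib_left[symmetric] mult_left_mono)
      then have "cmod (M m k * N k n) * exp (\<rho> * lnorm (m - n)) \<le> cmod (M m k * N k n) * (exp (\<rho> * lnorm (m - k)) * exp (\<rho> * lnorm (k - n)))"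
        by (rule mult_left_mono) simp
      then show "u k n \<le> w k * (cmod (N k n) * exp (\<rho> * lnorm (k - n)))"
        by (simp add: u_def w_def norm_mult ac_simps)
    qed
    also have "\<dots> \<le> w k * b" unfolding sum_distrib_left[symmetric]
      using row_boundD[OF N F] w(3) by (intro mult_left_mono)
    finally show "(\<Sum>n\<in>F. u k n) \<le> w k * b" .
  qed
  also have "\<dots> = infsum w UNIV * b" using w(1) by (subst infsum_cmult_left) auto
  also have "\<dots> \<le> a * b" using w(2) row_bound_nonneg[OF N] by (intro mult_right_mono)
  finally show "(\<Sum>n\<in>F. cmod (matmul M N m n) * exp (\<rho> * lnorm (m - n))) \<le> a * b" .
qed

text \<open>Fubini for a product of two matrices applied to a bounded sequence.  Associativity of the matrix
product is the case in which the sequence is a column of a third matrix; the resolvent and the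
pairing of eigenvectors need the general form.\<close>

lemma matmul_vector_assoc:
  assumes M: "row_bound 0 a M" and N: "row_bound 0 b N" and u: "\<And>k. cmod (u k) \<le> c"
  shows "(\<Sum>\<^sub>\<infinity>k. M m k * (\<Sum>\<^sub>\<infinity>j. N k j * u j)) = (\<Sum>\<^sub>\<infinity>j. matmul M N m j * u j)"
proof -
  have Nu: "(\<lambda>j. N k j * u j) abs_summable_on UNIV" for k
    by (rule abs_summable_mult_bounded[OF row_bound_abs_summable(1)[OF N order_refl] u])
  have c: "0 \<le> c" using u[of undefined] norm_ge_zero order.trans by blast
  have b: "0 \<le> b" using row_bound_nonneg[OF N] .
  have "(\<lambda>(k,j). M m k * (N k j * u j)) abs_summable_on (UNIV \<times> UNIV)"
    unfolding Infinite_Sum.abs_summable_on_Sigma_iff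
  proof (intro conjI ballI)
    show "(\<lambda>j. case (k, j) of (k, j) \<Rightarrow> M m k * (N k j * u j)) abs_summable_on UNIV" for k
      using summable_on_cmult_right[OF Nu[of k], of "cmod (M m k)"] by (simp add: norm_mult)
    show "(\<lambda>k. \<Sum>\<^sub>\<infinity>j. norm (case (k, j) of (k, j) \<Rightarrow> M m k * (N k j * u j))) abs_summable_on UNIV"
    proof (rule Infinite_Sum.abs_summable_on_comparison_test)
      show "(\<lambda>k. complex_of_real (b * c) * M m k) abs_summable_on UNIV"
        using summable_on_cmult_right[OF row_bound_abs_summable(1)[OF M order_refl, of m], of "b*c"] b c
        by (simp add: norm_mult)
      fix k
      have "(\<Sum>\<^sub>\<infinity>j. cmod (N k j * u j)) \<le> b * c"
      proof (rule abs_summable_on_if_bounded(2))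
        fix F :: "(int^'a) set" assume F: "finite F"
        have "(\<Sum>j\<in>F. cmod (N k j * u j)) \<le> (\<Sum>j\<in>F. cmod (N k j) * c)"
          using u by (intro sum_mono) (auto simp: norm_mult intro!: mult_left_mono)
        also have "\<dots> \<le> b * c" using row_boundD[OF N F, of k] c
          by (simp add: sum_distrib_right[symmetric] mult_right_mono)
        finally show "(\<Sum>j\<in>F. cmod (N k j * u j)) \<le> b * c" .
      qed
      then have "cmod (M m k) * (\<Sum>\<^sub>\<infinity>j. cmod (N k j * u j)) \<le> cmod (M m k) * (b * c)" by (rule mult_left_mono) simp
      moreover have "0 \<le> cmod (M m k) * (\<Sum>\<^sub>\<infinity>j. cmod (N k j * u j))" by (intro mult_nonneg_nonneg infsum_nonneg) auto
      ultimately show "norm (\<Sum>\<^sub>\<infinity>j. norm (case (k, j) of (k, j) \<Rightarrow> M m k * (N k j * u j))) \<le> norm (complex_of_real (b * c) * M m k)"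
        using b c infsum_cmult_right[OF Nu[of k], of "cmod (M m k)"] by (simp add: norm_mult ac_simps)
    qed
  qed
  then have S: "(\<lambda>(k,j). M m k * (N k j * u j)) summable_on (UNIV \<times> UNIV)" by (rule abs_summable_summable)
  have "(\<Sum>\<^sub>\<infinity>k. M m k * (\<Sum>\<^sub>\<infinity>j. N k j * u j)) = (\<Sum>\<^sub>\<infinity>k. \<Sum>\<^sub>\<infinity>j. M m k * (N k j * u j))"
    using Nu by (simp add: infsum_cmult_right abs_summable_summable)
  also have "\<dots> = (\<Sum>\<^sub>\<infinity>j. \<Sum>\<^sub>\<infinity>k. M m k * (N k j * u j))" using S by (rule infsum_swap_banach)
  also have "\<dots> = (\<Sum>\<^sub>\<infinity>j. matmul M N m j * u j)"
    unfolding matmul_def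
    using abs_summable_summable[OF matmul_abs_summable[OF M order_refl N order_refl]]
    by (subst infsum_cmult_left[symmetric]) (auto simp: ac_simps)
  finally show ?thesis .
qed

lemma matmul_assoc:
  assumes M: "row_bound 0 a M" and N: "row_bound 0 b N" and L: "row_bound 0 c L"
  shows "matmul M (matmul N L) m n = matmul (matmul M N) L m n"
  using matmul_vector_assoc[OF M N, of "\<lambda>j. L j n" c m] row_bound_entry0[OF L order_refl]
  by (simp add: matmul_def)

lemma row_bound_add:
  assumes "row_bound \<rho> a M" "row_bound \<rho> b N"
  shows "row_bound \<rho> (a + b) (\<lambda>m n. M m n + N m n)"
  unfolding row_bound_def
proof (intro allI impI)
  fix m :: "int^'a" and F :: "(int^'a) set" assume F: "finite F"
  have "(\<Sum>n\<in>F. cmod (M m n + N m n) * exp (\<rho> * lnorm (m - n))) \<le>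
     (\<Sum>n\<in>F. cmod (M m n) * exp (\<rho> * lnorm (m - n)) + cmod (N m n) * exp (\<rho> * lnorm (m - n)))"
    by (intro sum_mono) (simp add: distrib_right[symmetric] norm_triangle_ineq)
  also have "\<dots> \<le> a + b" using row_boundD[OF assms(1) F, of m] row_boundD[OF assms(2) F, of m]
    by (simp add: sum.distrib)
  finally show "(\<Sum>n\<in>F. cmod (M m n + N m n) * exp (\<rho> * lnorm (m - n))) \<le> a + b" .
qed


section \<open>The Banach algebra of holomorphic families of decaying matrices\<close>

abbreviation disc :: "complex set" where "disc \<equiv> ball 0 1"

text \<open>The coupling is rescaled, \<open>\<epsilon> = r \<zeta>\<close>, so that all matrices depend on a parameter \<open>\<zeta>\<close> in the unit
disc and the admissible size of \<open>\<epsilon>\<close> is hidden in the perturbation.\<close>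

lemma holomorphic_disc_uniform_limit:
  assumes "F \<noteq> bot" "\<And>n. f n holomorphic_on disc" "uniform_limit disc f g F"
  shows "g holomorphic_on disc"
proof -
  have "g field_differentiable at z" if z: "z \<in> disc" for z
  proof -
    obtain r where r: "cmod z < r" "r < 1" using z dense[of "cmod z" 1] by auto
    have sub: "cball 0 r \<subseteq> disc" "ball 0 r \<subseteq> disc" using r by auto
    have "g holomorphic_on ball 0 r"
    proof (rule holomorphic_uniform_limit[of 0 r f F g])
      show "\<forall>\<^sub>F n in F. continuous_on (cball 0 r) (f n) \<and> f n holomorphic_on ball 0 r"
        using holomorphic_on_subset[OF assms(2) sub(1)] holomorphic_on_subset[OF assms(2) sub(2)]
        by (auto intro: always_eventually holomorphic_on_imp_continuous_on)
      show "uniform_limit (cball 0 r) f g F" using assms(3) sub(1) by (rule uniform_limit_on_subset)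
    qed (use assms(1) in auto)
    then show ?thesis using r by (intro holomorphic_on_imp_differentiable_at[of g "ball 0 r"]) auto
  qed
  then show ?thesis by (auto simp: holomorphic_on_def intro: field_differentiable_at_within)
qed

text \<open>The value zero off the disc makes extensional equality of families the equality of functions.
The rate \<open>1/2\<close> is the one that survives the iteration; better rates are tracked by
\<open>fam_bound\<close>.\<close>

definition decaying_family :: "(complex \<Rightarrow> int ^ 'd \<Rightarrow> int ^ 'd \<Rightarrow> complex) \<Rightarrow> bool" where
  "decaying_family A \<longleftrightarrow> (\<forall>\<zeta> m n. \<zeta> \<notin> disc \<longrightarrow> A \<zeta> m n = 0) \<and>
     (\<forall>m n. (\<lambda>\<zeta>. A \<zeta> m n) holomorphic_on disc) \<and> (\<exists>a. \<forall>\<zeta>\<in>disc. row_bound (1/2) a (A \<zeta>))"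

text \<open>Making these families a Banach algebra lets the iteration be written as ring identities, with
holomorphy in the parameter built into the type.\<close>

typedef (overloaded) ('d::finite) dmat = "{A :: complex \<Rightarrow> int ^ 'd \<Rightarrow> int ^ 'd \<Rightarrow> complex. decaying_family A}"
  morphisms ent Abs_dmat
  by (rule exI[of _ "\<lambda>_ _ _. 0"]) (auto simp: decaying_family_def row_bound_def)

setup_lifting type_definition_dmat

definition fam_bound :: "real \<Rightarrow> real \<Rightarrow> ('d::finite) dmat \<Rightarrow> bool" where
  "fam_bound \<rho> a A \<longleftrightarrow> (\<forall>\<zeta>\<in>disc. row_bound \<rho> a (ent A \<zeta>))"

lemma decaying_family_ent: "decaying_family (ent A)"
  using ent[of A] by simp

lemma ent_outside: "\<zeta> \<notin> disc \<Longrightarrow> ent A \<zeta> m n = 0"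
  using decaying_family_ent[of A] by (simp add: decaying_family_def)

lemma ent_holomorphic: "(\<lambda>\<zeta>. ent A \<zeta> m n) holomorphic_on disc"
  using decaying_family_ent[of A] by (simp add: decaying_family_def)

lemma ent_bounded: obtains a where "fam_bound (1/2) a A"
  using decaying_family_ent[of A] by (auto simp: decaying_family_def fam_bound_def)

lemma ent_bounded':
  obtains a where "\<And>\<zeta>. row_bound (1/2) a (ent A \<zeta>)"
proof -
  obtain a where a: "fam_bound (1/2) a A" by (rule ent_bounded)
  then have "0 \<le> a" using row_bound_nonneg[of "1/2" a "ent A 0"] by (simp add: fam_bound_def)
  then have "row_bound (1/2) a (ent A \<zeta>)" for \<zeta>
    using a by (cases "\<zeta> \<in> disc") (auto simp: fam_bound_def row_bound_def ent_outside)
  then show thesis by (rule that)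
qed

lemma dmat_eqI:
  assumes "\<And>\<zeta> m n. \<zeta> \<in> disc \<Longrightarrow> ent A \<zeta> m n = ent B \<zeta> m n"
  shows "A = B"
proof -
  have "ent A = ent B"
    by (intro ext) (metis assms ent_outside)
  then show ?thesis by (simp add: ent_inject)
qed

lemma row_bound_zero: "row_bound \<rho> 0 (\<lambda>m n. 0)"
  by (simp add: row_bound_def)

lemma row_bound_one: "row_bound \<rho> 1 (\<lambda>m n. if m = n then 1 else 0)"
  unfolding row_bound_def
proof (intro allI impI)
  fix m :: "int^'a" and F :: "(int^'a) set" assume F: "finite F"
  have "(\<Sum>n\<in>F. cmod (if m = n then 1 else 0) * exp (\<rho> * lnorm (m - n))) = (\<Sum>n\<in>F. if m = n then 1 else 0)"
    by (intro sum.cong) auto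
  also have "\<dots> \<le> 1" using F by (simp add: sum.delta)
  finally show "(\<Sum>n\<in>F. cmod (if m = n then 1 else 0) * exp (\<rho> * lnorm (m - n))) \<le> 1" .
qed

lemma row_bound_minus: "row_bound \<rho> a M \<Longrightarrow> row_bound \<rho> a (\<lambda>m n. - M m n)"
  by (simp add: row_bound_def)

lemma row_bound_scaleR: "row_bound \<rho> a M \<Longrightarrow> row_bound \<rho> (\<bar>c\<bar> * a) (\<lambda>m n. c *\<^sub>R M m n)"
  by (erule row_bound_dominated) auto

lemma row_bound_diff: "row_bound \<rho> a M \<Longrightarrow> row_bound \<rho> b N \<Longrightarrow> row_bound \<rho> (a + b) (\<lambda>m n. M m n - N m n)"
  using row_bound_add[OF _ row_bound_minus, of \<rho> a M b N] by simp

text \<open>The exponential decay of the rows of \<open>A\<close> is uniform in the parameter, hence the Weierstrass M-test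
applies to the sums that define the product.\<close>

lemma matmul_holomorphic:
  assumes A: "\<And>m n. (\<lambda>\<zeta>. A \<zeta> m n) holomorphic_on disc" "\<And>\<zeta>. \<zeta> \<in> disc \<Longrightarrow> row_bound (1/2) a (A \<zeta>)"
    and B: "\<And>m n. (\<lambda>\<zeta>. B \<zeta> m n) holomorphic_on disc" "\<And>\<zeta>. \<zeta> \<in> disc \<Longrightarrow> row_bound (1/2) b (B \<zeta>)"
  shows "(\<lambda>\<zeta>. matmul (A \<zeta>) (B \<zeta>) m n) holomorphic_on disc"
proof -
  have "0 \<le> a" using row_bound_nonneg[OF A(2)[of 0]] by simp
  have "uniform_limit disc (\<lambda>X \<zeta>. \<Sum>k\<in>X. A \<zeta> m k * B \<zeta> k n) (\<lambda>\<zeta>. \<Sum>\<^sub>\<infinity>k. A \<zeta> m k * B \<zeta> k n) (finite_subsets_at_top UNIV)"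
  proof (rule Weierstrass_m_test_general)
    show "(\<lambda>k. (a * b) * exp (- (1/2 * lnorm (m - k)))) summable_on UNIV"
      by (intro summable_on_cmult_right exp_lnorm_diff_summable) simp
    fix k \<zeta> assume \<zeta>: "\<zeta> \<in> disc"
    have "cmod (A \<zeta> m k * B \<zeta> k n) \<le> (a * exp (- (1/2 * lnorm (m - k)))) * b"
      unfolding norm_mult using row_bound_entry[OF A(2)[OF \<zeta>]] row_bound_entry0[OF B(2)[OF \<zeta>]] \<open>0 \<le> a\<close>
      by (intro mult_mono) auto
    then show "cmod (A \<zeta> m k * B \<zeta> k n) \<le> (a * b) * exp (- (1/2 * lnorm (m - k)))"
      by (simp add: ac_simps)
  qed
  then show ?thesis unfolding matmul_def
    by (rule holomorphic_disc_uniform_limit[rotated 2]) (auto intro!: holomorphic_intros A B)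
qed

instantiation dmat :: (finite) ring_1
begin

lift_definition zero_dmat :: "'a dmat" is "\<lambda>_ _ _. 0"
  by (auto simp: decaying_family_def intro: row_bound_zero)

lift_definition one_dmat :: "'a dmat" is "\<lambda>\<zeta> m n. if \<zeta> \<in> disc \<and> m = n then 1 else 0"
proof -
  have "(\<lambda>\<zeta>::complex. if \<zeta> \<in> disc \<and> m = n then 1 else 0::complex) holomorphic_on disc" for m n :: "int^'a"
    by (rule holomorphic_transform[of "\<lambda>_. if m = n then 1 else 0"]) auto
  then show "decaying_family (\<lambda>\<zeta> (m::int^'a) n. if \<zeta> \<in> disc \<and> m = n then 1 else 0)"
    using row_bound_one by (auto simp: decaying_family_def intro!: exI[of _ 1])
qed

lift_definition plus_dmat :: "'a dmat \<Rightarrow> 'a dmat \<Rightarrow> 'a dmat" is "\<lambda>A B \<zeta> m n. A \<zeta> m n + B \<zeta> m n"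
proof -
  fix A B :: "complex \<Rightarrow> int ^ 'a \<Rightarrow> int ^ 'a \<Rightarrow> complex"
  assume AB: "decaying_family A" "decaying_family B"
  then obtain a b where "\<forall>\<zeta>\<in>disc. row_bound (1/2) a (A \<zeta>)" "\<forall>\<zeta>\<in>disc. row_bound (1/2) b (B \<zeta>)"
    unfolding decaying_family_def by blast
  then have "\<exists>c. \<forall>\<zeta>\<in>disc. row_bound (1/2) c (\<lambda>m n. A \<zeta> m n + B \<zeta> m n)"
    by (intro exI[of _ "a + b"]) (simp add: row_bound_add)
  with AB show "decaying_family (\<lambda>\<zeta> m n. A \<zeta> m n + B \<zeta> m n)"
    unfolding decaying_family_def by (simp add: holomorphic_on_add)
qed

lift_definition minus_dmat :: "'a dmat \<Rightarrow> 'a dmat \<Rightarrow> 'a dmat" is "\<lambda>A B \<zeta> m n. A \<zeta> m n - B \<zeta> m n"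
proof -
  fix A B :: "complex \<Rightarrow> int ^ 'a \<Rightarrow> int ^ 'a \<Rightarrow> complex"
  assume AB: "decaying_family A" "decaying_family B"
  then obtain a b where "\<forall>\<zeta>\<in>disc. row_bound (1/2) a (A \<zeta>)" "\<forall>\<zeta>\<in>disc. row_bound (1/2) b (B \<zeta>)"
    unfolding decaying_family_def by blast
  then have "\<exists>c. \<forall>\<zeta>\<in>disc. row_bound (1/2) c (\<lambda>m n. A \<zeta> m n - B \<zeta> m n)"
    by (intro exI[of _ "a + b"]) (simp add: row_bound_diff)
  with AB show "decaying_family (\<lambda>\<zeta> m n. A \<zeta> m n - B \<zeta> m n)"
    unfolding decaying_family_def by (simp add: holomorphic_on_diff)
qed

lift_definition uminus_dmat :: "'a dmat \<Rightarrow> 'a dmat" is "\<lambda>A \<zeta> m n. - A \<zeta> m n"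
proof -
  fix A :: "complex \<Rightarrow> int ^ 'a \<Rightarrow> int ^ 'a \<Rightarrow> complex"
  assume A: "decaying_family A"
  then obtain a where "\<forall>\<zeta>\<in>disc. row_bound (1/2) a (A \<zeta>)"
    unfolding decaying_family_def by blast
  then have "\<exists>c. \<forall>\<zeta>\<in>disc. row_bound (1/2) c (\<lambda>m n. - A \<zeta> m n)"
    by (intro exI[of _ a]) (simp add: row_bound_minus)
  with A show "decaying_family (\<lambda>\<zeta> m n. - A \<zeta> m n)"
    unfolding decaying_family_def by (simp add: holomorphic_on_minus)
qed

lift_definition times_dmat :: "'a dmat \<Rightarrow> 'a dmat \<Rightarrow> 'a dmat" is "\<lambda>A B \<zeta>. matmul (A \<zeta>) (B \<zeta>)"
proof -
  fix A B :: "complex \<Rightarrow> int ^ 'a \<Rightarrow> int ^ 'a \<Rightarrow> complex"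
  assume "decaying_family A" "decaying_family B"
  then obtain a b where ab: "\<And>m n. (\<lambda>\<zeta>. A \<zeta> m n) holomorphic_on disc" "\<And>\<zeta>. \<zeta> \<in> disc \<Longrightarrow> row_bound (1/2) a (A \<zeta>)"
    "\<And>m n. (\<lambda>\<zeta>. B \<zeta> m n) holomorphic_on disc" "\<And>\<zeta>. \<zeta> \<in> disc \<Longrightarrow> row_bound (1/2) b (B \<zeta>)"
    "\<And>\<zeta> m n. \<zeta> \<notin> disc \<Longrightarrow> A \<zeta> m n = 0"
    unfolding decaying_family_def by meson
  show "decaying_family (\<lambda>\<zeta>. matmul (A \<zeta>) (B \<zeta>))"
    unfolding decaying_family_def
  proof (intro conjI allI impI exI ballI)
    show "matmul (A \<zeta>) (B \<zeta>) m n = 0" if "\<zeta> \<notin> disc" for \<zeta> m n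
      using ab(5)[OF that] by (simp add: matmul_def)
    show "(\<lambda>\<zeta>. matmul (A \<zeta>) (B \<zeta>) m n) holomorphic_on disc" for m n
      by (rule matmul_holomorphic[OF ab(1-4)])
    show "row_bound (1/2) (a * b) (matmul (A \<zeta>) (B \<zeta>))" if "\<zeta> \<in> disc" for \<zeta>
      using that by (intro row_bound_matmul ab) auto
  qed
qed

lemma ent_zero [simp]: "ent 0 \<zeta> m n = 0" by transfer simp
lemma ent_one: "\<zeta> \<in> disc \<Longrightarrow> ent 1 \<zeta> m n = (if m = n then 1 else 0)" by transfer simp
lemma ent_add [simp]: "ent (A + B) \<zeta> m n = ent A \<zeta> m n + ent B \<zeta> m n" by transfer simp
lemma ent_diff [simp]: "ent (A - B) \<zeta> m n = ent A \<zeta> m n - ent B \<zeta> m n" by transfer simp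
lemma ent_uminus [simp]: "ent (- A) \<zeta> m n = - ent A \<zeta> m n" by transfer simp
lemma ent_times: "ent (A * B) \<zeta> m n = (\<Sum>\<^sub>\<infinity>k. ent A \<zeta> m k * ent B \<zeta> k n)"
  by transfer (simp add: matmul_def)

lemma ent_times_abs_summable: "(\<lambda>k. ent A \<zeta> m k * ent B \<zeta> k n) abs_summable_on UNIV"
proof -
  obtain a b where "\<And>\<zeta>. row_bound (1/2) a (ent A \<zeta>)" "\<And>\<zeta>. row_bound (1/2) b (ent B \<zeta>)"
    using ent_bounded'[of A] ent_bounded'[of B] by metis
  then show ?thesis by (intro matmul_abs_summable) auto
qed

lemmas ent_times_summable = abs_summable_summable[OF ent_times_abs_summable]

instance
proof
  fix a b c :: "'a dmat"
  show "a * b * c = a * (b * c)"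
  proof (rule dmat_eqI)
    fix \<zeta> m n
    obtain x y z where *: "\<And>\<zeta>. row_bound (1/2) x (ent a \<zeta>)" "\<And>\<zeta>. row_bound (1/2) y (ent b \<zeta>)" "\<And>\<zeta>. row_bound (1/2) z (ent c \<zeta>)"
      using ent_bounded'[of a] ent_bounded'[of b] ent_bounded'[of c] by metis
    have "row_bound 0 x (ent a \<zeta>)" "row_bound 0 y (ent b \<zeta>)" "row_bound 0 z (ent c \<zeta>)"
      using *[of \<zeta>] by (auto intro: row_bound_mono)
    from matmul_assoc[OF this] show "ent (a * b * c) \<zeta> m n = ent (a * (b * c)) \<zeta> m n"
      by (simp add: times_dmat.rep_eq)
  qed
  show "1 * a = a"
  proof (rule dmat_eqI)
    fix \<zeta> m n assume \<zeta>: "\<zeta> \<in> disc"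
    have "ent (1 * a) \<zeta> m n = (\<Sum>\<^sub>\<infinity>k\<in>{m}. ent 1 \<zeta> m k * ent a \<zeta> k n)"
      unfolding ent_times by (rule infsum_cong_neutral) (auto simp: ent_one[OF \<zeta>])
    then show "ent (1 * a) \<zeta> m n = ent a \<zeta> m n" by (simp add: ent_one[OF \<zeta>])
  qed
  show "a * 1 = a"
  proof (rule dmat_eqI)
    fix \<zeta> m n assume \<zeta>: "\<zeta> \<in> disc"
    have "ent (a * 1) \<zeta> m n = (\<Sum>\<^sub>\<infinity>k\<in>{n}. ent a \<zeta> m k * ent 1 \<zeta> k n)"
      unfolding ent_times by (rule infsum_cong_neutral) (auto simp: ent_one[OF \<zeta>])
    then show "ent (a * 1) \<zeta> m n = ent a \<zeta> m n" by (simp add: ent_one[OF \<zeta>])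
  qed
  show "(a + b) * c = a * c + b * c"
    by (rule dmat_eqI) (simp add: ent_times distrib_right infsum_add ent_times_summable)
  show "a * (b + c) = a * b + a * c"
    by (rule dmat_eqI) (simp add: ent_times distrib_left infsum_add ent_times_summable)
  show "(0::'a dmat) \<noteq> 1"
  proof
    assume "(0::'a dmat) = 1"
    then have "ent (0::'a dmat) 0 0 0 = ent 1 0 0 0" by simp
    then show False by (simp add: ent_one)
  qed
qed (rule dmat_eqI, simp)+

end

lemma fam_bound_nonneg: "fam_bound \<rho> a A \<Longrightarrow> 0 \<le> a"
  using row_bound_nonneg[of \<rho> a "ent A 0"] by (simp add: fam_bound_def)

lemma fam_bound_mono: "fam_bound \<rho> a A \<Longrightarrow> \<rho>' \<le> \<rho> \<Longrightarrow> a \<le> a' \<Longrightarrow> fam_bound \<rho>' a' A"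
  by (auto simp: fam_bound_def intro: row_bound_mono)

lemma fam_bound_add: "fam_bound \<rho> a A \<Longrightarrow> fam_bound \<rho> b B \<Longrightarrow> fam_bound \<rho> (a + b) (A + B)"
  by (auto simp: fam_bound_def plus_dmat.rep_eq intro: row_bound_add)

lemma fam_bound_diff: "fam_bound \<rho> a A \<Longrightarrow> fam_bound \<rho> b B \<Longrightarrow> fam_bound \<rho> (a + b) (A - B)"
  by (auto simp: fam_bound_def minus_dmat.rep_eq intro: row_bound_diff)

lemma fam_bound_minus: "fam_bound \<rho> a A \<Longrightarrow> fam_bound \<rho> a (- A)"
  by (auto simp: fam_bound_def uminus_dmat.rep_eq intro: row_bound_minus)

lemma fam_bound_times: "fam_bound \<rho> a A \<Longrightarrow> fam_bound \<rho> b B \<Longrightarrow> 0 \<le> \<rho> \<Longrightarrow> fam_bound \<rho> (a * b) (A * B)"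
  by (auto simp: fam_bound_def times_dmat.rep_eq intro: row_bound_matmul)

lemma fam_bound_one: "fam_bound \<rho> 1 1"
  unfolding fam_bound_def
proof
  fix \<zeta> :: complex assume "\<zeta> \<in> disc"
  then have "ent (1 :: 'a dmat) \<zeta> = (\<lambda>m n. if m = n then 1 else 0)" by (intro ext) (simp add: ent_one)
  then show "row_bound \<rho> 1 (ent (1 :: 'a dmat) \<zeta>)" by (simp add: row_bound_one)
qed

lemma fam_bound_zero: "fam_bound \<rho> 0 0"
  by (auto simp: fam_bound_def row_bound_def)

instantiation dmat :: (finite) real_normed_algebra_1
begin

lift_definition scaleR_dmat :: "real \<Rightarrow> 'a dmat \<Rightarrow> 'a dmat" is "\<lambda>c A \<zeta> m n. c *\<^sub>R A \<zeta> m n"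
proof -
  fix c and A :: "complex \<Rightarrow> int ^ 'a \<Rightarrow> int ^ 'a \<Rightarrow> complex"
  assume A: "decaying_family A"
  then obtain a where "\<And>\<zeta>. \<zeta> \<in> disc \<Longrightarrow> row_bound (1/2) a (A \<zeta>)" unfolding decaying_family_def by blast
  then have "\<exists>a. \<forall>\<zeta>\<in>disc. row_bound (1/2) a (\<lambda>m n. c *\<^sub>R A \<zeta> m n)"
    by (intro exI[of _ "\<bar>c\<bar> * a"]) (auto intro: row_bound_scaleR)
  then show "decaying_family (\<lambda>\<zeta> m n. c *\<^sub>R A \<zeta> m n)"
    using A by (auto simp: decaying_family_def intro!: holomorphic_intros simp: scaleR_conv_of_real)
qed

lemma ent_scaleR [simp]: "ent (c *\<^sub>R A) \<zeta> m n = c *\<^sub>R ent A \<zeta> m n" by transfer simp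

definition norm_dmat :: "'a dmat \<Rightarrow> real" where
  "norm_dmat A = Inf {a. fam_bound (1/2) a A}"

definition dist_dmat :: "'a dmat \<Rightarrow> 'a dmat \<Rightarrow> real" where
  "dist_dmat A B = norm (A - B)"

definition sgn_dmat :: "'a dmat \<Rightarrow> 'a dmat" where
  "sgn_dmat A = inverse (norm A) *\<^sub>R A"

definition uniformity_dmat :: "('a dmat \<times> 'a dmat) filter" where
  "uniformity_dmat = (INF e\<in>{0<..}. principal {(x, y). dist x y < e})"

definition open_dmat :: "'a dmat set \<Rightarrow> bool" where
  "open_dmat U \<longleftrightarrow> (\<forall>x\<in>U. eventually (\<lambda>(x', y). x' = x \<longrightarrow> y \<in> U) uniformity)"

lemma norm_dmat_le_iff: "norm (A :: 'a dmat) \<le> a \<longleftrightarrow> fam_bound (1/2) a A"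
proof
  have bdd: "bdd_below {a. fam_bound (1/2) a A}" by (auto intro!: bdd_belowI[of _ 0] fam_bound_nonneg)
  obtain b where b: "fam_bound (1/2) b A" by (rule ent_bounded)
  {
    assume a: "norm A \<le> a"
    have "fam_bound (1/2) (norm A) A"
      unfolding fam_bound_def row_bound_def norm_dmat_def
      using b by (auto intro!: cInf_greatest simp: fam_bound_def row_bound_def)
    then show "fam_bound (1/2) a A" using a by (rule fam_bound_mono[OF _ order_refl])
  next
    assume "fam_bound (1/2) a A"
    then show "norm A \<le> a" unfolding norm_dmat_def using bdd by (intro cInf_lower) auto
  }
qed

lemma fam_bound_norm: "fam_bound (1/2) (norm A) (A :: 'a dmat)"
  using norm_dmat_le_iff by blast

lemma norm_ent_le: "cmod (ent A \<zeta> m n) \<le> norm (A :: 'a dmat) * exp (- (1/2 * lnorm (m - n)))"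
proof (cases "\<zeta> \<in> disc")
  case True
  then have "row_bound (1/2) (norm A) (ent A \<zeta>)" using fam_bound_norm[of A] by (simp add: fam_bound_def)
  then show ?thesis by (rule row_bound_entry)
next
  case False
  have "0 \<le> norm A" using fam_bound_norm[of A] fam_bound_nonneg by blast
  then show ?thesis using False by (simp add: ent_outside)
qed

instance
proof
  fix x y :: "'a dmat" and a b :: real
  show "a *\<^sub>R (x + y) = a *\<^sub>R x + a *\<^sub>R y" by (rule dmat_eqI) (simp add: algebra_simps)
  show "(a + b) *\<^sub>R x = a *\<^sub>R x + b *\<^sub>R x" by (rule dmat_eqI) (simp add: algebra_simps)
  show "a *\<^sub>R b *\<^sub>R x = (a * b) *\<^sub>R x" by (rule dmat_eqI) simp
  show "1 *\<^sub>R x = x" by (rule dmat_eqI) simp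
  show "a *\<^sub>R x * y = a *\<^sub>R (x * y)"
    by (rule dmat_eqI) (simp add: ent_times scaleR_conv_of_real mult.assoc infsum_cmult_right ent_times_summable)
  show "x * a *\<^sub>R y = a *\<^sub>R (x * y)"
    by (rule dmat_eqI) (simp add: ent_times scaleR_conv_of_real mult.left_commute infsum_cmult_right ent_times_summable)
  have nn: "0 \<le> norm z" for z :: "'a dmat"
    using fam_bound_norm[of z] by (rule fam_bound_nonneg)
  show "(norm x = 0) = (x = 0)"
  proof
    assume "norm x = 0"
    then show "x = 0" using norm_ent_le[of x] by (intro dmat_eqI) simp
  next
    assume "x = 0"
    then show "norm x = 0" using nn[of x] norm_dmat_le_iff[of x 0] fam_bound_zero by auto
  qed
  show "norm (x + y) \<le> norm x + norm y"
    using fam_bound_add[OF fam_bound_norm fam_bound_norm] norm_dmat_le_iff by blast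
  show "norm (x * y) \<le> norm x * norm y"
    using fam_bound_times[OF fam_bound_norm fam_bound_norm] norm_dmat_le_iff by fastforce
  have le: "norm (c *\<^sub>R z) \<le> \<bar>c\<bar> * norm z" for c and z :: "'a dmat"
    unfolding norm_dmat_le_iff using fam_bound_norm[of z]
    by (auto simp: fam_bound_def scaleR_dmat.rep_eq intro: row_bound_scaleR)
  show "norm (a *\<^sub>R x) = \<bar>a\<bar> * norm x"
  proof (cases "a = 0")
    case True
    then show ?thesis using le[of 0 x] nn[of "0 *\<^sub>R x"] by simp
  next
    case False
    have "inverse a *\<^sub>R a *\<^sub>R x = x" using False by (intro dmat_eqI) simp
    then have "norm x \<le> \<bar>inverse a\<bar> * norm (a *\<^sub>R x)" using le[of "inverse a" "a *\<^sub>R x"] by simp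
    then have "\<bar>a\<bar> * norm x \<le> norm (a *\<^sub>R x)" using False by (simp add: field_simps)
    then show ?thesis using le[of a x] by simp
  qed
  show "norm (1 :: 'a dmat) = 1"
  proof (rule antisym)
    show "norm (1 :: 'a dmat) \<le> 1" using fam_bound_one norm_dmat_le_iff by blast
    show "1 \<le> norm (1 :: 'a dmat)" using norm_ent_le[of "1 :: 'a dmat" 0 0 0] by (simp add: ent_one)
  qed
  show "dist x y = norm (x - y)" by (rule dist_dmat_def)
  show "sgn x = inverse (norm x) *\<^sub>R x" by (rule sgn_dmat_def)
  show "(uniformity :: ('a dmat \<times> 'a dmat) filter) = (INF e\<in>{0<..}. principal {(x, y). dist x y < e})"
    by (rule uniformity_dmat_def)
  show "open U = (\<forall>x\<in>U. \<forall>\<^sub>F (x', y) in uniformity. x' = x \<longrightarrow> y \<in> U)" for U :: "'a dmat set"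
    by (rule open_dmat_def)
qed

end

lemma norm_ent_le': "cmod (ent A \<zeta> m n) \<le> norm (A :: 'd::finite dmat)"
proof -
  have "norm A * exp (- (1/2 * lnorm (m - n))) \<le> norm A * 1" by (intro mult_left_mono) auto
  then show ?thesis using norm_ent_le[of A \<zeta> m n] by linarith
qed

lemma tendsto_ent:
  assumes "(X \<longlongrightarrow> (L :: 'd::finite dmat)) F"
  shows "((\<lambda>i. ent (X i) \<zeta> m n) \<longlongrightarrow> ent L \<zeta> m n) F"
proof -
  have "((\<lambda>i. norm (X i - L)) \<longlongrightarrow> 0) F" by (rule tendsto_norm_zero[OF LIM_zero[OF assms]])
  moreover have "\<forall>\<^sub>F i in F. norm (ent (X i) \<zeta> m n - ent L \<zeta> m n) \<le> norm (X i - L)"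
    by (intro always_eventually allI) (metis ent_diff norm_ent_le')
  ultimately show ?thesis by (rule LIM_zero_cancel[OF Lim_null_comparison, rotated])
qed

text \<open>Entries of a Cauchy sequence converge uniformly on the disc, so the limit is holomorphic; the
row bounds of the differences pass to the limit because they only involve finite sums.\<close>

instance dmat :: (finite) banach
proof
  fix X :: "nat \<Rightarrow> 'a dmat" assume X: "Cauchy X"
  define L where "L = (\<lambda>\<zeta> m n. lim (\<lambda>i. ent (X i) \<zeta> m n))"
  have ev: "\<exists>N. \<forall>i\<ge>N. \<forall>j\<ge>N. norm (X i - X j) \<le> e" if "e > 0" for e
    using X that unfolding Cauchy_iff by (meson less_imp_le)
  have "Cauchy (\<lambda>i. ent (X i) \<zeta> m n)" for \<zeta> m n
    unfolding Cauchy_iff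
  proof (intro allI impI)
    fix e :: real assume "0 < e"
    then obtain N where N: "\<forall>i\<ge>N. \<forall>j\<ge>N. norm (X i - X j) < e" using X by (auto simp: Cauchy_iff)
    then show "\<exists>M. \<forall>i\<ge>M. \<forall>j\<ge>M. norm (ent (X i) \<zeta> m n - ent (X j) \<zeta> m n) < e"
      using le_less_trans[OF norm_ent_le'[of "X _ - X _" \<zeta> m n]] unfolding ent_diff by blast
  qed
  then have lim: "(\<lambda>i. ent (X i) \<zeta> m n) \<longlonglongrightarrow> L \<zeta> m n" for \<zeta> m n
    unfolding L_def by (simp add: Cauchy_convergent_iff convergent_LIMSEQ_iff)
  have rb: "row_bound (1/2) e (\<lambda>m n. ent (X i) \<zeta> m n - L \<zeta> m n)" if e: "\<forall>j\<ge>N. norm (X i - X j) \<le> e" and \<zeta>: "\<zeta> \<in> disc" for e i \<zeta> N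
    unfolding row_bound_def
  proof (intro allI impI)
    fix m :: "int^'a" and F :: "(int^'a) set" assume F: "finite F"
    have "(\<lambda>j. \<Sum>n\<in>F. cmod (ent (X i) \<zeta> m n - ent (X j) \<zeta> m n) * exp (1/2 * lnorm (m - n))) \<longlonglongrightarrow>
       (\<Sum>n\<in>F. cmod (ent (X i) \<zeta> m n - L \<zeta> m n) * exp (1/2 * lnorm (m - n)))"
      by (intro tendsto_intros lim)
    moreover have "(\<Sum>n\<in>F. cmod (ent (X i) \<zeta> m n - ent (X j) \<zeta> m n) * exp (1/2 * lnorm (m - n))) \<le> e" if "j \<ge> N" for j
    proof -
      have "fam_bound (1/2) e (X i - X j)" using e that norm_dmat_le_iff by blast
      then show ?thesis using \<zeta> row_boundD[OF _ F, of "1/2" e "ent (X i - X j) \<zeta>" m] by (simp add: fam_bound_def)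
    qed
    ultimately show "(\<Sum>n\<in>F. cmod (ent (X i) \<zeta> m n - L \<zeta> m n) * exp (1/2 * lnorm (m - n))) \<le> e"
      by (meson LIMSEQ_le_const2)
  qed
  have uni: "uniform_limit disc (\<lambda>i \<zeta>. ent (X i) \<zeta> m n) (\<lambda>\<zeta>. L \<zeta> m n) sequentially" for m n
  proof (rule uniform_limitI)
    fix e :: real assume "0 < e"
    then obtain N where N: "\<forall>i\<ge>N. \<forall>j\<ge>N. norm (X i - X j) \<le> e / 2" using ev[of "e/2"] by auto
    have "dist (ent (X i) \<zeta> m n) (L \<zeta> m n) < e" if "i \<ge> N" "\<zeta> \<in> disc" for i \<zeta>
    proof -
      have "row_bound (1/2) (e/2) (\<lambda>m n. ent (X i) \<zeta> m n - L \<zeta> m n)"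
        using N that by (intro rb[of N]) auto
      from row_bound_entry0[OF this, of m n] show ?thesis using \<open>0 < e\<close> by (simp add: dist_norm)
    qed
    then show "\<forall>\<^sub>F i in sequentially. \<forall>\<zeta>\<in>disc. dist (ent (X i) \<zeta> m n) (L \<zeta> m n) < e"
      unfolding eventually_sequentially by blast
  qed
  have "decaying_family L"
    unfolding decaying_family_def
  proof (intro conjI allI impI)
    show "L \<zeta> m n = 0" if "\<zeta> \<notin> disc" for \<zeta> m n
      using lim[of \<zeta> m n] that by (simp add: ent_outside LIMSEQ_const_iff)
    show "(\<lambda>\<zeta>. L \<zeta> m n) holomorphic_on disc" for m n
      by (rule holomorphic_disc_uniform_limit[OF _ ent_holomorphic uni]) simp
    obtain N where N: "\<forall>i\<ge>N. \<forall>j\<ge>N. norm (X i - X j) \<le> 1" using ev[of 1] by auto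
    have "row_bound (1/2) (norm (X N) + 1) (\<lambda>m n. ent (X N) \<zeta> m n - (ent (X N) \<zeta> m n - L \<zeta> m n))" if "\<zeta> \<in> disc" for \<zeta>
      using fam_bound_norm[of "X N"] that N by (intro row_bound_diff rb[of N]) (auto simp: fam_bound_def)
    then have "\<forall>\<zeta>\<in>disc. row_bound (1/2) (norm (X N) + 1) (L \<zeta>)" by simp
    then show "\<exists>a. \<forall>\<zeta>\<in>disc. row_bound (1/2) a (L \<zeta>)" by blast
  qed
  then have L: "ent (Abs_dmat L) = L" by (simp add: Abs_dmat_inverse)
  have "X \<longlonglongrightarrow> Abs_dmat L"
  proof (rule LIMSEQ_I)
    fix e :: real assume "0 < e"
    then obtain N where N: "\<forall>i\<ge>N. \<forall>j\<ge>N. norm (X i - X j) \<le> e / 2" using ev[of "e/2"] by auto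
    have "norm (X i - Abs_dmat L) \<le> e / 2" if "i \<ge> N" for i
      unfolding norm_dmat_le_iff fam_bound_def using rb[of N i "e/2"] N that by (auto simp: minus_dmat.rep_eq L)
    then show "\<exists>N. \<forall>i\<ge>N. norm (X i - Abs_dmat L) < e" using \<open>0 < e\<close> by (intro exI[of _ N]) force
  qed
  then show "convergent X" by (auto simp: convergent_def)
qed

text \<open>The tool by which an algebra element is cut down or divided entrywise: any family of holomorphic
entries dominated by those of \<open>A\<close> is again an element of the algebra.\<close>

lemma dmat_entrywise:
  fixes A :: "'d::finite dmat"
  assumes A: "fam_bound \<rho> a A" and \<rho>: "1/2 \<le> \<rho>'" and \<kappa>: "0 \<le> \<kappa>"
    and hol: "\<And>m n. (\<lambda>\<zeta>. X \<zeta> m n) holomorphic_on disc"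
    and le: "\<And>\<zeta> m n. \<zeta> \<in> disc \<Longrightarrow> cmod (X \<zeta> m n) * exp (\<rho>' * lnorm (m - n)) \<le> \<kappa> * (cmod (ent A \<zeta> m n) * exp (\<rho> * lnorm (m - n)))"
  obtains B where "\<And>\<zeta> m n. \<zeta> \<in> disc \<Longrightarrow> ent B \<zeta> m n = X \<zeta> m n" "fam_bound \<rho>' (\<kappa> * a) B"
proof -
  have rb: "row_bound \<rho>' (\<kappa> * a) (X \<zeta>)" if "\<zeta> \<in> disc" for \<zeta>
    using row_bound_dominated[of \<rho> a "ent A \<zeta>" "X \<zeta>" \<rho>' \<kappa>] A le \<kappa> that by (auto simp: fam_bound_def)
  define Y where "Y = (\<lambda>\<zeta> m n. if \<zeta> \<in> disc then X \<zeta> m n else 0)"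
  have "(\<lambda>\<zeta>. Y \<zeta> m n) holomorphic_on disc" for m n
    by (rule holomorphic_transform[OF hol[of m n]]) (auto simp: Y_def)
  moreover have "row_bound (1/2) (\<kappa> * a) (Y \<zeta>)" if "\<zeta> \<in> disc" for \<zeta>
    using row_bound_mono[OF rb[OF that] \<rho> order_refl] that by (simp add: Y_def)
  moreover have "Y \<zeta> m n = 0" if "\<zeta> \<notin> disc" for \<zeta> m n using that by (simp add: Y_def)
  ultimately have "decaying_family Y" unfolding decaying_family_def by blast
  then have "ent (Abs_dmat Y) = Y" by (simp add: Abs_dmat_inverse)
  with rb show thesis by (intro that[of "Abs_dmat Y"]) (auto simp: Y_def fam_bound_def)
qed

lemma fam_bound_limit:
  fixes L :: "'d::finite dmat"
  assumes X: "X \<longlonglongrightarrow> L" and bd: "\<And>i::nat. fam_bound \<rho> a (X i)"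
  shows "fam_bound \<rho> a L"
  unfolding fam_bound_def row_bound_def
proof (intro ballI allI impI)
  fix \<zeta> :: complex and m and F :: "(int^'d) set" assume \<zeta>: "\<zeta> \<in> disc" and F: "finite F"
  have "(\<lambda>i. \<Sum>n\<in>F. cmod (ent (X i) \<zeta> m n) * exp (\<rho> * lnorm (m - n))) \<longlonglongrightarrow>
     (\<Sum>n\<in>F. cmod (ent L \<zeta> m n) * exp (\<rho> * lnorm (m - n)))"
    by (intro tendsto_sum tendsto_mult tendsto_norm tendsto_const tendsto_ent[OF X])
  moreover have "\<exists>N. \<forall>i\<ge>N. (\<Sum>n\<in>F. cmod (ent (X i) \<zeta> m n) * exp (\<rho> * lnorm (m - n))) \<le> a"
    using bd \<zeta> F by (auto simp: fam_bound_def row_bound_def)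
  ultimately show "(\<Sum>n\<in>F. cmod (ent L \<zeta> m n) * exp (\<rho> * lnorm (m - n))) \<le> a"
    by (rule LIMSEQ_le_const2)
qed

lemma fam_bound_power:
  assumes "fam_bound \<rho> w W" "0 \<le> \<rho>"
  shows "fam_bound \<rho> (w ^ i) (W ^ i)"
  using assms by (induction i) (simp_all add: fam_bound_one fam_bound_times)

text \<open>The bound at the rate \<open>\<rho>\<close> is needed besides the norm: the next remainder of the iteration is
the inverse times a small element, both measured at the current rate of decay.\<close>

lemma dmat_neumann:
  fixes W :: "'d::finite dmat"
  assumes W: "fam_bound \<rho> w W" and \<rho>: "1/2 \<le> \<rho>" and w: "w \<le> 1/2"
  obtains Y where "(1 + W) * Y = 1" "Y * (1 + W) = 1" "fam_bound \<rho> 2 Y"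
proof -
  define x where "x = - W"
  have x: "fam_bound \<rho> w x" using W by (simp add: x_def fam_bound_minus)
  have w0: "0 \<le> w" using W by (rule fam_bound_nonneg)
  have "norm x \<le> w" unfolding norm_dmat_le_iff using x \<rho> by (rule fam_bound_mono) simp
  then have "norm x < 1" using w by simp
  then have s: "summable (\<lambda>i. x ^ i)" by (rule complete_algebra_summable_geometric)
  define Y where "Y = (\<Sum>i. x ^ i)"
  have h: "(\<Sum>i. x ^ Suc i) = Y - 1" using suminf_split_head[OF s] by (simp add: Y_def)
  have "x * Y = Y - 1" using suminf_mult[OF s, of x] h by (simp add: Y_def)
  then have 1: "(1 + W) * Y = 1" by (simp add: x_def algebra_simps)
  have "Y * x = Y - 1" using suminf_mult2[OF s, of x] h by (simp add: Y_def power_commutes)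
  then have 2: "Y * (1 + W) = 1" by (simp add: x_def algebra_simps)
  have part: "fam_bound \<rho> (\<Sum>i<n. w ^ i) (\<Sum>i<n. x ^ i)" for n
    using \<rho> by (induction n) (auto intro!: fam_bound_zero fam_bound_add fam_bound_power[OF x])
  have "(\<Sum>i<n. w ^ i) \<le> 2" for n
  proof -
    have "(\<Sum>i<n. w ^ i) \<le> (\<Sum>i<n. (1/2) ^ i)" using w w0 by (intro sum_mono power_mono) auto
    also have "\<dots> \<le> 2" by (simp add: geometric_sum)
    finally show ?thesis .
  qed
  then have "fam_bound \<rho> 2 (\<Sum>i<n. x ^ i)" for n using part by (rule fam_bound_mono[rotated 2]) simp
  then have 3: "fam_bound \<rho> 2 Y" using summable_LIMSEQ[OF s] unfolding Y_def by (rule fam_bound_limit[rotated])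
  show thesis by (rule that[OF 1 2 3])
qed


section \<open>Level differences of approximate eigenvectors\<close>

definition lattice_sum :: "'d::finite itself \<Rightarrow> real" where
  "lattice_sum _ = (\<Sum>\<^sub>\<infinity>j::int^'d. exp (- lnorm j))"

lemma exp_lnorm_has_sum: "((\<lambda>j::int^'d::finite. exp (- lnorm j)) has_sum lattice_sum TYPE('d)) UNIV"
  using has_sum_infsum[OF exp_lnorm_summable[of 1, where 'd = 'd]] by (simp add: lattice_sum_def)

lemma lattice_sum_ge_1: "1 \<le> lattice_sum TYPE('d::finite)"
  using finite_sum_le_has_sum[OF exp_lnorm_has_sum, of "{0::int^'d}"] by simp

text \<open>Separates the term at the origin, which carries the main contribution in the estimates below,
from a remainder of exponentially decaying terms.\<close>

lemma lattice_sum_split: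
  fixes f :: "int^'d::finite \<Rightarrow> complex"
  assumes "\<And>j. j \<noteq> 0 \<Longrightarrow> cmod (f j) \<le> K * exp (- lnorm j)"
  shows "f abs_summable_on UNIV" "cmod (infsum f UNIV - f 0) \<le> K * lattice_sum TYPE('d)"
proof -
  define g where "g = (\<lambda>j. if j = 0 then 0 else f j)"
  have K: "0 \<le> K"
  proof -
    obtain j :: "int^'d" where "j \<noteq> 0" by (metis one_neq_zero)
    from order.trans[OF norm_ge_zero assms[OF this]] show ?thesis by (simp add: zero_le_mult_iff)
  qed
  have gK: "cmod (g j) \<le> K * exp (- lnorm j)" for j using assms K by (simp add: g_def)
  have Ks: "((\<lambda>j::int^'d. K * exp (- lnorm j)) has_sum (K * lattice_sum TYPE('d))) UNIV"
    by (rule has_sum_cmult_right[OF exp_lnorm_has_sum])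
  have gs: "g abs_summable_on UNIV"
    using has_sum_imp_summable[OF Ks] gK by (rule Infinite_Sum.abs_summable_on_comparison_test')
  have "(\<lambda>j. norm (g j) + norm (if j = 0 then f 0 else 0)) summable_on UNIV"
  proof (rule summable_on_add[OF gs])
    show "(\<lambda>j. norm (if j = 0 then f 0 else 0)) summable_on UNIV"
      by (rule has_sum_imp_summable[OF has_sum_finite_neutralI[of "{0}" UNIV _ "norm (f 0)"]]) auto
  qed
  moreover have "(\<lambda>j. norm (g j) + norm (if j = 0 then f 0 else 0)) = (\<lambda>j. norm (f j))" by (auto simp: g_def)
  ultimately show fs: "f abs_summable_on UNIV" by simp
  have d0: "((\<lambda>j. if j = 0 then f 0 else 0) has_sum f 0) UNIV"
    by (rule has_sum_finite_neutralI[of "{0}"]) auto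
  have "((\<lambda>j. g j + (if j = 0 then f 0 else 0)) has_sum (infsum g UNIV + f 0)) UNIV"
    using abs_summable_summable[OF gs] by (intro has_sum_add d0) simp
  moreover have "(\<lambda>j. g j + (if j = 0 then f 0 else 0)) = f" by (auto simp: g_def)
  ultimately have "infsum f UNIV = infsum g UNIV + f 0" by (simp add: infsumI)
  then have "cmod (infsum f UNIV - f 0) = cmod (infsum g UNIV)" by simp
  also have "\<dots> \<le> K * lattice_sum TYPE('d)"
    using norm_infsum_le[OF _ Ks gK] abs_summable_summable[OF gs] by simp
  finally show "cmod (infsum f UNIV - f 0) \<le> K * lattice_sum TYPE('d)" .
qed

lemma ent_column_abs_summable: "(\<lambda>j. ent (T :: 'd::finite dmat) \<zeta> (q + j) n) abs_summable_on UNIV"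
proof (rule Infinite_Sum.abs_summable_on_comparison_test')
  have "(\<lambda>j::int^'d. exp (- (1/2 * lnorm ((n - q) - j)))) summable_on UNIV"
    by (rule exp_lnorm_diff_summable) simp
  then show "(\<lambda>j::int^'d. norm T * exp (- (1/2 * lnorm ((n - q) - j)))) summable_on UNIV"
    by (rule summable_on_cmult_right)
  fix j
  have "lnorm ((n - q) - j) = lnorm (q + j - n)"
    by (subst lnorm_minus_commute) (simp add: algebra_simps)
  then show "norm (ent T \<zeta> (q + j) n) \<le> norm T * exp (- (1/2 * lnorm ((n - q) - j)))"
    using norm_ent_le[of T \<zeta> "q + j" n] by simp
qed

text \<open>\<open>v\<close> is the diagonal part and \<open>P\<close> the convolution, as a family in the rescaled coupling.
\<open>toeplitz\<close> says that \<open>P\<close> is a convolution and \<open>hermitian\<close> that it is self-adjoint for real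
parameters, in the form that makes sense for complex ones.  \<open>Z\<close> is a name for a constant
that depends only on the dimension.\<close>

locale perturbed_diagonal =
  fixes v :: "int ^ 'd::finite \<Rightarrow> real" and P :: "'d dmat" and c \<tau> C Z :: real
  assumes Z_eq: "Z = lattice_sum TYPE('d)" and c_pos: "0 < c" and tau_nonneg: "0 \<le> \<tau>" and C_nonneg: "0 \<le> C"
    and separated: "\<And>m n. m \<noteq> n \<Longrightarrow> c * lnorm (m - n) powr - \<tau> \<le> \<bar>v m - v n\<bar>"
    and chordal: "\<And>m n j. \<bar>v (m + j) - v (n + j)\<bar> \<le>
        C * \<bar>v m - v n\<bar> * (1 + \<bar>v (m + j) - v m\<bar>) * (1 + \<bar>v (n + j) - v n\<bar>)"
    and toeplitz: "\<And>\<zeta> m n j. \<zeta> \<in> disc \<Longrightarrow> ent P \<zeta> (m + j) (n + j) = ent P \<zeta> m n"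
    and hermitian: "\<And>\<zeta> m n. \<zeta> \<in> disc \<Longrightarrow> cnj (ent P (cnj \<zeta>) n m) = ent P \<zeta> m n"
begin

definition level :: "'d dmat \<Rightarrow> complex \<Rightarrow> int ^ 'd \<Rightarrow> complex" where
  "level G \<zeta> m = complex_of_real (v m) + ent G \<zeta> m m"

text \<open>The equation \<open>(V + P) T = T (\<Lambda> + A)\<close> with \<open>\<Lambda>\<close> the diagonal matrix of the levels.  It is stated
entrywise because \<open>V\<close> and \<open>\<Lambda>\<close> are unbounded and so lie outside the algebra.\<close>

definition intertwines :: "'d dmat \<Rightarrow> 'd dmat \<Rightarrow> 'd dmat \<Rightarrow> bool" where
  "intertwines G T A \<longleftrightarrow> (\<forall>\<zeta>\<in>disc. \<forall>i m.
     complex_of_real (v i) * ent T \<zeta> i m + ent (P * T) \<zeta> i m = ent T \<zeta> i m * level G \<zeta> m + ent (T * A) \<zeta> i m)"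

text \<open>The Hellmann--Feynman formula.  A column of \<open>T\<close> and the conjugate of a column of \<open>T\<close> at the
conjugate parameter are a right and a left eigenvector up to \<open>A\<close>.  After translating them by \<open>p\<close>
and \<open>q\<close> the potentials differ but the convolutions coincide, and the latter cancel in the
difference of the two eigenvalue equations.  With \<open>p = m\<close> and \<open>q = n\<close> this compares levels at
different sites; with \<open>p = q = 0\<close> and \<open>A = 0\<close> it is the orthogonality of eigenvectors.\<close>

lemma pairing_identity:
  fixes p q m n :: "int ^ 'd"
  assumes I: "intertwines G T A" and \<zeta>: "\<zeta> \<in> disc"
  defines "\<alpha> \<equiv> \<lambda>j. ent T \<zeta> (p + j) m" and "\<beta> \<equiv> \<lambda>j. cnj (ent T (cnj \<zeta>) (q + j) n)"
    and "r \<equiv> \<lambda>j. cnj (ent T (cnj \<zeta>) (q + j) n) * ent (T * A) \<zeta> (p + j) m - cnj (ent (T * A) (cnj \<zeta>) (q + j) n) * ent T \<zeta> (p + j) m"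
  shows "(\<Sum>\<^sub>\<infinity>j. \<beta> j * complex_of_real (v (p + j) - v (q + j)) * \<alpha> j) =
    (level G \<zeta> m - cnj (level G (cnj \<zeta>) n)) * (\<Sum>\<^sub>\<infinity>j. \<beta> j * \<alpha> j) + (\<Sum>\<^sub>\<infinity>j. r j)"
proof -
  have \<zeta>': "cnj \<zeta> \<in> disc" using \<zeta> by simp
  have shift: "bij (\<lambda>j::int^'d. k + j)" for k by (rule bij_plus)
  define x where "x = (\<lambda>j. \<Sum>\<^sub>\<infinity>i. ent P \<zeta> j i * \<alpha> i)"
  define y where "y = (\<lambda>j. \<Sum>\<^sub>\<infinity>i. \<beta> i * ent P \<zeta> i j)"
  have PT: "ent (P * T) \<zeta>' (k + j) l = (\<Sum>\<^sub>\<infinity>i. ent P \<zeta>' j i * ent T \<zeta>' (k + i) l)" if "\<zeta>' \<in> disc" for \<zeta>' k j l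
  proof -
    have "ent (P * T) \<zeta>' (k + j) l = (\<Sum>\<^sub>\<infinity>i. ent P \<zeta>' (k + j) (k + i) * ent T \<zeta>' (k + i) l)"
      unfolding ent_times by (rule infsum_reindex_bij_betw[OF shift, symmetric])
    then show ?thesis using toeplitz[OF that, of j k] by (simp add: add.commute)
  qed
  have x: "x j = ent (P * T) \<zeta> (p + j) m" for j
    by (simp add: x_def \<alpha>_def PT[OF \<zeta>])
  have y: "y j = cnj (ent (P * T) (cnj \<zeta>) (q + j) n)" for j
    unfolding y_def \<beta>_def PT[OF \<zeta>'] infsum_cnj[symmetric] using hermitian[OF \<zeta>]
    by (simp add: mult.commute)
  have \<alpha>s: "\<alpha> abs_summable_on UNIV" and \<beta>s: "\<beta> abs_summable_on UNIV"
    using ent_column_abs_summable unfolding \<alpha>_def \<beta>_def complex_mod_cnj by auto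
  have \<alpha>b: "cmod (\<alpha> j) \<le> norm T" and \<beta>b: "cmod (\<beta> j) \<le> norm T"
    and xb: "cmod (x j) \<le> norm (P * T)" and yb: "cmod (y j) \<le> norm (P * T)" for j
    using norm_ent_le' unfolding \<alpha>_def \<beta>_def x y complex_mod_cnj by auto
  \<comment> \<open>moving the convolution from one factor to the other: here the two equations cancel\<close>
  have swap: "(\<Sum>\<^sub>\<infinity>j. \<beta> j * x j) = (\<Sum>\<^sub>\<infinity>j. \<alpha> j * y j)"
  proof -
    obtain b where "row_bound (1/2) b (ent P \<zeta>)" using ent_bounded' by metis
    then have P: "row_bound 0 b (ent P \<zeta>)" by (rule row_bound_mono) auto
    have "row_bound 0 (\<Sum>\<^sub>\<infinity>j. cmod (\<beta> j)) (\<lambda>_::int^'d. \<beta>)"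
      using \<beta>s by (auto simp: row_bound_def intro!: finite_sum_le_infsum)
    from matmul_vector_assoc[where m = 0, OF this P \<alpha>b] show ?thesis
      by (simp add: x_def y_def matmul_def mult.commute)
  qed
  define d where "d = level G \<zeta> m - cnj (level G (cnj \<zeta>) n)"
  have summand: "\<beta> j * complex_of_real (v (p + j) - v (q + j)) * \<alpha> j = d * (\<beta> j * \<alpha> j) + r j - \<beta> j * x j + \<alpha> j * y j" for j
  proof -
    have 1: "complex_of_real (v (p + j)) * \<alpha> j = \<alpha> j * level G \<zeta> m + ent (T * A) \<zeta> (p + j) m - x j"
      using I \<zeta> unfolding intertwines_def x \<alpha>_def unfolding eq_diff_eq by blast
    have "complex_of_real (v (q + j)) * ent T (cnj \<zeta>) (q + j) n + ent (P * T) (cnj \<zeta>) (q + j) n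
        = ent T (cnj \<zeta>) (q + j) n * level G (cnj \<zeta>) n + ent (T * A) (cnj \<zeta>) (q + j) n"
      using I \<zeta>' unfolding intertwines_def by blast
    from arg_cong[OF this, of cnj]
    have 2: "complex_of_real (v (q + j)) * \<beta> j = \<beta> j * cnj (level G (cnj \<zeta>) n) + cnj (ent (T * A) (cnj \<zeta>) (q + j) n) - y j"
      unfolding y \<beta>_def by (simp add: algebra_simps)
    have "\<beta> j * complex_of_real (v (p + j) - v (q + j)) * \<alpha> j =
       \<beta> j * (complex_of_real (v (p + j)) * \<alpha> j) - (complex_of_real (v (q + j)) * \<beta> j) * \<alpha> j"
      by (simp add: algebra_simps)
    then show ?thesis unfolding 1 2 d_def r_def \<alpha>_def[symmetric] \<beta>_def[symmetric]
      by (simp add: \<alpha>_def \<beta>_def algebra_simps)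
  qed
  have s1: "(\<lambda>j. \<beta> j * \<alpha> j) summable_on UNIV"
    by (rule abs_summable_summable[OF abs_summable_mult_bounded[OF \<beta>s \<alpha>b]])
  have s2: "(\<lambda>j. \<beta> j * x j) summable_on UNIV"
    by (rule abs_summable_summable[OF abs_summable_mult_bounded[OF \<beta>s xb]])
  have s3: "(\<lambda>j. \<alpha> j * y j) summable_on UNIV"
    by (rule abs_summable_summable[OF abs_summable_mult_bounded[OF \<alpha>s yb]])
  have s4: "r summable_on UNIV"
  proof -
    have "(\<lambda>j. \<beta> j * ent (T * A) \<zeta> (p + j) m) summable_on UNIV"
      by (rule abs_summable_summable[OF abs_summable_mult_bounded[OF \<beta>s norm_ent_le']])
    moreover have "(\<lambda>j. \<alpha> j * cnj (ent (T * A) (cnj \<zeta>) (q + j) n)) summable_on UNIV"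
      by (rule abs_summable_summable[OF abs_summable_mult_bounded[OF \<alpha>s, of _ "norm (T * A)"]]) (simp add: norm_ent_le')
    ultimately have "(\<lambda>j. \<beta> j * ent (T * A) \<zeta> (p + j) m - \<alpha> j * cnj (ent (T * A) (cnj \<zeta>) (q + j) n)) summable_on UNIV"
      using summable_on_add[of "\<lambda>j. \<beta> j * ent (T * A) \<zeta> (p + j) m" UNIV "\<lambda>j. - (\<alpha> j * cnj (ent (T * A) (cnj \<zeta>) (q + j) n))"]
      by (simp add: summable_on_uminus)
    then show ?thesis by (simp add: r_def \<alpha>_def \<beta>_def mult.commute)
  qed
  have "((\<lambda>j. d * (\<beta> j * \<alpha> j) + r j + (- (\<beta> j * x j)) + \<alpha> j * y j) has_sum
      (d * (\<Sum>\<^sub>\<infinity>j. \<beta> j * \<alpha> j) + (\<Sum>\<^sub>\<infinity>j. r j) + (- (\<Sum>\<^sub>\<infinity>j. \<beta> j * x j)) + (\<Sum>\<^sub>\<infinity>j. \<alpha> j * y j))) UNIV"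
    using s1 s2 s3 s4 by (intro has_sum_add has_sum_uminusI has_sum_cmult_right has_sum_infsum)
  then show ?thesis unfolding summand swap d_def by (simp add: infsumI)
qed

text \<open>In the pairing of eigenvectors centred at \<open>m\<close> and \<open>n\<close> the term \<open>j = 0\<close> is within a constant
factor of \<open>v m - v n\<close>.  In the other terms the off-centre components
of both eigenvectors carry the factors that \<open>chordal\<close> charges, so together they are at most
\<open>9 C \<eta>\<^sup>2 Z \<bar>v m - v n\<bar>\<close>.  The pairing bounds the difference of a level and the conjugate of
a level at the conjugate parameter; applied with \<open>m = n\<close> it also shows that this conjugation
changes a level only by a multiple of \<open>a\<close>.\<close>

lemma level_gap:
  assumes I: "intertwines G T A" and \<zeta>: "\<zeta> \<in> disc"
    and T: "norm (T - 1) \<le> \<eta>" and \<eta>: "\<eta> \<le> 1/10" "\<eta>\<^sup>2 * Z \<le> 1/16" "9 * C * \<eta>\<^sup>2 * Z \<le> 1/8"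
    and A: "norm A \<le> a" and small: "2 * (a + norm P) \<le> \<eta>" and G: "norm G \<le> 1"
  shows "cmod (level G \<zeta> m - level G \<zeta> n) \<ge> 2/5 * \<bar>v m - v n\<bar> - 22 * Z * a"
proof -
  have \<eta>0: "0 \<le> \<eta>" using T norm_ge_zero[of "T - 1"] by linarith
  have a0: "0 \<le> a" using A norm_ge_zero[of A] by linarith
  have T2: "norm T \<le> 2" using norm_triangle_ineq[of "T - 1" 1] T \<eta> by simp
  have Toff: "cmod (ent T \<zeta>' (l + j) l) \<le> \<eta> * exp (- (1/2 * lnorm j))" if "j \<noteq> 0" "\<zeta>' \<in> disc" for \<zeta>' l j
  proof -
    have "cmod (ent (T - 1) \<zeta>' (l + j) l) \<le> norm (T - 1) * exp (- (1/2 * lnorm (l + j - l)))" by (rule norm_ent_le)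
    also have "\<dots> \<le> \<eta> * exp (- (1/2 * lnorm j))" using T \<eta>0 by (intro mult_mono) auto
    finally show ?thesis using that by (simp add: ent_one)
  qed
  have Tdiag: "cmod (ent T \<zeta>' l l - 1) \<le> \<eta>" if "\<zeta>' \<in> disc" for \<zeta>' l
    using norm_ent_le'[of "T - 1" \<zeta>' l l] T that by (simp add: ent_one)
  have TAn: "norm (T * A) \<le> 2 * a"
    by (rule order.trans[OF norm_mult_ineq mult_mono]) (use T2 A in auto)
  have PTn: "norm (P * T) \<le> 2 * norm P"
    using order.trans[OF norm_mult_ineq[of P T] mult_left_mono[OF T2 norm_ge_zero[of P]]] by (simp add: mult.commute)
  have TA: "cmod (ent (T * A) \<zeta>' (l + j) l) \<le> 2 * a * exp (- (1/2 * lnorm j))" for \<zeta>' l j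
  proof -
    have "cmod (ent (T * A) \<zeta>' (l + j) l) \<le> norm (T * A) * exp (- (1/2 * lnorm (l + j - l)))" by (rule norm_ent_le)
    also have "\<dots> \<le> (2 * a) * exp (- (1/2 * lnorm j))"
      using TAn a0 by (intro mult_mono) auto
    finally show ?thesis .
  qed
  have PT: "cmod (ent (P * T) \<zeta>' (l + j) l) \<le> 2 * norm P * exp (- (1/2 * lnorm j))" for \<zeta>' l j
  proof -
    have "cmod (ent (P * T) \<zeta>' (l + j) l) \<le> norm (P * T) * exp (- (1/2 * lnorm (l + j - l)))" by (rule norm_ent_le)
    also have "\<dots> \<le> (2 * norm P) * exp (- (1/2 * lnorm j))"
      using PTn by (intro mult_mono) auto
    finally show ?thesis .
  qed
  have T_all: "cmod (ent T \<zeta>' (l + j) l) \<le> 2 * exp (- (1/2 * lnorm j))" for \<zeta>' l j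
  proof -
    have "cmod (ent T \<zeta>' (l + j) l) \<le> norm T * exp (- (1/2 * lnorm (l + j - l)))" by (rule norm_ent_le)
    also have "\<dots> \<le> 2 * exp (- (1/2 * lnorm j))" using T2 by (intro mult_mono) auto
    finally show ?thesis .
  qed
  \<comment> \<open>the eigenvalue equation read at an off-centre site: the component gains the denominator\<close>
  have weighted: "cmod (ent T \<zeta>' (l + j) l) * (1 + \<bar>v (l + j) - v l\<bar>) \<le> 3 * \<eta> * exp (- (1/2 * lnorm j))"
    if j: "j \<noteq> 0" and \<zeta>': "\<zeta>' \<in> disc" for \<zeta>' l j
  proof -
    let ?e = "exp (- (1/2 * lnorm j))" and ?t = "ent T \<zeta>' (l + j) l"
    have "complex_of_real (v (l + j)) * ?t + ent (P * T) \<zeta>' (l + j) l = ?t * level G \<zeta>' l + ent (T * A) \<zeta>' (l + j) l"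
      using I \<zeta>' unfolding intertwines_def by blast
    then have "complex_of_real (v (l + j) - v l) * ?t = ?t * ent G \<zeta>' l l + ent (T * A) \<zeta>' (l + j) l - ent (P * T) \<zeta>' (l + j) l"
      by (simp add: level_def algebra_simps)
    then have "\<bar>v (l + j) - v l\<bar> * cmod ?t = cmod (?t * ent G \<zeta>' l l + ent (T * A) \<zeta>' (l + j) l - ent (P * T) \<zeta>' (l + j) l)"
      by (metis norm_mult norm_of_real)
    also have "\<dots> \<le> cmod ?t * cmod (ent G \<zeta>' l l) + cmod (ent (T * A) \<zeta>' (l + j) l) + cmod (ent (P * T) \<zeta>' (l + j) l)"
      by (metis norm_mult norm_triangle_le_diff norm_triangle_ineq add_mono order_refl)
    also have "\<dots> \<le> cmod ?t * 1 + 2 * a * ?e + 2 * norm P * ?e"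
      using G norm_ent_le'[of G \<zeta>' l l] by (intro add_mono mult_left_mono TA PT) auto
    also have "\<dots> \<le> \<eta> * ?e + 2 * a * ?e + 2 * norm P * ?e" using Toff[OF j \<zeta>'] by simp
    also have "\<dots> = (\<eta> + 2 * (a + norm P)) * ?e" by (simp add: algebra_simps)
    also have "\<dots> \<le> (2 * \<eta>) * ?e" using small by (intro mult_right_mono) auto
    finally show ?thesis using Toff[OF j \<zeta>', of l] by (simp add: algebra_simps)
  qed
  have e2: "exp (- (1/2 * lnorm j)) * exp (- (1/2 * lnorm j)) = exp (- lnorm j)" for j :: "int^'d"
    by (simp add: exp_add[symmetric])
  have \<zeta>': "cnj \<zeta> \<in> disc" using \<zeta> by simp
  have main: "(3/2) * cmod (level G \<zeta> m - cnj (level G (cnj \<zeta>) n)) \<ge> 3/5 * \<bar>v m - v n\<bar> - 8 * Z * a"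
     and same: "cmod (level G \<zeta> m - cnj (level G (cnj \<zeta>) m)) \<le> 16 * Z * a" for m n
  proof -
    define \<alpha> where "\<alpha> = (\<lambda>j. ent T \<zeta> (m + j) m)"
    define \<beta> where "\<beta> = (\<lambda>n j. cnj (ent T (cnj \<zeta>) (n + j) n))"
    define r where "r = (\<lambda>n j. \<beta> n j * ent (T * A) \<zeta> (m + j) m - cnj (ent (T * A) (cnj \<zeta>) (n + j) n) * \<alpha> j)"
    define f where "f = (\<lambda>n j. \<beta> n j * complex_of_real (v (m + j) - v (n + j)) * \<alpha> j)"
    define q where "q = (\<lambda>n. \<Sum>\<^sub>\<infinity>j. \<beta> n j * \<alpha> j)"
    have id: "infsum (f n) UNIV = (level G \<zeta> m - cnj (level G (cnj \<zeta>) n)) * q n + infsum (r n) UNIV" for n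
      using pairing_identity[OF I \<zeta>, where p = m and q = n and m = m and n = n]
      by (simp add: \<alpha>_def \<beta>_def r_def f_def q_def)
    have rb: "cmod (infsum (r n) UNIV) \<le> 8 * Z * a" for n
    proof (rule norm_infsum_le[where X = UNIV and f = "r n"])
      have le: "cmod (r n j) \<le> 8 * a * exp (- lnorm j)" for j
      proof -
        have "cmod (r n j) \<le> cmod (\<beta> n j) * cmod (ent (T * A) \<zeta> (m + j) m) + cmod (ent (T * A) (cnj \<zeta>) (n + j) n) * cmod (\<alpha> j)"
          unfolding r_def by (metis complex_mod_cnj norm_mult norm_triangle_ineq4)
        also have "\<dots> \<le> (2 * exp (- (1/2 * lnorm j))) * (2 * a * exp (- (1/2 * lnorm j))) + (2 * a * exp (- (1/2 * lnorm j))) * (2 * exp (- (1/2 * lnorm j)))"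
          unfolding \<alpha>_def \<beta>_def complex_mod_cnj using a0 by (intro add_mono mult_mono T_all TA) auto
        also have "\<dots> = 8 * a * exp (- lnorm j)" by (simp add: e2[symmetric] algebra_simps)
        finally show ?thesis .
      qed
      then show "cmod (r n j) \<le> 8 * a * exp (- lnorm j)" for j .
      show "((\<lambda>j::int^'d. 8 * a * exp (- lnorm j)) has_sum (8 * Z * a)) UNIV"
        using has_sum_cmult_right[OF exp_lnorm_has_sum, of "8 * a"] by (simp add: Z_eq ac_simps)
      show "(r n has_sum infsum (r n) UNIV) UNIV"
        by (rule has_sum_infsum[OF abs_summable_summable[OF lattice_sum_split(1)[OF le]]])
    qed
    have p0: "cmod (\<beta> n 0 * \<alpha> 0) \<le> 121/100" "81/100 \<le> cmod (\<beta> n 0 * \<alpha> 0)" for n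
    proof -
      have "cmod (\<alpha> 0) \<le> 11/10" "9/10 \<le> cmod (\<alpha> 0)"
        using Tdiag[OF \<zeta>, of m] \<eta> norm_triangle_ineq3[of "ent T \<zeta> m m" 1] by (auto simp: \<alpha>_def)
      moreover have "cmod (\<beta> n 0) \<le> 11/10" "9/10 \<le> cmod (\<beta> n 0)"
        using Tdiag[OF \<zeta>', of n] \<eta> norm_triangle_ineq3[of "ent T (cnj \<zeta>) n n" 1] by (auto simp: \<beta>_def)
      ultimately show "cmod (\<beta> n 0 * \<alpha> 0) \<le> 121/100" "81/100 \<le> cmod (\<beta> n 0 * \<alpha> 0)"
        using mult_mono[of "cmod (\<beta> n 0)" "11/10" "cmod (\<alpha> 0)" "11/10"] mult_mono[of "9/10" "cmod (\<beta> n 0)" "9/10" "cmod (\<alpha> 0)"]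
        by (auto simp: norm_mult)
    qed
    have qb: "cmod (q n - \<beta> n 0 * \<alpha> 0) \<le> 1/16" for n
    proof -
      have "cmod (\<beta> n j * \<alpha> j) \<le> \<eta>\<^sup>2 * exp (- lnorm j)" if "j \<noteq> 0" for j
      proof -
        have "cmod (\<beta> n j * \<alpha> j) \<le> (\<eta> * exp (- (1/2 * lnorm j))) * (\<eta> * exp (- (1/2 * lnorm j)))"
          unfolding norm_mult \<alpha>_def \<beta>_def complex_mod_cnj using \<eta>0 that \<zeta> \<zeta>' by (intro mult_mono Toff) auto
        then show ?thesis by (simp add: e2[symmetric] power2_eq_square algebra_simps)
      qed
      from lattice_sum_split(2)[OF this] show ?thesis using \<eta>(2) by (simp add: q_def Z_eq)
    qed
    have fb: "cmod (infsum (f n) UNIV - f n 0) \<le> 1/8 * \<bar>v m - v n\<bar>" for n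
    proof -
      have "cmod (f n j) \<le> (9 * C * \<eta>\<^sup>2 * \<bar>v m - v n\<bar>) * exp (- lnorm j)" if j: "j \<noteq> 0" for j
      proof -
        have "cmod (f n j) = cmod (\<beta> n j) * cmod (\<alpha> j) * \<bar>v (m + j) - v (n + j)\<bar>"
          unfolding f_def norm_mult norm_of_real by (simp add: ac_simps)
        also have "\<dots> \<le> cmod (\<beta> n j) * cmod (\<alpha> j) * (C * \<bar>v m - v n\<bar> * (1 + \<bar>v (m + j) - v m\<bar>) * (1 + \<bar>v (n + j) - v n\<bar>))"
          by (intro mult_left_mono chordal) auto
        also have "\<dots> = (C * \<bar>v m - v n\<bar>) * ((cmod (\<beta> n j) * (1 + \<bar>v (n + j) - v n\<bar>)) * (cmod (\<alpha> j) * (1 + \<bar>v (m + j) - v m\<bar>)))"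
          by (simp add: ac_simps)
        also have "\<dots> \<le> (C * \<bar>v m - v n\<bar>) * ((3 * \<eta> * exp (- (1/2 * lnorm j))) * (3 * \<eta> * exp (- (1/2 * lnorm j))))"
          unfolding \<alpha>_def \<beta>_def complex_mod_cnj using C_nonneg \<eta>0 j \<zeta> \<zeta>'
          by (intro mult_left_mono mult_mono weighted) auto
        also have "\<dots> = (9 * C * \<eta>\<^sup>2 * \<bar>v m - v n\<bar>) * exp (- lnorm j)"
          by (simp add: e2[symmetric] power2_eq_square algebra_simps)
        finally show ?thesis .
      qed
      from lattice_sum_split(2)[OF this]
      have "cmod (infsum (f n) UNIV - f n 0) \<le> (9 * C * \<eta>\<^sup>2 * Z) * \<bar>v m - v n\<bar>" by (simp add: Z_eq ac_simps)
      also have "\<dots> \<le> 1/8 * \<bar>v m - v n\<bar>" using \<eta>(3) by (intro mult_right_mono) auto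
      finally show ?thesis .
    qed
    show "(3/2) * cmod (level G \<zeta> m - cnj (level G (cnj \<zeta>) n)) \<ge> 3/5 * \<bar>v m - v n\<bar> - 8 * Z * a"
    proof -
      let ?d = "cmod (level G \<zeta> m - cnj (level G (cnj \<zeta>) n))"
      have "cmod (f n 0) = cmod (\<beta> n 0 * \<alpha> 0) * \<bar>v m - v n\<bar>"
        unfolding f_def norm_mult norm_of_real by (simp add: ac_simps)
      then have "81/100 * \<bar>v m - v n\<bar> \<le> cmod (f n 0)" using p0(2)[of n] by (metis abs_ge_zero mult_right_mono)
      moreover have "cmod (f n 0) \<le> cmod (infsum (f n) UNIV) + cmod (infsum (f n) UNIV - f n 0)"
        by (metis norm_triangle_sub norm_minus_commute)
      moreover have "cmod (infsum (f n) UNIV) \<le> ?d * cmod (q n) + 8 * Z * a"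
        unfolding id using norm_triangle_ineq[of "(level G \<zeta> m - cnj (level G (cnj \<zeta>) n)) * q n" "infsum (r n) UNIV"] rb[of n] by (simp add: norm_mult)
      moreover have "cmod (q n) \<le> 3/2"
        using qb[of n] p0(1)[of n] norm_triangle_sub[of "q n" "\<beta> n 0 * \<alpha> 0"] by linarith
      then have "?d * cmod (q n) \<le> ?d * (3/2)" by (rule mult_left_mono) simp
      moreover have "3/5 * x - 8 * Z * a \<le> 3/2 * d"
        if "81/100 * x \<le> f0" "f0 \<le> i + j" "i \<le> s + 8 * Z * a" "s \<le> d * (3/2)" "j \<le> 1/8 * x" "0 \<le> x"
        for x f0 i j s d :: real
        using that by linarith
      ultimately show ?thesis using fb[of n] abs_ge_zero[of "v m - v n"] by blast
    qed
    show "cmod (level G \<zeta> m - cnj (level G (cnj \<zeta>) m)) \<le> 16 * Z * a"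
    proof -
      let ?d = "cmod (level G \<zeta> m - cnj (level G (cnj \<zeta>) m))"
      have "infsum (f m) UNIV = 0" by (simp add: f_def)
      then have "(level G \<zeta> m - cnj (level G (cnj \<zeta>) m)) * q m = - infsum (r m) UNIV" using id[of m] by (simp add: eq_neg_iff_add_eq_0)
      then have "?d * cmod (q m) = cmod (infsum (r m) UNIV)" by (metis norm_minus_cancel norm_mult)
      then have "?d * cmod (q m) \<le> 8 * Z * a" using rb[of m] by simp
      moreover have "1/2 \<le> cmod (q m)"
        using qb[of m] p0(2)[of m] norm_triangle_sub[of "\<beta> m 0 * \<alpha> 0" "q m"] by (simp add: norm_minus_commute)
      then have "?d * (1/2) \<le> ?d * cmod (q m)" by (rule mult_left_mono) simp
      ultimately show ?thesis by linarith
    qed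
  qed
  have "cmod (level G \<zeta> m - cnj (level G (cnj \<zeta>) n)) \<le> cmod (level G \<zeta> m - level G \<zeta> n) + cmod (level G \<zeta> n - cnj (level G (cnj \<zeta>) n))"
    using norm_triangle_ineq[of "level G \<zeta> m - level G \<zeta> n" "level G \<zeta> n - cnj (level G (cnj \<zeta>) n)"] by simp
  then have "(3/2) * cmod (level G \<zeta> m - cnj (level G (cnj \<zeta>) n)) \<le> (3/2) * cmod (level G \<zeta> m - level G \<zeta> n) + (3/2) * (16 * Z * a)"
    using same[of n] by linarith
  moreover have "0 \<le> Z * a" using lattice_sum_ge_1[where 'd = 'd] a0 by (simp add: Z_eq)
  ultimately show ?thesis using main[of m n] by linarith
qed

end


section \<open>The iteration step\<close>

context perturbed_diagonal
begin

lemma separated_up_to: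
  assumes "m \<noteq> n" "lnorm (m - n) \<le> N"
  shows "c * N powr - \<tau> \<le> \<bar>v m - v n\<bar>"
proof -
  have "1 \<le> lnorm (m - n)" using assms(1) by (intro lnorm_ge_1) simp
  then have "N powr - \<tau> \<le> lnorm (m - n) powr - \<tau>"
    using assms(2) tau_nonneg by (intro powr_mono2') auto
  then have "c * N powr - \<tau> \<le> c * lnorm (m - n) powr - \<tau>" using c_pos by (intro mult_left_mono) auto
  then show ?thesis using separated[OF assms(1)] by linarith
qed

text \<open>Split \<open>A = D + B + R\<close> into its diagonal \<open>D\<close>, the off-diagonal entries \<open>B\<close> of range at most \<open>N\<close> and the rest
\<open>R\<close>, and solve \<open>\<Lambda> W - W \<Lambda> = - B\<close> entrywise.  Then
\<open>(\<Lambda> + A) (1 + W) = (1 + W) (\<Lambda> + D) + (R + A W - W D)\<close>, so the new transformation is \<open>T (1 + W)\<close>, the new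
levels are those of \<open>G + A\<close> (whose diagonal absorbs \<open>D\<close>), and the new remainder is
\<open>(1 + W)\<^sup>-\<^sup>1 (R + A W - W D)\<close>.  Here \<open>R\<close> is small because giving up \<open>\<sigma>\<close> in the rate of decay gains
\<open>exp (- \<sigma> N)\<close> at distances beyond \<open>N\<close>, and the other two terms are quadratic in \<open>A\<close>.  The hypothesis
\<open>gap\<close> makes the error in \<open>level_gap\<close> negligible against the separation at distance \<open>N\<close>.\<close>

lemma kam_step:
  assumes I: "intertwines G T A"
    and T: "norm (T - 1) \<le> \<eta>" and \<eta>: "\<eta> \<le> 1/10" "\<eta>\<^sup>2 * Z \<le> 1/16" "9 * C * \<eta>\<^sup>2 * Z \<le> 1/8"
    and A: "fam_bound \<rho> a A" and small: "2 * (a + norm P) \<le> \<eta>" and G: "norm G \<le> 1"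
    and \<rho>: "1/2 \<le> \<rho> - \<sigma>" "0 \<le> \<sigma>" and N: "1 \<le> N"
    and gap: "22 * Z * a \<le> 3/20 * (c * N powr - \<tau>)"
    and w_def: "w = 4 / c * N powr \<tau> * a" and w: "w \<le> 1/2"
  shows "\<exists>T' A'. intertwines (G + A) T' A' \<and> norm (T' - T) \<le> norm T * w \<and>
     fam_bound (\<rho> - \<sigma>) (2 * (exp (- (\<sigma> * N)) * a + 2 * w * a)) A'"
proof -
  have a0: "0 \<le> a" using A by (rule fam_bound_nonneg)
  have \<rho>2: "1/2 \<le> \<rho>" using \<rho> by linarith
  have normA: "norm A \<le> a" unfolding norm_dmat_le_iff using A \<rho>2 by (rule fam_bound_mono) simp
  have lev: "1/4 * (c * N powr - \<tau>) \<le> cmod (level G \<zeta> n - level G \<zeta> m)"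
    if "\<zeta> \<in> disc" "m \<noteq> n" "lnorm (m - n) \<le> N" for \<zeta> m n
    using level_gap[OF I that(1) T \<eta> normA small G, of n m] separated_up_to[OF that(2,3)] gap
    by (simp add: abs_minus_commute)
  have cN: "0 < c * N powr - \<tau>" using c_pos N by simp
  have lev0: "level G \<zeta> n - level G \<zeta> m \<noteq> 0" if "\<zeta> \<in> disc" "m \<noteq> n" "lnorm (m - n) \<le> N" for \<zeta> m n
    using lev[OF that] cN by auto
  have level_hol: "(\<lambda>\<zeta>. level G \<zeta> m) holomorphic_on disc" for m
    unfolding level_def by (intro holomorphic_intros ent_holomorphic)
  have mask: "\<exists>X. (\<forall>\<zeta>\<in>disc. \<forall>m n. ent X \<zeta> m n = (if Q m n then ent A \<zeta> m n else 0)) \<and> fam_bound \<rho>' (\<kappa> * a) X"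
    if "1/2 \<le> \<rho>'" "0 \<le> \<kappa>" and Q: "\<And>m n. Q m n \<Longrightarrow> exp (\<rho>' * lnorm (m - n)) \<le> \<kappa> * exp (\<rho> * lnorm (m - n))" for Q \<rho>' \<kappa>
  proof (rule dmat_entrywise[OF A that(1,2), of "\<lambda>\<zeta> m n. if Q m n then ent A \<zeta> m n else 0"])
    show "(\<lambda>\<zeta>. if Q m n then ent A \<zeta> m n else 0) holomorphic_on disc" for m n
      by (cases "Q m n") (simp_all add: ent_holomorphic)
    show "cmod (if Q m n then ent A \<zeta> m n else 0) * exp (\<rho>' * lnorm (m - n)) \<le> \<kappa> * (cmod (ent A \<zeta> m n) * exp (\<rho> * lnorm (m - n)))" for \<zeta> m n
      using mult_left_mono[OF Q[of m n] norm_ge_zero[of "ent A \<zeta> m n"]] that(2) by (simp add: ac_simps)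
  qed blast
  have "\<exists>X. (\<forall>\<zeta>\<in>disc. \<forall>m n. ent X \<zeta> m n = (if m = n then ent A \<zeta> m n else 0)) \<and> fam_bound \<rho> (1 * a) X"
    by (rule mask) (use \<rho>2 in auto)
  then obtain D where D: "\<And>\<zeta> m n. \<zeta> \<in> disc \<Longrightarrow> ent D \<zeta> m n = (if m = n then ent A \<zeta> m n else 0)" "fam_bound \<rho> (1 * a) D"
    by blast
  have "\<exists>X. (\<forall>\<zeta>\<in>disc. \<forall>m n. ent X \<zeta> m n = (if m \<noteq> n \<and> lnorm (m - n) \<le> N then ent A \<zeta> m n else 0)) \<and> fam_bound \<rho> (1 * a) X"
    by (rule mask) (use \<rho>2 in auto)
  then obtain B where B: "\<And>\<zeta> m n. \<zeta> \<in> disc \<Longrightarrow> ent B \<zeta> m n = (if m \<noteq> n \<and> lnorm (m - n) \<le> N then ent A \<zeta> m n else 0)" "fam_bound \<rho> (1 * a) B"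
    by blast
  have "\<exists>X. (\<forall>\<zeta>\<in>disc. \<forall>m n. ent X \<zeta> m n = (if m \<noteq> n \<and> \<not> lnorm (m - n) \<le> N then ent A \<zeta> m n else 0)) \<and> fam_bound (\<rho> - \<sigma>) (exp (- (\<sigma> * N)) * a) X"
  proof (rule mask)
    fix m n :: "int^'d" assume "m \<noteq> n \<and> \<not> lnorm (m - n) \<le> N"
    then have "\<sigma> * N \<le> \<sigma> * lnorm (m - n)" using \<rho>(2) by (intro mult_left_mono) auto
    then show "exp ((\<rho> - \<sigma>) * lnorm (m - n)) \<le> exp (- (\<sigma> * N)) * exp (\<rho> * lnorm (m - n))"
      by (simp add: exp_add[symmetric] algebra_simps)
  qed (use \<rho> in auto)
  then obtain R where R: "\<And>\<zeta> m n. \<zeta> \<in> disc \<Longrightarrow> ent R \<zeta> m n = (if m \<noteq> n \<and> \<not> lnorm (m - n) \<le> N then ent A \<zeta> m n else 0)"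
     "fam_bound (\<rho> - \<sigma>) (exp (- (\<sigma> * N)) * a) R"
    by blast
  obtain W where W: "\<And>\<zeta> m n. \<zeta> \<in> disc \<Longrightarrow> ent W \<zeta> m n =
      (if m \<noteq> n \<and> lnorm (m - n) \<le> N then ent A \<zeta> m n / (level G \<zeta> n - level G \<zeta> m) else 0)"
     "fam_bound \<rho> (4 / c * N powr \<tau> * a) W"
  proof (rule dmat_entrywise[OF A \<rho>2, of "4 / c * N powr \<tau>" "\<lambda>\<zeta> m n. if m \<noteq> n \<and> lnorm (m - n) \<le> N then ent A \<zeta> m n / (level G \<zeta> n - level G \<zeta> m) else 0"])
    show "0 \<le> 4 / c * N powr \<tau>" using c_pos by simp
    show "(\<lambda>\<zeta>. if m \<noteq> n \<and> lnorm (m - n) \<le> N then ent A \<zeta> m n / (level G \<zeta> n - level G \<zeta> m) else 0) holomorphic_on disc" for m n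
    proof (cases "m \<noteq> n \<and> lnorm (m - n) \<le> N")
      case True
      then have "(\<lambda>\<zeta>. ent A \<zeta> m n / (level G \<zeta> n - level G \<zeta> m)) holomorphic_on disc"
        using lev0[of _ m n] by (intro holomorphic_intros ent_holomorphic level_hol) auto
      then show ?thesis using True by simp
    qed auto
    fix \<zeta> :: complex and m n :: "int^'d" assume \<zeta>: "\<zeta> \<in> disc"
    show "cmod (if m \<noteq> n \<and> lnorm (m - n) \<le> N then ent A \<zeta> m n / (level G \<zeta> n - level G \<zeta> m) else 0) * exp (\<rho> * lnorm (m - n))
       \<le> 4 / c * N powr \<tau> * (cmod (ent A \<zeta> m n) * exp (\<rho> * lnorm (m - n)))"
    proof (cases "m \<noteq> n \<and> lnorm (m - n) \<le> N")
      case True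
      have "inverse (cmod (level G \<zeta> n - level G \<zeta> m)) \<le> inverse (1/4 * (c * N powr - \<tau>))"
        using lev[OF \<zeta>] True cN by (intro le_imp_inverse_le) auto
      also have "\<dots> = 4 / c * N powr \<tau>" using N by (simp add: powr_minus field_simps)
      finally have "cmod (ent A \<zeta> m n) * inverse (cmod (level G \<zeta> n - level G \<zeta> m)) \<le> cmod (ent A \<zeta> m n) * (4 / c * N powr \<tau>)"
        by (rule mult_left_mono) simp
      from mult_right_mono[OF this, of "exp (\<rho> * lnorm (m - n))"]
      show ?thesis using True by (simp add: divide_inverse norm_mult norm_inverse ac_simps)
    qed (use c_pos in auto)
  qed auto
  have W': "fam_bound \<rho> w W" using W(2) by (simp add: w_def)
  have le: "\<rho> - \<sigma> \<le> \<rho>" using \<rho> by simp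
  obtain Y where Y: "(1 + W) * Y = 1" "Y * (1 + W) = 1" "fam_bound (\<rho> - \<sigma>) 2 Y"
    using dmat_neumann[OF fam_bound_mono[OF W' le order_refl] \<rho>(1) w] .
  define A' where "A' = Y * (R + A * W - W * D)"
  define T' where "T' = T + T * W"
  have A_split: "A = D + B + R"
    by (rule dmat_eqI) (auto simp: D B R)
  have bound: "fam_bound (\<rho> - \<sigma>) (2 * (exp (- (\<sigma> * N)) * a + 2 * w * a)) A'"
  proof -
    have "fam_bound (\<rho> - \<sigma>) (2 * (exp (- (\<sigma> * N)) * a + a * w + w * (1 * a))) A'"
      unfolding A'_def using \<rho>
      by (intro fam_bound_times fam_bound_diff fam_bound_add Y R fam_bound_mono[OF A le order_refl]
          fam_bound_mono[OF W' le order_refl] fam_bound_mono[OF D(2) le order_refl]) auto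
    then show ?thesis by (simp add: algebra_simps)
  qed
  have T'bound: "norm (T' - T) \<le> norm T * w"
  proof -
    have "norm W \<le> w" unfolding norm_dmat_le_iff using W' \<rho>2 by (rule fam_bound_mono) simp
    then have "norm T * norm W \<le> norm T * w" by (rule mult_left_mono) simp
    then show ?thesis using norm_mult_ineq[of T W] by (simp add: T'_def)
  qed
  have "intertwines (G + A) T' A'"
    unfolding intertwines_def
  proof (intro ballI allI)
    fix \<zeta> :: complex and i m :: "int^'d" assume \<zeta>: "\<zeta> \<in> disc"
    define K where "K = T * A - P * T"
    have IK: "complex_of_real (v i) * ent T \<zeta> i k = ent T \<zeta> i k * level G \<zeta> k + ent K \<zeta> i k" for k
    proof -
      have "complex_of_real (v i) * ent T \<zeta> i k + ent (P * T) \<zeta> i k = ent T \<zeta> i k * level G \<zeta> k + ent (T * A) \<zeta> i k"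
        using I \<zeta> unfolding intertwines_def by blast
      then show ?thesis by (simp add: K_def algebra_simps)
    qed
    have lW: "level G \<zeta> k * ent W \<zeta> k m = ent W \<zeta> k m * level G \<zeta> m - ent B \<zeta> k m" for k
    proof (cases "k \<noteq> m \<and> lnorm (k - m) \<le> N")
      case True
      have "ent W \<zeta> k m * (level G \<zeta> m - level G \<zeta> k) = ent A \<zeta> k m"
        using True lev0[OF \<zeta>, of k m] by (simp add: W(1)[OF \<zeta>])
      then show ?thesis using True by (simp add: B(1)[OF \<zeta>] algebra_simps)
    qed (auto simp: W(1)[OF \<zeta>] B(1)[OF \<zeta>])
    have "complex_of_real (v i) * ent (T * W) \<zeta> i m = (\<Sum>\<^sub>\<infinity>k. complex_of_real (v i) * (ent T \<zeta> i k * ent W \<zeta> k m))"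
      unfolding ent_times using ent_times_summable by (intro infsum_cmult_right[symmetric]) auto
    also have "\<dots> = (\<Sum>\<^sub>\<infinity>k. ent T \<zeta> i k * ent W \<zeta> k m * level G \<zeta> m + (- (ent T \<zeta> i k * ent B \<zeta> k m)) + ent K \<zeta> i k * ent W \<zeta> k m)"
    proof (rule infsum_cong)
      fix k
      have "complex_of_real (v i) * (ent T \<zeta> i k * ent W \<zeta> k m) = (ent T \<zeta> i k * level G \<zeta> k + ent K \<zeta> i k) * ent W \<zeta> k m"
        by (simp add: IK[symmetric] mult.assoc)
      also have "\<dots> = ent T \<zeta> i k * (level G \<zeta> k * ent W \<zeta> k m) + ent K \<zeta> i k * ent W \<zeta> k m" by (simp add: algebra_simps)
      finally show "complex_of_real (v i) * (ent T \<zeta> i k * ent W \<zeta> k m) =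
         ent T \<zeta> i k * ent W \<zeta> k m * level G \<zeta> m + (- (ent T \<zeta> i k * ent B \<zeta> k m)) + ent K \<zeta> i k * ent W \<zeta> k m"
        unfolding lW by (simp add: algebra_simps)
    qed
    also have "\<dots> = ent (T * W) \<zeta> i m * level G \<zeta> m + (- ent (T * B) \<zeta> i m) + ent (K * W) \<zeta> i m"
      unfolding ent_times
      by (intro infsumI has_sum_add has_sum_uminusI has_sum_cmult_left has_sum_infsum ent_times_summable)
    finally have vTW: "complex_of_real (v i) * ent (T * W) \<zeta> i m = ent (T * W) \<zeta> i m * level G \<zeta> m - ent (T * B) \<zeta> i m + ent (K * W) \<zeta> i m"
      by simp
    have T'D: "ent (T' * D) \<zeta> i m = ent T' \<zeta> i m * ent A \<zeta> m m"
    proof -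
      have "ent (T' * D) \<zeta> i m = (\<Sum>\<^sub>\<infinity>k\<in>{m}. ent T' \<zeta> i k * ent D \<zeta> k m)"
        unfolding ent_times by (rule infsum_cong_neutral) (auto simp: D(1)[OF \<zeta>])
      then show ?thesis by (simp add: D(1)[OF \<zeta>])
    qed
    have "T' * A' = T * (((1 + W) * Y) * (R + A * W - W * D))"
      by (simp add: T'_def A'_def algebra_simps)
    then have "T' * A' + T' * D = T * (R + A * W - W * D) + T' * D" by (simp only: Y(1) mult_1_left)
    also have "\<dots> = T * (D + R) + T * A * W" by (simp add: T'_def algebra_simps)
    also have "D + R = A - B" by (subst A_split) simp
    finally have alg: "T' * A' + T' * D = T * A - T * B + T * A * W" by (simp add: algebra_simps)
    have "K + K * W + P * T' - T * B = T' * A' + T' * D"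
      unfolding alg by (simp add: K_def T'_def algebra_simps)
    then have ent_alg: "ent K \<zeta> i m + ent (K * W) \<zeta> i m + ent (P * T') \<zeta> i m - ent (T * B) \<zeta> i m = ent (T' * A') \<zeta> i m + ent T' \<zeta> i m * ent A \<zeta> m m"
      by (metis ent_add ent_diff T'D)
    have "complex_of_real (v i) * ent T' \<zeta> i m + ent (P * T') \<zeta> i m =
        (complex_of_real (v i) * ent T \<zeta> i m) + (complex_of_real (v i) * ent (T * W) \<zeta> i m) + ent (P * T') \<zeta> i m"
      by (simp add: T'_def algebra_simps)
    also have "\<dots> = ent T' \<zeta> i m * level G \<zeta> m + (ent K \<zeta> i m + ent (K * W) \<zeta> i m + ent (P * T') \<zeta> i m - ent (T * B) \<zeta> i m)"
      unfolding IK vTW by (simp add: T'_def algebra_simps)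
    finally show "complex_of_real (v i) * ent T' \<zeta> i m + ent (P * T') \<zeta> i m = ent T' \<zeta> i m * level (G + A) \<zeta> m + ent (T' * A') \<zeta> i m"
      unfolding ent_alg by (simp add: level_def algebra_simps)
  qed
  with bound T'bound show ?thesis by blast
qed

end


section \<open>Convergence of the iteration\<close>

lemma convergent_if_geometric_steps:
  fixes X :: "nat \<Rightarrow> 'a::banach"
  assumes "\<And>k. norm (X (Suc k) - X k) \<le> K / 2 ^ k"
  shows "convergent X"
proof -
  have "summable (\<lambda>k. K / 2 ^ k)"
    using summable_mult[OF summable_geometric[of "1/2 :: real"], of K] by (simp add: power_divide)
  then have "summable (\<lambda>k. norm (X (Suc k) - X k))"
    by (rule summable_comparison_test'[where N = 0]) (use assms in auto)
  then have "summable (\<lambda>k. X (Suc k) - X k)" by (rule summable_norm_cancel)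
  then have "convergent (\<lambda>n. \<Sum>k<n. X (Suc k) - X k)" by (simp add: summable_iff_convergent)
  then have "convergent (\<lambda>n. X n - X 0)" by (simp add: sum_lessThan_telescope)
  then have "convergent (\<lambda>n. (X n - X 0) + X 0)" by (rule convergent_add[OF _ convergent_const])
  then show ?thesis by simp
qed

text \<open>With \<open>a k = exp (- M (3/2)\<^sup>k)\<close>, \<open>N k = (2 M + 8) 3\<^sup>k\<close> and losses of decay \<open>2\<^sup>-\<^sup>k\<^sup>-\<^sup>2\<close>, the exponents satisfy
\<open>a (Suc k) = a k powr (3/2)\<close> and \<open>2\<^sup>-\<^sup>k\<^sup>-\<^sup>2 N k = (M/2 + 2) (3/2)\<^sup>k\<close>.  The truncation error is therefore below
\<open>a (Suc k) / 2\<close>, and the quadratic error too once \<open>M\<close> is so large that the powers of \<open>N k\<close>,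
which grow only like \<open>3\<^sup>k\<^sup>\<tau>\<close>, are beaten by \<open>exp (- M (3/2)\<^sup>k / 2)\<close>.\<close>

lemma kam_parameters:
  fixes c \<tau> \<delta> :: real
  assumes c: "0 < c" and \<tau>: "0 \<le> \<tau>" and \<delta>: "0 < \<delta>" "\<delta> \<le> 1"
  shows "\<exists>a N. \<forall>k::nat. 0 < a k \<and> a k \<le> \<delta> / 2 ^ Suc k \<and> 1 \<le> N k \<and>
     4 / c * N k powr \<tau> * a k \<le> \<delta> / 2 ^ k \<and>
     2 * (exp (- (1 / 2 ^ (k + 2) * N k)) * a k + 2 * (4 / c * N k powr \<tau> * a k) * a k) \<le> a (Suc k)"
proof -
  \<comment> \<open>\<open>y powr \<tau> \<le> s powr - \<tau> * exp (\<tau> s y)\<close> with \<open>\<tau> s \<le> 1/8\<close> turns the polynomial factor into \<open>exp (M/4 + 1)\<close>\<close>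
  define s where "s = 1 / (8 * (\<tau> + 1))"
  have s: "0 < s" "\<tau> * s \<le> 1/8" using \<tau> by (auto simp: s_def field_simps)
  define \<kappa> where "\<kappa> = \<delta> / 8 / (4 / c * s powr - \<tau> * exp 1)"
  have \<kappa>: "0 < \<kappa>" using \<delta> c s by (simp add: \<kappa>_def)
  define M where "M = max (max (4 * (\<tau> * ln 3 + ln 2)) (- 4 * ln \<kappa>)) (- ln (\<delta> / 2))"
  have M1: "4 * (\<tau> * ln 3 + ln 2) \<le> M" and M2: "- 4 * ln \<kappa> \<le> M" and M3: "- ln (\<delta> / 2) \<le> M"
    by (auto simp: M_def)
  have M0: "4 * ln 2 \<le> M" using M1 \<tau> by (smt (verit) ln_ge_zero mult_nonneg_nonneg numeral_le_one_iff semiring_norm(70))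
  have Mpos: "0 < M" using M0 ln_gt_zero[of "2::real"] by linarith
  have eM: "exp (- M) \<le> \<delta> / 2" using M3 \<delta> exp_le_cancel_iff[of "- M" "ln (\<delta>/2)"] by simp
  have eM2: "exp (- (M / 2)) \<le> 1 / 2"
  proof -
    have "exp (- (M / 2)) \<le> exp (- ln 2)" using M0 ln_gt_zero[of "2::real"] by (subst exp_le_cancel_iff) linarith
    then show ?thesis by (simp add: exp_minus)
  qed
  have key: "4 / c * (2 * M + 8) powr \<tau> * exp (- (M / 2)) \<le> \<delta> / 8"
  proof -
    define y where "y = 2 * M + 8"
    have y: "0 < y" using Mpos by (simp add: y_def)
    have "s * y \<le> exp (s * y)" using exp_ge_add_one_self[of "s * y"] by linarith
    then have "y \<le> exp (s * y) / s" using s by (simp add: field_simps)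
    then have "y powr \<tau> \<le> (exp (s * y) / s) powr \<tau>" using y \<tau> by (intro powr_mono2) auto
    also have "\<dots> = s powr - \<tau> * exp (\<tau> * s * y)" using s by (simp add: powr_divide powr_minus exp_powr_real field_simps)
    also have "\<dots> \<le> s powr - \<tau> * exp (M / 4 + 1)"
    proof -
      have "\<tau> * s * y \<le> 1/8 * y" using s y by (intro mult_right_mono) auto
      then show ?thesis by (intro mult_left_mono) (auto simp: y_def)
    qed
    finally have "4 / c * y powr \<tau> * exp (- (M / 2)) \<le> 4 / c * (s powr - \<tau> * exp (M / 4 + 1)) * exp (- (M / 2))"
      using c by (intro mult_right_mono mult_left_mono) auto
    also have "\<dots> = (4 / c * s powr - \<tau> * exp 1) * exp (- (M / 4))"
    proof -
      have "exp (M / 4 + 1) * exp (- (M / 2)) = exp 1 * exp (- (M / 4))" by (simp add: exp_add[symmetric])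
      then show ?thesis by (simp add: mult.assoc)
    qed
    also have "\<dots> \<le> (4 / c * s powr - \<tau> * exp 1) * \<kappa>"
    proof -
      have "exp (- (M / 4)) \<le> exp (ln \<kappa>)" using M2 by (subst exp_le_cancel_iff) linarith
      then show ?thesis using \<kappa> c by (intro mult_left_mono) auto
    qed
    also have "\<dots> = \<delta> / 8" using c s by (simp add: \<kappa>_def)
    finally show ?thesis by (simp add: y_def)
  qed
  define L where "L = (\<lambda>k::nat. (3/2::real) ^ k)"
  define a where "a = (\<lambda>k. exp (- (M * L k)))"
  define N where "N = (\<lambda>k::nat. (2 * M + 8) * 3 ^ k)"
  have L: "1 + real k / 2 \<le> L k" for k
    using Bernoulli_inequality[of "1/2" k] by (simp add: L_def)
  have L1: "1 \<le> L k" for k using L[of k] by (smt (verit) of_nat_0_le_iff divide_nonneg_nonneg)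
  have ah: "a k = exp (- (M * L k / 2)) * exp (- (M * L k / 2))" for k by (simp add: a_def exp_add[symmetric])
  have aS: "a (Suc k) = a k * exp (- (M * L k / 2))" for k by (simp add: a_def L_def exp_add[symmetric] field_simps)
  have c1: "a k \<le> \<delta> / 2 ^ Suc k" for k
  proof -
    have "M * (1 + real k / 2) \<le> M * L k" using L Mpos by (intro mult_left_mono) auto
    then have "a k \<le> exp (- M - real k * (M / 2))" by (simp add: a_def algebra_simps)
    also have "\<dots> = exp (- M) * exp (- (M / 2)) ^ k" by (simp add: exp_of_nat_mult[symmetric] exp_add[symmetric] exp_diff exp_minus field_simps)
    also have "\<dots> \<le> (\<delta> / 2) * (1/2) ^ k" using eM eM2 \<delta> by (intro mult_mono power_mono) auto
    finally show ?thesis by (simp add: power_divide)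
  qed
  have c2: "4 / c * N k powr \<tau> * a k \<le> \<delta> / 8 / 2 ^ k * exp (- (M * L k / 2))" for k
  proof -
    have "N k powr \<tau> = (2 * M + 8) powr \<tau> * exp (real k * (\<tau> * ln 3))"
    proof -
      have "(3 ^ k) powr \<tau> = exp (real k * (\<tau> * ln 3))" by (simp add: powr_def ln_realpow ac_simps)
      then show ?thesis using Mpos by (simp add: N_def powr_mult)
    qed
    moreover have q: "exp (real k * (\<tau> * ln 3)) * exp (- (M * L k / 2)) \<le> exp (- (M / 2)) * (1 / 2 ^ k)"
    proof -
      have "M * (1 + real k / 2) \<le> M * L k" using L Mpos by (intro mult_left_mono) auto
      moreover have "real k * (4 * (\<tau> * ln 3 + ln 2)) \<le> real k * M" using M1 by (intro mult_left_mono) auto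
      ultimately have "real k * (\<tau> * ln 3) - M * L k / 2 \<le> - (M / 2) - real k * ln 2" by (simp add: algebra_simps)
      then have "exp (real k * (\<tau> * ln 3) - M * L k / 2) \<le> exp (- (M / 2) - real k * ln 2)" by simp
      also have "\<dots> = exp (- (M / 2)) * (1 / 2 ^ k)" by (simp add: exp_diff exp_of_nat_mult)
      finally show ?thesis by (simp add: exp_add[symmetric])
    qed
    ultimately have "4 / c * N k powr \<tau> * a k \<le> 4 / c * (2 * M + 8) powr \<tau> * (exp (- (M / 2)) * (1 / 2 ^ k)) * exp (- (M * L k / 2))"
      unfolding ah using mult_left_mono[OF q, of "4 / c * (2 * M + 8) powr \<tau> * exp (- (M * L k / 2))"] c
      by (simp add: ac_simps)
    also have "\<dots> = (4 / c * (2 * M + 8) powr \<tau> * exp (- (M / 2))) * (1 / 2 ^ k * exp (- (M * L k / 2)))" by (simp add: ac_simps)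
    also have "\<dots> \<le> \<delta> / 8 * (1 / 2 ^ k * exp (- (M * L k / 2)))" using key by (intro mult_right_mono) auto
    finally show ?thesis by simp
  qed
  have "0 < a k \<and> a k \<le> \<delta> / 2 ^ Suc k \<and> 1 \<le> N k \<and> 4 / c * N k powr \<tau> * a k \<le> \<delta> / 2 ^ k \<and>
     2 * (exp (- (1 / 2 ^ (k + 2) * N k)) * a k + 2 * (4 / c * N k powr \<tau> * a k) * a k) \<le> a (Suc k)" for k
  proof (intro conjI)
    show "0 < a k" by (simp add: a_def)
    show "a k \<le> \<delta> / 2 ^ Suc k" by (rule c1)
    show "1 \<le> N k" using mult_mono[of 1 "2 * M + 8" 1 "3 ^ k"] Mpos by (simp add: N_def)
    have e1: "exp (- (M * L k / 2)) \<le> 1" using Mpos L1[of k] by simp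
    have "\<delta> / 8 / 2 ^ k * exp (- (M * L k / 2)) \<le> \<delta> / 8 / 2 ^ k * 1" using e1 \<delta> by (intro mult_left_mono) auto
    also have "\<dots> \<le> \<delta> / 2 ^ k" using \<delta> by (simp add: field_simps)
    finally show "4 / c * N k powr \<tau> * a k \<le> \<delta> / 2 ^ k" using c2[of k] by linarith
    have "\<delta> / 8 / 2 ^ k \<le> 1 / 8"
    proof -
      have "\<delta> / 8 / 2 ^ k \<le> \<delta> / 8 / 1" using \<delta> by (intro divide_left_mono) auto
      also have "\<dots> \<le> 1 / 8" using \<delta> by simp
      finally show ?thesis .
    qed
    then have "\<delta> / 8 / 2 ^ k * exp (- (M * L k / 2)) \<le> 1/8 * exp (- (M * L k / 2))" by (rule mult_right_mono) simp
    then have w8: "4 / c * N k powr \<tau> * a k \<le> 1/8 * exp (- (M * L k / 2))" using c2[of k] by linarith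
    have e4: "exp (- (1 / 2 ^ (k + 2) * N k)) \<le> 1/4 * exp (- (M * L k / 2))"
    proof -
      have "1 / 2 ^ (k + 2) * N k = (M / 2 + 2) * L k" by (simp add: N_def L_def power_divide field_simps)
      also have "\<dots> \<ge> M * L k / 2 + 2" using L1[of k] by (simp add: algebra_simps)
      finally have "exp (- (1 / 2 ^ (k + 2) * N k)) \<le> exp (- (M * L k / 2) - 2)" by simp
      also have "\<dots> = exp (- 2) * exp (- (M * L k / 2))" by (simp add: exp_add[symmetric])
      also have "\<dots> \<le> 1/4 * exp (- (M * L k / 2))"
      proof (rule mult_right_mono)
        have "(2::real) \<le> exp 1" using exp_ge_add_one_self[of "1::real"] by simp
        then have "2 * 2 \<le> exp (1::real) * exp 1" by (intro mult_mono) auto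
        then have "4 \<le> exp (2::real)" by (simp add: exp_add[symmetric])
        then show "exp (- 2) \<le> (1/4::real)" by (simp add: exp_minus field_simps)
      qed simp
      finally show ?thesis .
    qed
    have "2 * (exp (- (1 / 2 ^ (k + 2) * N k)) * a k + 2 * (4 / c * N k powr \<tau> * a k) * a k)
      \<le> 2 * (1/4 * exp (- (M * L k / 2)) * a k + 2 * (1/8 * exp (- (M * L k / 2))) * a k)"
      using e4 w8 by (intro mult_left_mono add_mono mult_right_mono) (auto simp: a_def)
    also have "\<dots> = a (Suc k)" by (simp add: aS)
    finally show "2 * (exp (- (1 / 2 ^ (k + 2) * N k)) * a k + 2 * (4 / c * N k powr \<tau> * a k) * a k) \<le> a (Suc k)" .
  qed
  then show ?thesis by blast
qed

context perturbed_diagonal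
begin

text \<open>At step \<open>k\<close> the remainder has the rate \<open>1/2 + 2\<^sup>-\<^sup>k\<^sup>-\<^sup>1\<close> of decay, so every step may give up \<open>2\<^sup>-\<^sup>k\<^sup>-\<^sup>2\<close>
and the rate \<open>1/2\<close> remains in the limit.  The increments of \<open>T\<close> and \<open>G\<close> are summable, and the
gap between distinct levels survives because its error term tends to zero.\<close>

lemma kam_diagonalization:
  assumes \<eta>: "0 < \<eta>" "\<eta> \<le> 1/10" "\<eta>\<^sup>2 * Z \<le> 1/16" "9 * C * \<eta>\<^sup>2 * Z \<le> 1/8"
    and \<delta>: "0 < \<delta>" "\<delta> \<le> 1/2" "4 * \<delta> \<le> \<eta>" "\<delta> \<le> 3 / (110 * Z)"
    and par: "\<And>k::nat. 0 < a k \<and> a k \<le> \<delta> / 2 ^ Suc k \<and> 1 \<le> N k \<and> 4 / c * N k powr \<tau> * a k \<le> \<delta> / 2 ^ k \<and>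
     2 * (exp (- (1 / 2 ^ (k + 2) * N k)) * a k + 2 * (4 / c * N k powr \<tau> * a k) * a k) \<le> a (Suc k)"
    and P: "fam_bound 1 (a 0) P"
  shows "\<exists>G T. intertwines G T 0 \<and> norm (T - 1) \<le> 1/10 \<and>
    (\<forall>\<zeta>\<in>disc. \<forall>m n. m \<noteq> n \<longrightarrow> level G \<zeta> m \<noteq> level G \<zeta> n)"
proof -
  have Z: "1 \<le> Z" unfolding Z_eq by (rule lattice_sum_ge_1)
  define Inv where "Inv = (\<lambda>k (G, T, A). intertwines G T A \<and> fam_bound (1/2 + 1 / 2 ^ Suc k) (a k) A \<and>
     norm (T - 1) \<le> 4 * \<delta> * (1 - 1 / 2 ^ k) \<and> norm G \<le> \<delta> * (1 - 1 / 2 ^ k))"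
  define Stp where "Stp = (\<lambda>(k::nat) (G::'d dmat, T::'d dmat, A::'d dmat) (G'::'d dmat, T'::'d dmat, A'::'d dmat). G' = G + A \<and> norm (T' - T) \<le> (2 * \<delta>) / 2 ^ k)"
  have normA: "norm A \<le> a k" if "fam_bound (1/2 + 1 / 2 ^ Suc k) (a k) A" for A k
    unfolding norm_dmat_le_iff using that by (rule fam_bound_mono) auto
  have normP: "norm P \<le> a 0" unfolding norm_dmat_le_iff using P by (rule fam_bound_mono) auto
  have ak: "a k \<le> \<delta> / 2" for k
  proof -
    have "\<delta> / 2 ^ Suc k \<le> \<delta> / 2 ^ 1" using \<delta>(1) by (intro divide_left_mono power_increasing) auto
    then show ?thesis using par[of k] by simp
  qed
  have small: "2 * (a k + norm P) \<le> \<eta>" for k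
  proof -
    have "a k + norm P \<le> \<delta> / 2 + \<delta> / 2" using ak[of k] order.trans[OF normP ak[of 0]] by (rule add_mono)
    then show ?thesis using \<delta>(1) \<delta>(3) by simp
  qed
  have frac: "\<delta>' * (1 - 1 / 2 ^ k) \<le> \<delta>'" if "0 \<le> \<delta>'" for \<delta>' :: real and k :: nat
    using that by (simp add: algebra_simps)
  have "\<exists>f. \<forall>k. Inv k (f k) \<and> Stp k (f k) (f (Suc k))"
  proof (rule dependent_nat_choice)
    have "intertwines 0 1 P"
      unfolding intertwines_def by (auto simp: level_def ent_one)
    then show "\<exists>x. Inv 0 x" using P by (intro exI[of _ "(0, 1, P)"]) (simp add: Inv_def)
  next
    fix x and k :: nat assume "Inv k x"
    then obtain G T A where x: "x = (G, T, A)" and I: "intertwines G T A" and A: "fam_bound (1/2 + 1 / 2 ^ Suc k) (a k) A"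
      and T: "norm (T - 1) \<le> 4 * \<delta> * (1 - 1 / 2 ^ k)" and G: "norm G \<le> \<delta> * (1 - 1 / 2 ^ k)"
      by (cases x) (auto simp: Inv_def)
    define w where "w = 4 / c * N k powr \<tau> * a k"
    have T': "norm (T - 1) \<le> \<eta>" using T frac[of "4 * \<delta>" k] \<delta>(1-3) by linarith
    have G': "norm G \<le> 1" using G frac[of \<delta> k] \<delta>(1-3) by linarith
    have w\<delta>: "w \<le> \<delta> / 2 ^ k" using par[of k] by (simp add: w_def)
    have "\<delta> / 2 ^ k \<le> \<delta> / 1" using \<delta>(1) by (intro divide_left_mono) auto
    then have w1: "w \<le> \<delta>" using w\<delta> by simp
    then have w: "w \<le> 1/2" using \<delta> by simp
    have N1: "1 \<le> N k" using par[of k] by simp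
    have gap: "22 * Z * a k \<le> 3/20 * (c * N k powr - \<tau>)"
    proof -
      have "a k = w * (c * N k powr - \<tau>) / 4" using N1 c_pos by (simp add: w_def powr_minus field_simps)
      also have "\<dots> \<le> \<delta> * (c * N k powr - \<tau>) / 4" using w1 c_pos N1 by (intro divide_right_mono mult_right_mono) auto
      also have "\<dots> \<le> 3 / (110 * Z) * (c * N k powr - \<tau>) / 4" using \<delta> c_pos N1 by (intro divide_right_mono mult_right_mono) auto
      finally have "22 * Z * a k \<le> 22 * Z * (3 / (110 * Z) * (c * N k powr - \<tau>) / 4)" using Z by (intro mult_left_mono) auto
      also have "\<dots> = 3/20 * (c * N k powr - \<tau>)" using Z by (simp add: field_simps)
      finally show ?thesis .
    qed
    have \<rho>: "1/2 + 1 / 2 ^ Suc k - 1 / 2 ^ (k + 2) = 1/2 + 1 / (2::real) ^ Suc (Suc k)" by (simp add: field_simps)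
    have "\<exists>T' A'. intertwines (G + A) T' A' \<and> norm (T' - T) \<le> norm T * w \<and>
       fam_bound (1/2 + 1 / 2 ^ Suc k - 1 / 2 ^ (k + 2)) (2 * (exp (- (1 / 2 ^ (k + 2) * N k)) * a k + 2 * w * a k)) A'"
      by (rule kam_step[OF I T' \<eta>(2-4) A small G' _ _ N1 gap w_def w]) (auto simp: \<rho>)
    then obtain T2 A2 where 2: "intertwines (G + A) T2 A2" "norm (T2 - T) \<le> norm T * w"
       "fam_bound (1/2 + 1 / 2 ^ Suc (Suc k)) (2 * (exp (- (1 / 2 ^ (k + 2) * N k)) * a k + 2 * w * a k)) A2"
      unfolding \<rho> by blast
    have A2: "fam_bound (1/2 + 1 / 2 ^ Suc (Suc k)) (a (Suc k)) A2"
      using 2(3) order_refl by (rule fam_bound_mono) (use par[of k] in \<open>simp add: w_def\<close>)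
    have "norm T \<le> 2" using norm_triangle_ineq[of "T - 1" 1] T' \<eta> by simp
    moreover have "0 \<le> w" using par[of k] c_pos by (simp add: w_def)
    ultimately have "norm T * w \<le> 2 * w" by (rule mult_right_mono)
    then have "norm (T2 - T) \<le> 2 * (\<delta> / 2 ^ k)" using 2(2) w\<delta> by linarith
    then have st: "norm (T2 - T) \<le> 2 * \<delta> / 2 ^ k" by simp
    have "norm (T2 - 1) \<le> norm (T2 - T) + norm (T - 1)" using norm_triangle_ineq[of "T2 - T" "T - 1"] by simp
    then have "norm (T2 - 1) \<le> 2 * \<delta> / 2 ^ k + 4 * \<delta> * (1 - 1 / 2 ^ k)" using st T by linarith
    also have "\<dots> = 4 * \<delta> * (1 - 1 / 2 ^ Suc k)" by (simp add: field_simps)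
    finally have T2: "norm (T2 - 1) \<le> 4 * \<delta> * (1 - 1 / 2 ^ Suc k)" .
    have "norm (G + A) \<le> \<delta> * (1 - 1 / 2 ^ k) + \<delta> / 2 ^ Suc k"
      using norm_triangle_ineq[of G A] G normA[OF A] par[of k] by linarith
    also have "\<dots> = \<delta> * (1 - 1 / 2 ^ Suc k)" by (simp add: field_simps)
    finally have G2: "norm (G + A) \<le> \<delta> * (1 - 1 / 2 ^ Suc k)" .
    show "\<exists>y. Inv (Suc k) y \<and> Stp k x y"
      by (rule exI[of _ "(G + A, T2, A2)"]) (use 2(1) A2 T2 G2 st in \<open>simp add: x Inv_def Stp_def\<close>)
  qed
  then obtain f where f: "\<And>k. Inv k (f k)" "\<And>k. Stp k (f k) (f (Suc k))" by blast
  define Gs where "Gs = (\<lambda>k. fst (f k))"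
  define Ts where "Ts = (\<lambda>k. fst (snd (f k)))"
  define As where "As = (\<lambda>k. snd (snd (f k)))"
  have fk: "f k = (Gs k, Ts k, As k)" for k by (simp add: Gs_def Ts_def As_def)
  have I: "intertwines (Gs k) (Ts k) (As k)" and A: "norm (As k) \<le> a k"
    and T: "norm (Ts k - 1) \<le> 4 * \<delta> * (1 - 1 / 2 ^ k)" and G: "norm (Gs k) \<le> \<delta> * (1 - 1 / 2 ^ k)" for k
    using f(1)[of k] normA by (auto simp: Inv_def fk)
  have T': "norm (Ts k - 1) \<le> \<eta>" for k using T[of k] frac[of "4 * \<delta>" k] \<delta>(1-3) by linarith
  have G': "norm (Gs k) \<le> 1" for k using G[of k] frac[of \<delta> k] \<delta>(1-3) by linarith
  have Ak: "norm (As k) \<le> \<delta> / 2 ^ k" for k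
  proof -
    have "\<delta> / 2 ^ Suc k \<le> \<delta> / 2 ^ k" using \<delta>(1) by (intro divide_left_mono power_increasing) auto
    then show ?thesis using A[of k] par[of k] by linarith
  qed
  have "convergent Ts" using f(2) by (intro convergent_if_geometric_steps[of Ts "2 * \<delta>"]) (auto simp: Stp_def fk)
  then obtain TL where Tlim: "Ts \<longlonglongrightarrow> TL" by (auto simp: convergent_def)
  have "convergent Gs" using f(2) Ak by (intro convergent_if_geometric_steps[of Gs \<delta>]) (auto simp: Stp_def fk)
  then obtain GL where Glim: "Gs \<longlonglongrightarrow> GL" by (auto simp: convergent_def)
  have pow: "(\<lambda>k. \<delta> / 2 ^ k) \<longlonglongrightarrow> 0"
    using tendsto_mult[OF tendsto_const LIMSEQ_realpow_zero[of "1/2::real"], of \<delta>] by (simp add: power_divide)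
  have Alim: "As \<longlonglongrightarrow> 0"
    using Ak by (intro Lim_null_comparison[OF _ pow]) auto
  have alim: "a \<longlonglongrightarrow> 0"
  proof (rule Lim_null_comparison[OF _ pow])
    have "norm (a k) \<le> \<delta> / 2 ^ k" for k
    proof -
      have "\<delta> / 2 ^ Suc k \<le> \<delta> / 2 ^ k" using \<delta>(1) by (intro divide_left_mono power_increasing) auto
      then show ?thesis using par[of k] by simp
    qed
    then show "\<forall>\<^sub>F k in sequentially. norm (a k) \<le> \<delta> / 2 ^ k" by simp
  qed
  have lev: "(\<lambda>k. level (Gs k) \<zeta> m) \<longlonglongrightarrow> level GL \<zeta> m" for \<zeta> m
    unfolding level_def by (intro tendsto_intros tendsto_ent[OF Glim])
  have "intertwines GL TL 0"
    unfolding intertwines_def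
  proof (intro ballI allI)
    fix \<zeta> :: complex and i m :: "int^'d" assume \<zeta>: "\<zeta> \<in> disc"
    have l: "(\<lambda>k. complex_of_real (v i) * ent (Ts k) \<zeta> i m + ent (P * Ts k) \<zeta> i m) \<longlonglongrightarrow> complex_of_real (v i) * ent TL \<zeta> i m + ent (P * TL) \<zeta> i m"
      by (intro tendsto_add tendsto_mult tendsto_const tendsto_ent Tlim)
    have r: "(\<lambda>k. ent (Ts k) \<zeta> i m * level (Gs k) \<zeta> m + ent (Ts k * As k) \<zeta> i m) \<longlonglongrightarrow> ent TL \<zeta> i m * level GL \<zeta> m + ent (TL * 0) \<zeta> i m"
      by (intro tendsto_add tendsto_mult tendsto_ent Tlim lev Alim)
    have "complex_of_real (v i) * ent (Ts k) \<zeta> i m + ent (P * Ts k) \<zeta> i m = ent (Ts k) \<zeta> i m * level (Gs k) \<zeta> m + ent (Ts k * As k) \<zeta> i m" for k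
      using I[of k] \<zeta> unfolding intertwines_def by blast
    then show "complex_of_real (v i) * ent TL \<zeta> i m + ent (P * TL) \<zeta> i m = ent TL \<zeta> i m * level GL \<zeta> m + ent (TL * 0) \<zeta> i m"
      using LIMSEQ_unique[OF l] r by simp
  qed
  moreover have "norm (TL - 1) \<le> 1/10"
  proof (rule LIMSEQ_le_const2)
    show "(\<lambda>k. norm (Ts k - 1)) \<longlonglongrightarrow> norm (TL - 1)" by (intro tendsto_intros Tlim)
    show "\<exists>n0. \<forall>k\<ge>n0. norm (Ts k - 1) \<le> 1/10" using T' \<eta> order.trans by blast
  qed
  moreover have "level GL \<zeta> m \<noteq> level GL \<zeta> n" if \<zeta>: "\<zeta> \<in> disc" and mn: "m \<noteq> n" for \<zeta> m n
  proof -
    have "2/5 * \<bar>v m - v n\<bar> - 22 * Z * 0 \<le> cmod (level GL \<zeta> m - level GL \<zeta> n)"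
    proof (rule LIMSEQ_le)
      show "(\<lambda>k. 2/5 * \<bar>v m - v n\<bar> - 22 * Z * a k) \<longlonglongrightarrow> 2/5 * \<bar>v m - v n\<bar> - 22 * Z * 0" by (intro tendsto_intros alim)
      show "(\<lambda>k. cmod (level (Gs k) \<zeta> m - level (Gs k) \<zeta> n)) \<longlonglongrightarrow> cmod (level GL \<zeta> m - level GL \<zeta> n)" by (intro tendsto_intros lev)
      show "\<exists>k0. \<forall>k\<ge>k0. 2/5 * \<bar>v m - v n\<bar> - 22 * Z * a k \<le> cmod (level (Gs k) \<zeta> m - level (Gs k) \<zeta> n)"
        using level_gap[OF I \<zeta> T' \<eta>(2-4) A small G'] by blast
    qed
    moreover have "0 < \<bar>v m - v n\<bar>"
    proof -
      have "1 \<le> lnorm (m - n)" using mn by (intro lnorm_ge_1) simp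
      then have "0 < c * lnorm (m - n) powr - \<tau>" using c_pos by simp
      then show ?thesis using separated[OF mn] by linarith
    qed
    ultimately show ?thesis by auto
  qed
  ultimately show ?thesis by blast
qed

end


section \<open>Monotone potentials\<close>

text \<open>Compactness of the extended reals: arbitrarily short increments with slope at most \<open>K\<close> have
a limiting slope at most \<open>K\<close>.\<close>

lemma derivative_number_witness:
  assumes "\<And>d. d > 0 \<Longrightarrow> \<exists>h. h \<noteq> 0 \<and> \<bar>h\<bar> < d \<and> (f (x + h) - f x) / h \<le> K"
  shows "\<exists>L\<in>derivative_numbers f x. L \<le> ereal K"
proof -
  have "\<forall>k::nat. \<exists>h. h \<noteq> 0 \<and> \<bar>h\<bar> < 1 / real (Suc k) \<and> (f (x + h) - f x) / h \<le> K"
    using assms by simp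
  then obtain h where h: "\<And>k::nat. h k \<noteq> 0" "\<And>k. \<bar>h k\<bar> < 1 / real (Suc k)" "\<And>k. (f (x + h k) - f x) / h k \<le> K"
    by metis
  have h0: "h \<longlonglongrightarrow> 0"
    by (rule Lim_null_comparison[OF _ LIMSEQ_inverse_real_of_nat])
      (use h(2) in \<open>auto simp: inverse_eq_divide intro!: always_eventually less_imp_le\<close>)
  obtain L r where r: "strict_mono (r :: nat \<Rightarrow> nat)" "((\<lambda>k. ereal ((f (x + h k) - f x) / h k)) \<circ> r) \<longlonglongrightarrow> L"
    using compact_complete_linorder by metis
  have "L \<in> derivative_numbers f x"
    unfolding derivative_numbers_def
    using h(1) LIMSEQ_subseq_LIMSEQ[OF h0 r(1)] r(2)
    by (auto intro!: exI[of _ "h \<circ> r"] simp: comp_def)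
  moreover have "L \<le> ereal K"
    by (rule LIMSEQ_le_const2[OF r(2)]) (use h(3) in auto)
  ultimately show ?thesis by blast
qed

text \<open>A mean value inequality for derivative numbers.  Slopes are above any \<open>K' < K\<close> on all short intervals around a given
point, by the previous lemma, and lower bounds on slopes are additive over adjacent intervals,
so the bisection principle applies.\<close>

lemma slope_ge_derivative_numbers:
  assumes st: "s \<le> t" and D: "\<And>x L. x \<in> {s..t} \<Longrightarrow> L \<in> derivative_numbers f x \<Longrightarrow> ereal K \<le> L"
  shows "K * (t - s) \<le> f t - f s"
proof -
  have *: "K' * (t - s) \<le> f t - f s" if K': "K' < K" for K'
  proof (rule Bolzano[OF st, of "\<lambda>a b. K' * (b - a) \<le> f b - f a"])
    fix a b c
    assume "K' * (b - a) \<le> f b - f a" "K' * (c - b) \<le> f c - f b"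
    then show "K' * (c - a) \<le> f c - f a" by (simp add: algebra_simps)
  next
    fix x assume "s \<le> x" "x \<le> t"
    have "\<not> (\<exists>L\<in>derivative_numbers f x. L \<le> ereal K')"
      using D[of x] \<open>s \<le> x\<close> \<open>x \<le> t\<close> K' by (meson atLeastAtMost_iff ereal_less_eq(3) not_le order_trans)
    then obtain d where d: "d > 0" "\<And>h. h \<noteq> 0 \<Longrightarrow> \<bar>h\<bar> < d \<Longrightarrow> K' < (f (x + h) - f x) / h"
      using derivative_number_witness[of f x K'] by (meson not_le)
    have "K' * (b - a) \<le> f b - f a" if ab: "a \<le> x \<and> x \<le> b \<and> b - a < d" for a b
    proof -
      have "K' * (b - x) \<le> f b - f x"
      proof (cases "b = x")
        case False
        then have "K' < (f (x + (b - x)) - f x) / (b - x)" using ab by (intro d) auto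
        then show ?thesis using False ab by (simp add: field_simps)
      qed simp
      moreover have "K' * (x - a) \<le> f x - f a"
      proof (cases "a = x")
        case False
        then have "K' < (f (x + (a - x)) - f x) / (a - x)" using ab by (intro d) auto
        then show ?thesis using False ab by (simp add: field_simps)
      qed simp
      ultimately show ?thesis by (simp add: algebra_simps)
    qed
    then show "\<exists>d>0. \<forall>a b. a \<le> x \<and> x \<le> b \<and> b - a < d \<longrightarrow> K' * (b - a) \<le> f b - f a"
      using d(1) by blast
  qed
  show ?thesis
  proof (cases "s = t")
    case False
    then have ts: "t - s > 0" using st by simp
    have "K \<le> (f t - f s) / (t - s)"
      by (rule dense_le) (use * ts in \<open>simp add: field_simps\<close>)
    then show ?thesis using ts by (simp add: field_simps)
  qed simp
qed

lemma derivative_numbers_uminus: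
  assumes "L \<in> derivative_numbers (\<lambda>x. - f x) x"
  shows "- L \<in> derivative_numbers f x"
proof -
  obtain h where h: "\<forall>k::nat. h k \<noteq> 0" "h \<longlonglongrightarrow> 0" "(\<lambda>k. ereal ((- f (x + h k) - (- f x)) / h k)) \<longlonglongrightarrow> L"
    using assms unfolding derivative_numbers_def by blast
  have "(\<lambda>k. - ereal ((- f (x + h k) - (- f x)) / h k)) \<longlonglongrightarrow> - L"
    using h(3) by (rule tendsto_uminus_ereal)
  moreover have "(\<lambda>k. - ereal ((- f (x + h k) - (- f x)) / h k)) = (\<lambda>k. ereal ((f (x + h k) - f x) / h k))"
    by (simp add: fun_eq_iff minus_divide_left)
  ultimately show ?thesis using h by (auto simp: derivative_numbers_def)
qed

lemma slope_le_derivative_numbers: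
  assumes st: "s \<le> t" and D: "\<And>x L. x \<in> {s..t} \<Longrightarrow> L \<in> derivative_numbers f x \<Longrightarrow> L \<le> ereal K"
  shows "f t - f s \<le> K * (t - s)"
proof -
  have "- K * (t - s) \<le> - f t - - f s"
  proof (rule slope_ge_derivative_numbers[OF st])
    fix x L assume "x \<in> {s..t}" "L \<in> derivative_numbers (\<lambda>x. - f x) x"
    then have "- L \<le> ereal K" using D derivative_numbers_uminus by blast
    then show "ereal (- K) \<le> L" by (metis ereal_minus_le_minus ereal_uminus_uminus uminus_ereal.simps(1))
  qed
  then show ?thesis by simp
qed

text \<open>Regularity in terms of increments, with the minimal slope as a finite number: an infinite one would give
\<open>f\<close> unbounded increments on a compact interval.\<close>

lemma regular_slopes:
  assumes reg: "regular_at C f x" and D1: "D_min f x \<ge> 1"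
  obtains D where "1 \<le> D"
    "\<And>s t. s \<le> t \<Longrightarrow> {s..t} \<subseteq> level_nbhd f x 2 \<Longrightarrow> D * (t - s) \<le> f t - f s"
    "\<And>s t. s \<le> t \<Longrightarrow> {s..t} \<subseteq> level_nbhd f x 2 \<Longrightarrow> f t - f s \<le> C * D * (t - s)"
    "\<And>a1 b1 s t. level_nbhd f x 1 = {a1<..<b1} \<Longrightarrow> a1 < b1 \<Longrightarrow> b1 < s \<Longrightarrow> s \<le> t \<Longrightarrow> t < a1 + 1 \<Longrightarrow>
       \<bar>(if t = 1/2 then 0 else 1 / (f x - f t)) - (if s = 1/2 then 0 else 1 / (f x - f s))\<bar> \<le> C * D * (t - s)"
proof -
  obtain a b where ab: "a < b" "level_nbhd f x 2 = {a<..<b}"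
    and cr1: "\<And>y L. y \<in> {a<..<b} \<Longrightarrow> L \<in> derivative_numbers f y \<Longrightarrow> D_min f x \<le> L \<and> L \<le> ereal C * D_min f x"
    using reg unfolding regular_at_def by blast
  define g where "g = (\<lambda>y. if y = 1/2 then 0 else 1 / (f x - f y))"
  obtain a2 b2 where a2b2: "a2 < b2" "level_nbhd f x 1 = {a2<..<b2}"
    and cr2: "\<And>y L. y \<in> {b2<..<a2 + 1} \<Longrightarrow> L \<in> derivative_numbers g y \<Longrightarrow> \<bar>L\<bar> \<le> ereal C * D_min f x"
    using reg unfolding regular_at_def g_def Let_def by blast
  define D where "D = real_of_ereal (D_min f x)"
  define s0 where "s0 = (2 * a + b) / 3"
  define t0 where "t0 = (a + 2 * b) / 3"
  have s0t0: "s0 < t0" "{s0..t0} \<subseteq> {a<..<b}" using ab(1) by (auto simp: s0_def t0_def field_simps)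
  have "D_min f x \<noteq> \<infinity>"
  proof
    assume inf: "D_min f x = \<infinity>"
    have "K * (t0 - s0) \<le> f t0 - f s0" for K
    proof (rule slope_ge_derivative_numbers)
      fix y L assume "y \<in> {s0..t0}" "L \<in> derivative_numbers f y"
      then have "D_min f x \<le> L" using cr1 s0t0(2) by blast
      then show "ereal K \<le> L" using inf by simp
    qed (use s0t0 in simp)
    from this[of "(f t0 - f s0 + 1) / (t0 - s0)"] show False using s0t0 by simp
  qed
  then have Dm: "D_min f x = ereal D" using D1 unfolding D_def by (cases "D_min f x") auto
  have "1 \<le> D" using D1 by (simp add: Dm one_ereal_def)
  moreover have "D * (t - s) \<le> f t - f s" if "s \<le> t" "{s..t} \<subseteq> level_nbhd f x 2" for s t
    by (rule slope_ge_derivative_numbers[OF that(1)]) (use cr1 that ab Dm in auto)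
  moreover have "f t - f s \<le> C * D * (t - s)" if "s \<le> t" "{s..t} \<subseteq> level_nbhd f x 2" for s t
    by (rule slope_le_derivative_numbers[OF that(1)]) (use cr1 that ab Dm in auto)
  moreover have "\<bar>g t - g s\<bar> \<le> C * D * (t - s)"
    if "level_nbhd f x 1 = {a1<..<b1}" "a1 < b1" "b1 < s" "s \<le> t" "t < a1 + 1" for a1 b1 s t
  proof -
    have "a1 = a2" "b1 = b2" using that(1,2) a2b2 greaterThanLessThan_eq_iff[of a1 b1 a2 b2] by auto
    then have bd: "\<bar>L\<bar> \<le> ereal (C * D)" if "y \<in> {s..t}" "L \<in> derivative_numbers g y" for y L
      using cr2[of y L] that \<open>b1 < s\<close> \<open>t < a1 + 1\<close> Dm by auto
    have "g t - g s \<le> C * D * (t - s)"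
    proof (rule slope_le_derivative_numbers[OF that(4)])
      fix y L assume "y \<in> {s..t}" "L \<in> derivative_numbers g y"
      then have "\<bar>L\<bar> \<le> ereal (C * D)" by (rule bd)
      then show "L \<le> ereal (C * D)" by (cases L) auto
    qed
    moreover have "- (C * D) * (t - s) \<le> g t - g s"
    proof (rule slope_ge_derivative_numbers[OF that(4)])
      fix y L assume "y \<in> {s..t}" "L \<in> derivative_numbers g y"
      then have "\<bar>L\<bar> \<le> ereal (C * D)" by (rule bd)
      then show "ereal (- (C * D)) \<le> L" by (cases L) auto
    qed
    ultimately show ?thesis by (simp add: abs_le_iff)
  qed
  ultimately show thesis by (intro that[of D]) (auto simp: g_def)
qed


locale monotone_potential =
  fixes f :: "real \<Rightarrow> real" and C :: real
  assumes cont: "continuous_on {-1/2<..<1/2} f"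
    and left: "filterlim f at_bot (at_right (-1/2))"
    and right: "filterlim f at_top (at_left (1/2))"
    and periodic: "\<And>x. x \<notin> half_integers \<Longrightarrow> f (x + 1) = f x"
    and regular: "\<And>x. x \<in> {-1/2<..<1/2} \<Longrightarrow> regular_at C f x"
    and Dmin: "\<And>x. x \<in> {-1/2<..<1/2} \<Longrightarrow> D_min f x \<ge> 1"
begin

abbreviation I :: "real set" where "I \<equiv> {-1/2<..<1/2}"

lemma slope_ge_1:
  assumes "s \<in> I" "t \<in> I" "s \<le> t"
  shows "t - s \<le> f t - f s"
proof -
  have "1 * (t - s) \<le> f t - f s"
  proof (rule slope_ge_derivative_numbers[OF assms(3)])
    fix x L assume x: "x \<in> {s..t}" and L: "L \<in> derivative_numbers f x"
    have xI: "x \<in> I" using x assms by auto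
    then have "x \<in> level_nbhd f x 2" by (simp add: level_nbhd_def)
    then have "D_min f x \<le> L" unfolding D_min_def using L by (intro Inf_lower) auto
    then show "ereal 1 \<le> L" using Dmin[OF xI] by (simp add: one_ereal_def[symmetric])
  qed
  then show ?thesis by simp
qed

lemma less_iff: "s \<in> I \<Longrightarrow> t \<in> I \<Longrightarrow> f s < f t \<longleftrightarrow> s < t"
  using slope_ge_1[of s t] slope_ge_1[of t s] by (cases s t rule: linorder_cases) auto

lemma le_iff: "s \<in> I \<Longrightarrow> t \<in> I \<Longrightarrow> f s \<le> f t \<longleftrightarrow> s \<le> t"
  using less_iff[of t s] by (auto simp: not_less[symmetric])

lemma attains: obtains x where "x \<in> I" "f x = y"
proof -
  have "eventually (\<lambda>x. f x < y) (at_right (-1/2))"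
    using left by (auto simp: filterlim_at_bot_dense)
  then obtain b where b: "b > -1/2" "\<And>x. -1/2 < x \<Longrightarrow> x < b \<Longrightarrow> f x < y"
    unfolding eventually_at_right_field by auto
  define p where "p = (-1/2 + min b 0) / 2"
  have p: "p \<in> I" "f p < y" "p < 0" using b by (auto simp: p_def min_def field_simps intro!: b(2))
  have "eventually (\<lambda>x. y < f x) (at_left (1/2))"
    using right by (auto simp: filterlim_at_top_dense)
  then obtain c where c: "c < 1/2" "\<And>x. c < x \<Longrightarrow> x < 1/2 \<Longrightarrow> y < f x"
    unfolding eventually_at_left_field by auto
  define q where "q = (1/2 + max c 0) / 2"
  have q: "q \<in> I" "y < f q" "0 < q" using c by (auto simp: q_def max_def field_simps intro!: c(2))
  have "continuous_on {p..q} f" by (rule continuous_on_subset[OF cont]) (use p q in auto)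
  then obtain x where "p \<le> x" "x \<le> q" "f x = y" using IVT'[of f p y q] p q by auto
  then show thesis using p q by (intro that[of x]) auto
qed

lemma level_interval:
  assumes x: "x \<in> I" and r: "r > 0"
  obtains A B where "A \<in> I" "B \<in> I" "f A = f x - r" "f B = f x + r" "A < x" "x < B" "level_nbhd f x r = {A<..<B}"
proof -
  obtain A where A: "A \<in> I" "f A = f x - r" by (rule attains)
  obtain B where B: "B \<in> I" "f B = f x + r" by (rule attains)
  have "A < x" using less_iff[of A x] A x r by simp
  moreover have "x < B" using less_iff[of x B] B x r by simp
  moreover have "level_nbhd f x r = {A<..<B}"
  proof (intro set_eqI iffI)
    fix y assume "y \<in> level_nbhd f x r"
    then have y: "y \<in> I" "f A < f y" "f y < f B" using A B by (auto simp: level_nbhd_def)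
    then show "y \<in> {A<..<B}" using less_iff[of A y] less_iff[of y B] A B by simp
  next
    fix y assume "y \<in> {A<..<B}"
    then have "y \<in> I" "A < y" "y < B" using A B by auto
    moreover from this have "f A < f y" "f y < f B" using less_iff[of A y] less_iff[of y B] A B by auto
    ultimately show "y \<in> level_nbhd f x r" using A B by (auto simp: level_nbhd_def)
  qed
  ultimately show thesis using A B that by blast
qed

lemma mod1_unique:
  assumes "s \<in> I" "t \<in> I" "t - s \<in> \<int>"
  shows "s = t"
proof -
  obtain k where k: "t - s = real_of_int k" using assms(3) by (elim Ints_cases)
  then have "\<bar>real_of_int k\<bar> < 1" using assms by auto
  then have "k = 0" by linarith
  then show ?thesis using k by simp
qed

lemma Cgt: "1 \<le> C"
proof -
  have x0: "(0::real) \<in> I" by simp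
  obtain D where D: "1 \<le> D"
    "\<And>s t. s \<le> t \<Longrightarrow> {s..t} \<subseteq> level_nbhd f 0 2 \<Longrightarrow> D * (t - s) \<le> f t - f s"
    "\<And>s t. s \<le> t \<Longrightarrow> {s..t} \<subseteq> level_nbhd f 0 2 \<Longrightarrow> f t - f s \<le> C * D * (t - s)"
    by (rule regular_slopes[OF regular[OF x0] Dmin[OF x0]]) blast
  obtain A B where AB: "A < 0" "0 < B" "level_nbhd f 0 2 = {A<..<B}"
    by (rule level_interval[OF x0, of 2]) auto
  have "{0..B/2} \<subseteq> level_nbhd f 0 2" unfolding AB(3) using AB(1,2) by auto
  then have "D * (B / 2) \<le> C * D * (B / 2)" using D(2,3)[of 0 "B/2"] AB by simp
  then show ?thesis using D(1) AB by simp
qed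

text \<open>Let \<open>\<delta> = x' - x\<close> and let \<open>D\<close> be the minimal slope at \<open>x\<close>.  If \<open>\<bar>f x - f x'\<bar>\<close> is bounded below, the
triangle inequality suffices.  Otherwise \<open>C D \<bar>\<delta>\<bar>\<close> is small, whereas levels one half
apart near \<open>f x\<close> are attained at distance at least \<open>1 / (2 C D)\<close>; so moving by \<open>\<delta>\<close> cannot leave the region
where the slopes are at most \<open>C D\<close>, if \<open>y\<close> or \<open>y'\<close> has a level within one of \<open>f x\<close>.  If both have
levels further away, they lie on the complementary arc of the circle, on which \<open>1 / (f x - f)\<close> has
slopes at most \<open>C D\<close>; the omitted interval of nearby levels is longer than \<open>\<bar>\<delta>\<bar>\<close>, so \<open>y\<close> and \<open>y'\<close>
differ by exactly \<open>\<delta>\<close> along that arc.\<close>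

lemma chordal_lipschitz:
  assumes x: "x \<in> I" and x': "x' \<in> I" and y: "y \<in> I" and y': "y' \<in> I"
    and mod1: "(y' - y) - (x' - x) \<in> \<int>"
  shows "\<bar>f y - f y'\<bar> \<le> (1 + 2 * C) * \<bar>f x - f x'\<bar> * (1 + \<bar>f y - f x\<bar>) * (1 + \<bar>f y' - f x'\<bar>)"
proof -
  define X where "X = \<bar>f x - f x'\<bar>"
  define p where "p = \<bar>f y - f x\<bar>"
  define q where "q = \<bar>f y' - f x'\<bar>"
  have nn: "0 \<le> X" "0 \<le> p" "0 \<le> q" by (auto simp: X_def p_def q_def)
  have C1: "1 \<le> C" by (rule Cgt)
  have expand: "X * (1 + p) * (1 + q) = X + X * p + X * q + X * p * q" by (simp add: algebra_simps)
  have pos: "0 \<le> X * p" "0 \<le> X * q" "0 \<le> X * p * q" using nn by auto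
  have goal_C: ?thesis if "\<bar>f y - f y'\<bar> \<le> C * (X * (1 + p) * (1 + q))"
  proof -
    have "C * (X * (1 + p) * (1 + q)) \<le> (1 + 2 * C) * (X * (1 + p) * (1 + q))"
      using C1 nn by (intro mult_right_mono) auto
    then show ?thesis using that by (simp add: X_def p_def q_def mult.assoc)
  qed
  show ?thesis
  proof (cases "1 / (2 * C) \<le> X")
    case True
    then have XC: "1 \<le> 2 * C * X" using C1 by (simp add: field_simps)
    have "\<bar>f y - f y'\<bar> \<le> X + p + q" by (simp add: X_def p_def q_def)
    moreover have "1 * (p + q) \<le> (2 * C * X) * (p + q)" using XC nn by (intro mult_right_mono) auto
    moreover have "X + 2 * C * (X * p + X * q) \<le> (1 + 2 * C) * (X * (1 + p) * (1 + q))"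
    proof -
      have "(1 + 2 * C) * (X * (1 + p) * (1 + q)) = X + 2 * C * (X * p + X * q) + (2 * C * X + (X * p + X * q) + (1 + 2 * C) * (X * p * q))"
        unfolding expand by (simp add: algebra_simps)
      moreover have "0 \<le> 2 * C * X + (X * p + X * q) + (1 + 2 * C) * (X * p * q)"
        using pos nn C1 by (intro add_nonneg_nonneg mult_nonneg_nonneg) auto
      ultimately show ?thesis by linarith
    qed
    ultimately have "\<bar>f y - f y'\<bar> \<le> (1 + 2 * C) * (X * (1 + p) * (1 + q))" by (simp add: algebra_simps)
    then show ?thesis by (simp add: X_def p_def q_def mult.assoc)
  next
    case False
    then have Xs: "2 * C * X < 1" using C1 by (simp add: field_simps)
    have "X * 1 \<le> X * C" using C1 nn by (intro mult_left_mono) auto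
    then have "X \<le> C * X" by (simp add: mult.commute)
    then have X2: "X < 1/2" using Xs by linarith
    have fx': "f x - 2 < f x'" "f x' < f x + 2" using X2 unfolding X_def by linarith+
    define \<delta> where "\<delta> = x' - x"
    obtain D where D: "1 \<le> D"
      "\<And>s t. s \<le> t \<Longrightarrow> {s..t} \<subseteq> level_nbhd f x 2 \<Longrightarrow> D * (t - s) \<le> f t - f s"
      "\<And>s t. s \<le> t \<Longrightarrow> {s..t} \<subseteq> level_nbhd f x 2 \<Longrightarrow> f t - f s \<le> C * D * (t - s)"
      "\<And>a1 b1 s t. level_nbhd f x 1 = {a1<..<b1} \<Longrightarrow> a1 < b1 \<Longrightarrow> b1 < s \<Longrightarrow> s \<le> t \<Longrightarrow> t < a1 + 1 \<Longrightarrow>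
         \<bar>(if t = 1/2 then 0 else 1 / (f x - f t)) - (if s = 1/2 then 0 else 1 / (f x - f s))\<bar> \<le> C * D * (t - s)"
      by (rule regular_slopes[OF regular[OF x] Dmin[OF x]]) (rule that; assumption)
    have nbhd2: "{s..t} \<subseteq> level_nbhd f x 2" if "s \<in> I" "t \<in> I" "f x - 2 < f s" "f t < f x + 2" for s t
    proof
      fix z assume z: "z \<in> {s..t}"
      then have "z \<in> I" using that by auto
      then have "f s \<le> f z" "f z \<le> f t" using z that le_iff[of s z] le_iff[of z t] by auto
      then show "z \<in> level_nbhd f x 2" using that \<open>z \<in> I\<close> by (simp add: level_nbhd_def)
    qed
    have D\<delta>: "D * \<bar>\<delta>\<bar> \<le> X"
    proof (cases "x \<le> x'")
      case True
      then have "D * (x' - x) \<le> f x' - f x" using fx' x x' by (intro D(2) nbhd2) auto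
      then show ?thesis using True by (simp add: \<delta>_def X_def)
    next
      case False
      then have "D * (x - x') \<le> f x - f x'" using fx' x x' by (intro D(2) nbhd2) auto
      then show ?thesis using False by (simp add: \<delta>_def X_def)
    qed
    have CD: "0 < C * D" using C1 D(1) by simp
    have CD\<delta>: "C * D * \<bar>\<delta>\<bar> \<le> C * X" using mult_left_mono[OF D\<delta>, of C] C1 by (simp add: mult.assoc)
    then have small: "C * D * \<bar>\<delta>\<bar> < 1/2" using Xs by linarith
    have near: "z + \<delta>' \<in> I \<and> \<bar>f (z + \<delta>') - f z\<bar> \<le> C * X"
      if z: "z \<in> I" and fz: "\<bar>f z - f x\<bar> \<le> 1" and \<delta>': "\<bar>\<delta>'\<bar> = \<bar>\<delta>\<bar>" for z \<delta>'
    proof -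
      have fz': "f x - 1 \<le> f z" "f z \<le> f x + 1" using fz by linarith+
      obtain A B where AB: "A \<in> I" "B \<in> I" "f A = f x - 3/2" "f B = f x + 3/2"
        by (rule level_interval[OF x, of "3/2"]) (simp, rule that, assumption+)
      have "A < z" "z < B" using less_iff[of A z] less_iff[of z B] AB z fz' by auto
      have "1/2 \<le> f B - f z" "1/2 \<le> f z - f A" using AB fz' by auto
      moreover have "f B - f z \<le> C * D * (B - z)" using \<open>z < B\<close> AB z fz' by (intro D(3) nbhd2) auto
      moreover have "f z - f A \<le> C * D * (z - A)" using \<open>A < z\<close> AB z fz' by (intro D(3) nbhd2) auto
      ultimately have "C * D * \<bar>\<delta>\<bar> < C * D * (B - z)" "C * D * \<bar>\<delta>\<bar> < C * D * (z - A)" using small by linarith+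
      then have "\<bar>\<delta>\<bar> < B - z" "\<bar>\<delta>\<bar> < z - A" unfolding mult_less_cancel_left_pos[OF CD] by blast+
      then have in_AB: "A < z + \<delta>'" "z + \<delta>' < B" using \<delta>' by linarith+
      then have zI: "z + \<delta>' \<in> I" using AB by auto
      then have lv: "f A < f (z + \<delta>')" "f (z + \<delta>') < f B" using less_iff[of A "z + \<delta>'"] less_iff[of "z + \<delta>'" B] AB in_AB by auto
      have "\<bar>f (z + \<delta>') - f z\<bar> \<le> C * D * \<bar>\<delta>\<bar>"
      proof (cases "0 \<le> \<delta>'")
        case True
        then have "f z \<le> f (z + \<delta>')" using le_iff[OF z zI] by simp
        moreover have "f (z + \<delta>') - f z \<le> C * D * (z + \<delta>' - z)" using True zI z AB lv fz' by (intro D(3) nbhd2) auto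
        ultimately show ?thesis using True \<delta>' by simp
      next
        case False
        then have "f (z + \<delta>') \<le> f z" using le_iff[OF zI z] by simp
        moreover have "f z - f (z + \<delta>') \<le> C * D * (z - (z + \<delta>'))" using False zI z AB lv fz' by (intro D(3) nbhd2) auto
        moreover have "z - (z + \<delta>') = \<bar>\<delta>\<bar>" using False \<delta>' by simp
        ultimately show ?thesis by simp
      qed
      then show ?thesis using zI CD\<delta> by linarith
    qed
    have one: "C * X \<le> C * (X * (1 + p) * (1 + q))" unfolding expand using pos C1 by (intro mult_left_mono) auto
    consider (n1) "\<bar>f y - f x\<bar> \<le> 1" | (n2) "\<bar>f y' - f x\<bar> \<le> 1" | (far) "1 < \<bar>f y - f x\<bar>" "1 < \<bar>f y' - f x\<bar>" by linarith
    then show ?thesis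
    proof cases
      case n1
      have "y + \<delta> = y'" using near[OF y n1, of \<delta>] y' mod1 by (intro mod1_unique) (auto simp: \<delta>_def algebra_simps)
      then have "\<bar>f y - f y'\<bar> \<le> C * X" using near[OF y n1, of \<delta>] by auto
      then show ?thesis using one by (intro goal_C) linarith
    next
      case n2
      have "y = y' + - \<delta>" using near[OF y' n2, of "- \<delta>"] y mod1 Ints_minus[OF mod1] by (intro mod1_unique) (auto simp: \<delta>_def algebra_simps)
      then have "\<bar>f y - f y'\<bar> \<le> C * X" using near[OF y' n2, of "- \<delta>"] by auto
      then show ?thesis using one by (intro goal_C) linarith
    next
      case far
      obtain a1 b1 where ab: "a1 \<in> I" "b1 \<in> I" "f a1 = f x - 1" "f b1 = f x + 1" "a1 < x" "x < b1" "level_nbhd f x 1 = {a1<..<b1}"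
        by (rule level_interval[OF x, of 1]) (simp, rule that, assumption+)
      have width: "\<bar>\<delta>\<bar> < b1 - a1"
      proof -
        have "f b1 - f a1 \<le> C * D * (b1 - a1)" using ab by (intro D(3) nbhd2) auto
        then have "C * D * \<bar>\<delta>\<bar> < C * D * (b1 - a1)" using ab small by linarith
        then show ?thesis unfolding mult_less_cancel_left_pos[OF CD] .
      qed
      \<comment> \<open>the arc from \<open>b1\<close> through the pole at \<open>1/2\<close> to \<open>a1 + 1\<close>\<close>
      define lift where "lift = (\<lambda>z. if b1 < z then z else z + 1)"
      have lift: "b1 < lift z \<and> lift z < a1 + 1 \<and> lift z \<noteq> 1/2 \<and> f (lift z) = f z \<and> lift z - z \<in> \<int>"
        if z: "z \<in> I" and fz: "1 < \<bar>f z - f x\<bar>" for z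
      proof (cases "b1 < z")
        case True
        then show ?thesis using z ab by (auto simp: lift_def)
      next
        case False
        have "z \<notin> half_integers"
          unfolding half_integers_def
        proof
          assume "z \<in> {real_of_int k + 1 / 2 |k. True}"
          then obtain k where k: "z = real_of_int k + 1/2" by blast
          then have "- 1 < real_of_int k" "real_of_int k < 0" using z by auto
          then have "- 1 < k" "k < 0" by linarith+
          then show False by simp
        qed
        then have "f (z + 1) = f z" by (rule periodic)
        moreover have "z < a1"
        proof -
          have "f z \<le> f b1" using le_iff[of z b1] z ab False by simp
          then have "f z < f a1" using fz ab by auto
          then show ?thesis using less_iff[of z a1] z ab by simp
        qed
        ultimately show ?thesis using z ab False by (auto simp: lift_def)
      qed
      note ly = lift[OF y far(1)] and ly' = lift[OF y' far(2)]
      have "lift y' - lift y - \<delta> \<in> \<int>"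
      proof -
        have "lift y' - lift y - \<delta> = (lift y' - y') - (lift y - y) + ((y' - y) - (x' - x))" by (simp add: \<delta>_def)
        then show ?thesis using ly ly' mod1 by (metis Ints_add Ints_diff)
      qed
      then obtain k where k: "lift y' - lift y - \<delta> = real_of_int k" by (elim Ints_cases)
      have "\<bar>lift y' - lift y\<bar> < 1 - (b1 - a1)" using ly ly' by linarith
      then have "\<bar>real_of_int k\<bar> < 1" using width k by linarith
      then have "k = 0" by linarith
      then have diff: "lift y' - lift y = \<delta>" using k by simp
      have g: "\<bar>1 / (f x - f y') - 1 / (f x - f y)\<bar> \<le> C * X"
      proof (cases "lift y \<le> lift y'")
        case True
        have "\<bar>1 / (f x - f y') - 1 / (f x - f y)\<bar> \<le> C * D * (lift y' - lift y)"
          using D(4)[OF ab(7), of "lift y" "lift y'"] True ly ly' ab by auto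
        then show ?thesis using CD\<delta> diff True by simp
      next
        case False
        have "\<bar>1 / (f x - f y) - 1 / (f x - f y')\<bar> \<le> C * D * (lift y - lift y')"
          using D(4)[OF ab(7), of "lift y'" "lift y"] False ly ly' ab by auto
        moreover have "lift y - lift y' = \<bar>\<delta>\<bar>" using diff False by simp
        ultimately show ?thesis using CD\<delta> by (simp add: abs_minus_commute)
      qed
      have nz: "f x - f y \<noteq> 0" "f x - f y' \<noteq> 0" using far by auto
      have "f y' - f y = (1 / (f x - f y') - 1 / (f x - f y)) * ((f x - f y) * (f x - f y'))"
      proof -
        have "(1 / b - 1 / a) * (a * b) = a - b" if "a \<noteq> 0" "b \<noteq> 0" for a b :: real
          using that by (simp add: field_simps)
        from this[OF nz] show ?thesis by simp
      qed
      then have "\<bar>f y - f y'\<bar> = \<bar>1 / (f x - f y') - 1 / (f x - f y)\<bar> * (\<bar>f x - f y\<bar> * \<bar>f x - f y'\<bar>)"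
        by (metis abs_minus_commute abs_mult)
      also have "\<dots> \<le> (C * X) * ((1 + p) * (1 + q))"
      proof -
        have "\<bar>f x - f y\<bar> \<le> 1 + p" "\<bar>f x - f y'\<bar> \<le> 1 + q"
          using X2 unfolding X_def p_def q_def by linarith+
        then show ?thesis using g C1 nn by (intro mult_mono) auto
      qed
      finally show ?thesis by (intro goal_C) (simp add: ac_simps)
    qed
  qed
qed

end


section \<open>Square-summable sequences and decaying matrices\<close>

lemma ell2I:
  assumes "\<And>F. finite F \<Longrightarrow> (\<Sum>n\<in>F. (cmod (u n))\<^sup>2) \<le> B"
  shows "u \<in> ell2" "(\<Sum>\<^sub>\<infinity>n. (cmod (u n))\<^sup>2) \<le> B" "ell2_norm u \<le> sqrt B"
proof -
  have *: "(\<Sum>n\<in>F. norm ((cmod (u n))\<^sup>2)) \<le> B" if "finite F" for F using assms[OF that] by simp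
  show "u \<in> ell2" "(\<Sum>\<^sub>\<infinity>n. (cmod (u n))\<^sup>2) \<le> B"
    using abs_summable_on_if_bounded[OF *] by (auto simp: ell2_def)
  then show "ell2_norm u \<le> sqrt B" by (simp add: ell2_norm_def)
qed

lemma ell2_sum_le:
  assumes "u \<in> ell2" "finite F"
  shows "(\<Sum>n\<in>F. (cmod (u n))\<^sup>2) \<le> (ell2_norm u)\<^sup>2"
proof -
  have s: "(\<lambda>n. (cmod (u n))\<^sup>2) summable_on UNIV" using assms by (simp add: ell2_def)
  have "0 \<le> (\<Sum>\<^sub>\<infinity>n. (cmod (u n))\<^sup>2)" by (rule infsum_nonneg) simp
  moreover have "(\<Sum>n\<in>F. (cmod (u n))\<^sup>2) \<le> (\<Sum>\<^sub>\<infinity>n. (cmod (u n))\<^sup>2)"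
    using finite_sum_le_infsum[OF s assms(2)] by simp
  ultimately show ?thesis by (simp add: ell2_norm_def)
qed

lemma ell2_norm_nonneg: "0 \<le> ell2_norm u"
  by (simp add: ell2_norm_def infsum_nonneg)

lemma ell2_bounded:
  assumes "u \<in> ell2" shows "cmod (u n) \<le> ell2_norm u"
  using ell2_sum_le[OF assms, of "{n}"] ell2_norm_nonneg[of u] by (simp add: power2_le_iff_abs_le)

lemma ell2_dominated:
  assumes "u \<in> ell2" "\<And>n. cmod (w n) \<le> c * cmod (u n)"
  shows "w \<in> ell2"
proof (rule ell2I(1))
  fix F :: "'a set" assume "finite F"
  have "(\<Sum>n\<in>F. (cmod (w n))\<^sup>2) \<le> (\<Sum>n\<in>F. (c * cmod (u n))\<^sup>2)"
    using assms(2) by (intro sum_mono power_mono) auto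
  also have "\<dots> = c\<^sup>2 * (\<Sum>n\<in>F. (cmod (u n))\<^sup>2)" by (simp add: power_mult_distrib sum_distrib_left)
  also have "\<dots> \<le> c\<^sup>2 * (ell2_norm u)\<^sup>2" using ell2_sum_le[OF assms(1) \<open>finite F\<close>] by (intro mult_left_mono) auto
  finally show "(\<Sum>n\<in>F. (cmod (w n))\<^sup>2) \<le> c\<^sup>2 * (ell2_norm u)\<^sup>2" .
qed

lemma ell2_add:
  assumes "u \<in> ell2" "w \<in> ell2"
  shows "(\<lambda>n. u n + w n) \<in> ell2"
proof (rule ell2I(1))
  fix F :: "'a set" assume "finite F"
  have "(\<Sum>n\<in>F. (cmod (u n + w n))\<^sup>2) \<le> (\<Sum>n\<in>F. 2 * (cmod (u n))\<^sup>2 + 2 * (cmod (w n))\<^sup>2)"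
  proof (rule sum_mono)
    fix n
    have "(cmod (u n + w n))\<^sup>2 \<le> (cmod (u n) + cmod (w n))\<^sup>2" by (intro power_mono norm_triangle_ineq) auto
    then show "(cmod (u n + w n))\<^sup>2 \<le> 2 * (cmod (u n))\<^sup>2 + 2 * (cmod (w n))\<^sup>2"
      using sum_squares_bound[of "cmod (u n)" "cmod (w n)"] by (simp add: power2_sum)
  qed
  also have "\<dots> \<le> 2 * (ell2_norm u)\<^sup>2 + 2 * (ell2_norm w)\<^sup>2"
    using ell2_sum_le[OF assms(1) \<open>finite F\<close>] ell2_sum_le[OF assms(2) \<open>finite F\<close>]
    by (simp add: sum.distrib sum_distrib_left[symmetric])
  finally show "(\<Sum>n\<in>F. (cmod (u n + w n))\<^sup>2) \<le> 2 * (ell2_norm u)\<^sup>2 + 2 * (ell2_norm w)\<^sup>2" .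
qed

lemma ell2_cmult: "u \<in> ell2 \<Longrightarrow> (\<lambda>n. c * u n) \<in> ell2"
  by (rule ell2_dominated[of u _ "cmod c"]) (auto simp: norm_mult)

lemma ell2_diff:
  assumes "u \<in> ell2" "w \<in> ell2"
  shows "(\<lambda>n. u n - w n) \<in> ell2"
  using ell2_add[OF assms(1) ell2_cmult[OF assms(2), of "-1"]] by simp

lemma ell2_mult_summable:
  assumes "u \<in> ell2" "w \<in> ell2"
  shows "(\<lambda>n. cmod (u n) * cmod (w n)) summable_on UNIV"
proof -
  have "(\<lambda>n. u n * w n) abs_summable_on UNIV"
  proof (rule Infinite_Sum.abs_summable_on_comparison_test')
    show "(\<lambda>n. (cmod (u n))\<^sup>2 + (cmod (w n))\<^sup>2) summable_on UNIV"
      using assms by (intro summable_on_add) (auto simp: ell2_def)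
    fix n
    have "0 \<le> cmod (u n) * cmod (w n)" by simp
    then show "norm (u n * w n) \<le> (cmod (u n))\<^sup>2 + (cmod (w n))\<^sup>2"
      unfolding norm_mult using sum_squares_bound[of "cmod (u n)" "cmod (w n)"] by linarith
  qed
  then show ?thesis by (simp add: norm_mult)
qed

lemma infsum_complex_of_real:
  assumes "f summable_on A"
  shows "(\<Sum>\<^sub>\<infinity>x\<in>A. complex_of_real (f x)) = complex_of_real (infsum f A)"
proof -
  have "((\<lambda>F. complex_of_real (sum f F)) \<longlongrightarrow> complex_of_real (infsum f A)) (finite_subsets_at_top A)"
    using has_sum_infsum[OF assms] by (intro tendsto_of_real) (simp add: has_sum_def)
  then have "((\<lambda>x. complex_of_real (f x)) has_sum complex_of_real (infsum f A)) A"
    by (simp add: has_sum_def)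
  then show ?thesis by (rule infsumI)
qed

definition half_lattice_sum :: "'d::finite itself \<Rightarrow> real" where
  "half_lattice_sum _ = (\<Sum>\<^sub>\<infinity>j::int^'d. exp (- (1/2 * lnorm j)))"

lemma half_lattice_sum_bounds:
  fixes m :: "int ^ 'd::finite"
  assumes "finite F"
  shows "(\<Sum>n\<in>F. exp (- (1/2 * lnorm (m - n)))) \<le> half_lattice_sum TYPE('d)"
    "(\<Sum>n\<in>F. exp (- (1/2 * lnorm (n - m)))) \<le> half_lattice_sum TYPE('d)"
proof -
  have "(\<Sum>n\<in>F. exp (- (1/2 * lnorm (m - n)))) = (\<Sum>j\<in>(\<lambda>n. m - n) ` F. exp (- (1/2 * lnorm j)))"
    by (subst sum.reindex) (auto simp: inj_on_def)
  also have "\<dots> \<le> half_lattice_sum TYPE('d)"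
    unfolding half_lattice_sum_def using assms
    by (intro finite_sum_le_infsum exp_lnorm_summable) auto
  finally show 1: "(\<Sum>n\<in>F. exp (- (1/2 * lnorm (m - n)))) \<le> half_lattice_sum TYPE('d)" .
  then show "(\<Sum>n\<in>F. exp (- (1/2 * lnorm (n - m)))) \<le> half_lattice_sum TYPE('d)"
    by (simp add: lnorm_minus_commute)
qed

lemma half_lattice_sum_nonneg: "0 \<le> half_lattice_sum TYPE('d::finite)"
  using half_lattice_sum_bounds(1)[of "{}"] by simp

definition matvec :: "('a \<Rightarrow> 'b \<Rightarrow> complex) \<Rightarrow> ('b \<Rightarrow> complex) \<Rightarrow> 'a \<Rightarrow> complex" where
  "matvec t w i = (\<Sum>\<^sub>\<infinity>n. t i n * w n)"

lemma matvec_abs_summable: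
  assumes "row_bound (1/2) K t" "w \<in> ell2"
  shows "(\<lambda>n. t i n * w n) abs_summable_on UNIV"
  by (rule abs_summable_mult_bounded[OF row_bound_abs_summable(1)[OF assms(1)] ell2_bounded[OF assms(2)]]) simp

lemma column_sum_le:
  fixes t :: "int ^ 'd::finite \<Rightarrow> int ^ 'd \<Rightarrow> complex"
  assumes t: "row_bound (1/2) K t" and F: "finite F"
  shows "(\<Sum>i\<in>F. cmod (t i n)) \<le> K * half_lattice_sum TYPE('d)"
proof -
  have "(\<Sum>i\<in>F. cmod (t i n)) \<le> (\<Sum>i\<in>F. K * exp (- (1/2 * lnorm (i - n))))"
    using row_bound_entry[OF t] by (intro sum_mono)
  also have "\<dots> \<le> K * half_lattice_sum TYPE('d)"
    unfolding sum_distrib_left[symmetric] using half_lattice_sum_bounds(2)[OF F] row_bound_nonneg[OF t]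
    by (intro mult_left_mono)
  finally show ?thesis .
qed

lemma column_abs_summable:
  assumes "row_bound (1/2) K (t :: int ^ 'd::finite \<Rightarrow> int ^ 'd \<Rightarrow> complex)"
  shows "(\<lambda>i. t i n) abs_summable_on UNIV"
  by (rule abs_summable_on_if_bounded(1)[OF column_sum_le[OF assms]])

lemma column_ell2:
  assumes t: "row_bound (1/2) K (t :: int ^ 'd::finite \<Rightarrow> int ^ 'd \<Rightarrow> complex)"
  shows "(\<lambda>i. t i n) \<in> ell2" "(\<Sum>\<^sub>\<infinity>i. (cmod (t i n))\<^sup>2) \<le> K * (K * half_lattice_sum TYPE('d))"
proof -
  have *: "(\<Sum>i\<in>F. (cmod (t i n))\<^sup>2) \<le> K * (K * half_lattice_sum TYPE('d))" if F: "finite F" for F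
  proof -
    have "(\<Sum>i\<in>F. (cmod (t i n))\<^sup>2) \<le> (\<Sum>i\<in>F. K * cmod (t i n))"
      using row_bound_entry0[OF t] by (intro sum_mono) (auto simp: power2_eq_square intro: mult_right_mono)
    also have "\<dots> \<le> K * (K * half_lattice_sum TYPE('d))"
      unfolding sum_distrib_left[symmetric] using column_sum_le[OF t F] row_bound_nonneg[OF t] by (intro mult_left_mono)
    finally show ?thesis .
  qed
  from ell2I(1,2)[OF this] show "(\<lambda>i. t i n) \<in> ell2" "(\<Sum>\<^sub>\<infinity>i. (cmod (t i n))\<^sup>2) \<le> K * (K * half_lattice_sum TYPE('d))" by auto
qed

text \<open>Rows and columns of \<open>t\<close> have bounded sums, by \<open>row_bound\<close> and by the entrywise decay it implies.\<close>

lemma schur_test: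
  fixes t :: "int ^ 'd::finite \<Rightarrow> int ^ 'd \<Rightarrow> complex"
  assumes t: "row_bound (1/2) K t" and w: "w \<in> ell2"
  shows "matvec t w \<in> ell2" "ell2_norm (matvec t w) \<le> sqrt (K * (K * half_lattice_sum TYPE('d))) * ell2_norm w"
proof -
  let ?S = "half_lattice_sum TYPE('d)"
  have K: "0 \<le> K" using row_bound_nonneg[OF t] .
  have fin: "(\<Sum>i\<in>F. (cmod (\<Sum>n\<in>M. t i n * w n))\<^sup>2) \<le> K * (K * ?S) * (ell2_norm w)\<^sup>2" if F: "finite F" and M: "finite M" for F M
  proof -
    have "(cmod (\<Sum>n\<in>M. t i n * w n))\<^sup>2 \<le> K * (\<Sum>n\<in>M. cmod (t i n) * (cmod (w n))\<^sup>2)" for i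
    proof -
      have "cmod (\<Sum>n\<in>M. t i n * w n) \<le> (\<Sum>n\<in>M. sqrt (cmod (t i n)) * (sqrt (cmod (t i n)) * cmod (w n)))"
        by (rule order.trans[OF norm_sum]) (simp add: norm_mult mult.assoc[symmetric])
      then have "(cmod (\<Sum>n\<in>M. t i n * w n))\<^sup>2 \<le> (\<Sum>n\<in>M. sqrt (cmod (t i n)) * (sqrt (cmod (t i n)) * cmod (w n)))\<^sup>2"
        by (intro power_mono) auto
      also have "\<dots> \<le> (\<Sum>n\<in>M. (sqrt (cmod (t i n)))\<^sup>2) * (\<Sum>n\<in>M. (sqrt (cmod (t i n)) * cmod (w n))\<^sup>2)"
        by (rule Cauchy_Schwarz_ineq_sum)
      also have "\<dots> = (\<Sum>n\<in>M. cmod (t i n)) * (\<Sum>n\<in>M. cmod (t i n) * (cmod (w n))\<^sup>2)"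
        by (simp add: power_mult_distrib)
      also have "\<dots> \<le> K * (\<Sum>n\<in>M. cmod (t i n) * (cmod (w n))\<^sup>2)"
        using row_boundD[OF row_bound_mono[OF t, of 0 K] M, of i] by (intro mult_right_mono sum_nonneg) auto
      finally show ?thesis .
    qed
    then have "(\<Sum>i\<in>F. (cmod (\<Sum>n\<in>M. t i n * w n))\<^sup>2) \<le> (\<Sum>i\<in>F. K * (\<Sum>n\<in>M. cmod (t i n) * (cmod (w n))\<^sup>2))"
      by (rule sum_mono)
    also have "\<dots> = K * (\<Sum>n\<in>M. (\<Sum>i\<in>F. cmod (t i n)) * (cmod (w n))\<^sup>2)"
      unfolding sum_distrib_left[symmetric] by (subst sum.swap) (simp add: sum_distrib_right)
    also have "\<dots> \<le> K * (\<Sum>n\<in>M. (K * ?S) * (cmod (w n))\<^sup>2)"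
      using K column_sum_le[OF t F] by (intro mult_left_mono sum_mono mult_right_mono) auto
    also have "\<dots> \<le> K * ((K * ?S) * (ell2_norm w)\<^sup>2)"
      unfolding sum_distrib_left[symmetric] using K ell2_sum_le[OF w M] half_lattice_sum_nonneg[where 'd='d] by (intro mult_left_mono) auto
    finally show ?thesis by (simp add: mult.assoc)
  qed
  have lim: "(\<Sum>i\<in>F. (cmod (matvec t w i))\<^sup>2) \<le> K * (K * ?S) * (ell2_norm w)\<^sup>2" if F: "finite F" for F
  proof (rule tendsto_upperbound)
    have "((\<lambda>n. t i n * w n) has_sum matvec t w i) UNIV" for i
      unfolding matvec_def by (rule has_sum_infsum[OF abs_summable_summable[OF matvec_abs_summable[OF t w]]])
    then have "((\<lambda>M. \<Sum>n\<in>M. t i n * w n) \<longlongrightarrow> matvec t w i) (finite_subsets_at_top UNIV)" for i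
      by (simp add: has_sum_def)
    then show "((\<lambda>M. \<Sum>i\<in>F. (cmod (\<Sum>n\<in>M. t i n * w n))\<^sup>2) \<longlongrightarrow> (\<Sum>i\<in>F. (cmod (matvec t w i))\<^sup>2)) (finite_subsets_at_top UNIV)"
      by (intro tendsto_intros)
    show "\<forall>\<^sub>F M in finite_subsets_at_top UNIV. (\<Sum>i\<in>F. (cmod (\<Sum>n\<in>M. t i n * w n))\<^sup>2) \<le> K * (K * ?S) * (ell2_norm w)\<^sup>2"
      using fin[OF F] by (intro eventually_finite_subsets_at_top_weakI) auto
  qed simp
  show "matvec t w \<in> ell2" by (rule ell2I(1)[OF lim])
  have "ell2_norm (matvec t w) \<le> sqrt (K * (K * ?S) * (ell2_norm w)\<^sup>2)" by (rule ell2I(3)[OF lim])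
  then show "ell2_norm (matvec t w) \<le> sqrt (K * (K * ?S)) * ell2_norm w"
    using ell2_norm_nonneg[of w] by (simp add: real_sqrt_mult)
qed

lemma row_bound_0: "row_bound (1/2) K t \<Longrightarrow> row_bound 0 K t"
  by (rule row_bound_mono) auto

lemma matvec_matvec:
  assumes "row_bound (1/2) K t" "row_bound (1/2) L s" "w \<in> ell2"
  shows "matvec t (matvec s w) i = matvec (matmul t s) w i"
  unfolding matvec_def
  by (rule matmul_vector_assoc[OF row_bound_0[OF assms(1)] row_bound_0[OF assms(2)] ell2_bounded[OF assms(3)]])

lemma matvec_inner_swap:
  fixes t :: "int ^ 'd::finite \<Rightarrow> int ^ 'd \<Rightarrow> complex"
  assumes t: "row_bound (1/2) K t" and y: "y \<in> ell2" and u: "u \<in> ell2"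
  shows "(\<Sum>\<^sub>\<infinity>i. matvec t y i * u i) = (\<Sum>\<^sub>\<infinity>n. y n * (\<Sum>\<^sub>\<infinity>i. t i n * u i))"
proof -
  define t' where "t' = (\<lambda>i n. complex_of_real (cmod (t i n)))"
  define y' where "y' = (\<lambda>n. complex_of_real (cmod (y n)))"
  have t': "row_bound (1/2) K t'" using t by (simp add: row_bound_def t'_def)
  have y': "y' \<in> ell2" using y by (simp add: ell2_def y'_def)
  have ts: "(\<lambda>n. t i n * y n) abs_summable_on UNIV" for i by (rule matvec_abs_summable[OF t y])
  have abs_eq: "(\<Sum>\<^sub>\<infinity>n. cmod (t i n * y n)) = cmod (matvec t' y' i)" for i
  proof -
    have "matvec t' y' i = complex_of_real (\<Sum>\<^sub>\<infinity>n. cmod (t i n * y n))"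
      unfolding matvec_def infsum_complex_of_real[OF ts[of i], symmetric]
      by (simp add: t'_def y'_def norm_mult)
    moreover have "0 \<le> (\<Sum>\<^sub>\<infinity>n. cmod (t i n * y n))" by (rule infsum_nonneg) simp
    ultimately show ?thesis by simp
  qed
  have "(\<lambda>(i, n). t i n * y n * u i) abs_summable_on (UNIV \<times> UNIV)"
    unfolding Infinite_Sum.abs_summable_on_Sigma_iff
  proof (intro conjI ballI)
    fix i
    show "(\<lambda>n. case (i, n) of (i, n) \<Rightarrow> t i n * y n * u i) abs_summable_on UNIV"
      using summable_on_cmult_left[OF ts[of i], of "cmod (u i)"] by (simp add: norm_mult)
  next
    have "(\<Sum>\<^sub>\<infinity>n. norm (case (i, n) of (i, n) \<Rightarrow> t i n * y n * u i)) = cmod (matvec t' y' i) * cmod (u i)" for i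
      using infsum_cmult_left[of "cmod (u i)" "\<lambda>n. cmod (t i n * y n)" UNIV] ts[of i] abs_eq[of i] by (simp add: norm_mult)
    then show "(\<lambda>i. \<Sum>\<^sub>\<infinity>n. norm (case (i, n) of (i, n) \<Rightarrow> t i n * y n * u i)) abs_summable_on UNIV"
      using ell2_mult_summable[OF schur_test(1)[OF t' y'] u] by simp
  qed
  then have S: "(\<lambda>(i, n). t i n * y n * u i) summable_on (UNIV \<times> UNIV)" by (rule abs_summable_summable)
  have "(\<Sum>\<^sub>\<infinity>i. matvec t y i * u i) = (\<Sum>\<^sub>\<infinity>i. \<Sum>\<^sub>\<infinity>n. t i n * y n * u i)"
    unfolding matvec_def using abs_summable_summable[OF ts] by (subst infsum_cmult_left) auto
  also have "\<dots> = (\<Sum>\<^sub>\<infinity>n. \<Sum>\<^sub>\<infinity>i. t i n * y n * u i)" using S by (rule infsum_swap_banach)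
  also have "\<dots> = (\<Sum>\<^sub>\<infinity>n. y n * (\<Sum>\<^sub>\<infinity>i. t i n * u i))"
  proof (rule infsum_cong)
    fix n
    have "(\<lambda>i. t i n * u i) summable_on UNIV"
      by (rule abs_summable_summable[OF abs_summable_mult_bounded[OF column_abs_summable[OF t] ell2_bounded[OF u]]])
    then show "(\<Sum>\<^sub>\<infinity>i. t i n * y n * u i) = y n * (\<Sum>\<^sub>\<infinity>i. t i n * u i)"
      by (subst infsum_cmult_right[symmetric]) (auto simp: ac_simps)
  qed
  finally show ?thesis .
qed

section \<open>Operators diagonalized by a decaying matrix\<close>

text \<open>The columns of \<open>t\<close> are eigenvectors of \<open>V + p\<close>; the right inverse \<open>s\<close> makes \<open>t\<close> map onto \<open>\<ell>\<^sup>2\<close>, so that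
every vector is an expansion \<open>t w\<close> with square-summable coefficients \<open>w = s u\<close>.\<close>

locale diagonalized_operator =
  fixes V :: "int ^ 'd::finite \<Rightarrow> real" and p t s :: "int ^ 'd \<Rightarrow> int ^ 'd \<Rightarrow> complex"
    and lam :: "int ^ 'd \<Rightarrow> real" and Kp Kt Ks :: real
  assumes p: "row_bound (1/2) Kp p" and t: "row_bound (1/2) Kt t" and s: "row_bound (1/2) Ks s"
    and eigen: "\<And>i n. complex_of_real (V i) * t i n + (\<Sum>\<^sub>\<infinity>k. p i k * t k n) = complex_of_real (lam n) * t i n"
    and inverse: "\<And>i n. matmul t s i n = (if i = n then 1 else 0)"
    and orthogonal: "\<And>m n. m \<noteq> n \<Longrightarrow> (\<Sum>\<^sub>\<infinity>i. t i n * cnj (t i m)) = 0"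
begin

definition dom :: "(int ^ 'd \<Rightarrow> complex) set" where
  "dom = {u \<in> ell2. (\<lambda>n. complex_of_real (V n) * u n) \<in> ell2}"

definition H :: "(int ^ 'd \<Rightarrow> complex) \<Rightarrow> int ^ 'd \<Rightarrow> complex" where
  "H u n = complex_of_real (V n) * u n + matvec p u n"

lemma expansion:
  assumes "u \<in> ell2" shows "matvec t (matvec s u) = u"
proof
  fix i
  have "matvec t (matvec s u) i = matvec (matmul t s) u i" by (rule matvec_matvec[OF t s assms])
  also have "\<dots> = (\<Sum>\<^sub>\<infinity>n. (if i = n then 1 else 0) * u n)" by (simp only: matvec_def inverse)
  also have "\<dots> = (\<Sum>\<^sub>\<infinity>n\<in>{i}. u n)" by (rule infsum_cong_neutral) auto
  finally show "matvec t (matvec s u) i = u i" by simp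
qed

text \<open>The domain condition costs nothing: \<open>V (t y) = t (\<Lambda> y) - p (t y)\<close>, and both terms on the right are
square-summable.\<close>

lemma H_matvec:
  assumes y: "y \<in> ell2" and ly: "(\<lambda>n. complex_of_real (lam n) * y n) \<in> ell2"
  shows "matvec t y \<in> dom" "H (matvec t y) = matvec t (\<lambda>n. complex_of_real (lam n) * y n)"
proof -
  let ?ly = "\<lambda>n. complex_of_real (lam n) * y n"
  have Vt: "complex_of_real (V i) * matvec t y i = matvec t ?ly i - matvec p (matvec t y) i" for i
  proof -
    have pt: "(\<lambda>n. matmul p t i n * y n) abs_summable_on UNIV"
      using abs_summable_mult_bounded[OF row_bound_abs_summable(1)[OF row_bound_matmul[OF p t]] ell2_bounded[OF y]] by simp
    have "complex_of_real (V i) * matvec t y i = (\<Sum>\<^sub>\<infinity>n. complex_of_real (V i) * (t i n * y n))"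
      unfolding matvec_def using abs_summable_summable[OF matvec_abs_summable[OF t y]] by (subst infsum_cmult_right) auto
    also have "\<dots> = (\<Sum>\<^sub>\<infinity>n. t i n * ?ly n + - (matmul p t i n * y n))"
    proof (rule infsum_cong)
      fix n
      have "complex_of_real (V i) * t i n = complex_of_real (lam n) * t i n - matmul p t i n"
        using eigen[of i n] by (simp add: matmul_def eq_diff_eq)
      then have "complex_of_real (V i) * (t i n * y n) = (complex_of_real (lam n) * t i n - matmul p t i n) * y n"
        by (metis mult.assoc)
      then show "complex_of_real (V i) * (t i n * y n) = t i n * ?ly n + - (matmul p t i n * y n)"
        by (simp add: algebra_simps)
    qed
    also have "\<dots> = matvec t ?ly i + - matvec (matmul p t) y i"
      unfolding matvec_def
      by (intro infsumI has_sum_add has_sum_uminusI has_sum_infsum abs_summable_summable[OF matvec_abs_summable[OF t ly]] abs_summable_summable[OF pt])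
    finally show ?thesis by (simp add: matvec_matvec[OF p t y])
  qed
  have ty: "matvec t y \<in> ell2" by (rule schur_test(1)[OF t y])
  have "(\<lambda>i. matvec t ?ly i - matvec p (matvec t y) i) \<in> ell2"
    by (intro ell2_diff schur_test(1)[OF t ly] schur_test(1)[OF p ty])
  then show "matvec t y \<in> dom" using ty by (simp add: dom_def Vt)
  show "H (matvec t y) = matvec t ?ly" by (rule ext) (simp add: H_def Vt)
qed

lemma complete:
  assumes "\<And>n. c n \<noteq> 0"
  shows "complete_system (\<lambda>n i. t i n / c n)"
  unfolding complete_system_def
proof (intro conjI allI ballI impI)
  fix n
  show "(\<lambda>i. t i n / c n) \<in> ell2"
    using ell2_cmult[OF column_ell2(1)[OF t, of n], of "1 / c n"] by simp
next
  fix u :: "int ^ 'd \<Rightarrow> complex" and \<delta> :: real assume u: "u \<in> ell2" and \<delta>: "0 < \<delta>"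
  define w where "w = matvec s u"
  have w: "w \<in> ell2" unfolding w_def by (rule schur_test(1)[OF s u])
  define B where "B = sqrt (Kt * (Kt * half_lattice_sum TYPE('d)))"
  have B: "0 \<le> B" unfolding B_def using half_lattice_sum_nonneg[where 'd='d] row_bound_nonneg[OF t] by simp
  define e where "e = \<delta> / (B + 1)"
  have e: "0 < e" using \<delta> B by (simp add: e_def)
  obtain F where F: "finite F" "dist (\<Sum>n\<in>F. (cmod (w n))\<^sup>2) (\<Sum>\<^sub>\<infinity>n. (cmod (w n))\<^sup>2) \<le> e\<^sup>2"
    using infsum_finite_approximation[of "\<lambda>n. (cmod (w n))\<^sup>2" UNIV "e\<^sup>2"] w e by (auto simp: ell2_def)
  define w' where "w' = (\<lambda>n. if n \<in> F then 0 else w n)"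
  have w': "w' \<in> ell2" by (rule ell2_dominated[OF w, of _ 1]) (auto simp: w'_def)
  have "ell2_norm w' \<le> e"
  proof -
    have "(\<Sum>n\<in>M. (cmod (w' n))\<^sup>2) \<le> e\<^sup>2" if M: "finite M" for M
    proof -
      have "(\<Sum>n\<in>F. (cmod (w n))\<^sup>2) + (\<Sum>n\<in>M. (cmod (w' n))\<^sup>2) = (\<Sum>n\<in>F. (cmod (w n))\<^sup>2) + (\<Sum>n\<in>M - F. (cmod (w n))\<^sup>2)"
        using M by (simp add: w'_def if_distrib[of cmod] if_distrib[of "\<lambda>x. x\<^sup>2"] sum.If_cases Diff_eq)
      also have "\<dots> = (\<Sum>n\<in>F \<union> (M - F). (cmod (w n))\<^sup>2)" using F M by (subst sum.union_disjoint) auto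
      also have "\<dots> \<le> (\<Sum>\<^sub>\<infinity>n. (cmod (w n))\<^sup>2)" using w F M by (intro finite_sum_le_infsum) (auto simp: ell2_def)
      finally show ?thesis using F(2) by (simp add: dist_real_def abs_le_iff)
    qed
    from ell2I(3)[OF this] show ?thesis using e by simp
  qed
  have "matvec t w' i = u i - (\<Sum>n\<in>F. (c n * w n) * (t i n / c n))" for i
  proof -
    have "((\<lambda>n. if n \<in> F then t i n * w n else 0) has_sum (\<Sum>n\<in>F. t i n * w n)) UNIV"
      by (rule has_sum_finite_neutralI[OF F(1)]) auto
    then have "((\<lambda>n. t i n * w' n + (if n \<in> F then t i n * w n else 0)) has_sum (matvec t w' i + (\<Sum>n\<in>F. t i n * w n))) UNIV"
      unfolding matvec_def by (intro has_sum_add has_sum_infsum abs_summable_summable[OF matvec_abs_summable[OF t w']])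
    moreover have "(\<lambda>n. t i n * w' n + (if n \<in> F then t i n * w n else 0)) = (\<lambda>n. t i n * w n)"
      by (auto simp: w'_def)
    ultimately have "matvec t w i = matvec t w' i + (\<Sum>n\<in>F. t i n * w n)" by (simp add: matvec_def infsumI)
    moreover have "matvec t w i = u i" unfolding w_def expansion[OF u] ..
    moreover have "(\<Sum>n\<in>F. (c n * w n) * (t i n / c n)) = (\<Sum>n\<in>F. t i n * w n)"
      using assms by (intro sum.cong) auto
    ultimately show ?thesis by simp
  qed
  then have "(\<lambda>i. u i - (\<Sum>n\<in>F. (c n * w n) * (t i n / c n))) = matvec t w'" by auto
  moreover have "ell2_norm (matvec t w') < \<delta>"
  proof -
    have "ell2_norm (matvec t w') \<le> B * ell2_norm w'" unfolding B_def by (rule schur_test(2)[OF t w'])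
    also have "\<dots> \<le> B * e" using \<open>ell2_norm w' \<le> e\<close> B by (rule mult_left_mono)
    also have "\<dots> < \<delta>" using B \<delta> by (simp add: e_def field_simps)
    finally show ?thesis .
  qed
  ultimately show "\<exists>F c'. finite F \<and> ell2_norm (\<lambda>i. u i - (\<Sum>n\<in>F. c' n * (t i n / c n))) < \<delta>"
    using F(1) by (intro exI[of _ F] exI[of _ "\<lambda>n. c n * w n"]) auto
qed

lemma inner_expansion:
  assumes y: "y \<in> ell2" and w: "w \<in> ell2"
  shows "ell2_inner (matvec t y) (matvec t w) = (\<Sum>\<^sub>\<infinity>n. y n * (cnj (w n) * complex_of_real (\<Sum>\<^sub>\<infinity>i. (cmod (t i n))\<^sup>2)))"
proof -
  have tw: "matvec t w \<in> ell2" by (rule schur_test(1)[OF t w])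
  then have ctw: "(\<lambda>i. cnj (matvec t w i)) \<in> ell2" by (simp add: ell2_def)
  have "(\<Sum>\<^sub>\<infinity>i. t i n * cnj (matvec t w i)) = cnj (w n) * complex_of_real (\<Sum>\<^sub>\<infinity>i. (cmod (t i n))\<^sup>2)" for n
  proof -
    have col: "row_bound 0 (\<Sum>\<^sub>\<infinity>i. cmod (t i n)) (\<lambda>_::int^'d. \<lambda>i. t i n)"
      using column_abs_summable[OF t, of n] by (auto simp: row_bound_def intro!: finite_sum_le_infsum)
    have ct: "row_bound 0 Kt (\<lambda>i m. cnj (t i m))" using row_bound_0[OF t] by (simp add: row_bound_def)
    have "(\<Sum>\<^sub>\<infinity>i. t i n * cnj (matvec t w i)) = (\<Sum>\<^sub>\<infinity>i. t i n * (\<Sum>\<^sub>\<infinity>m. cnj (t i m) * cnj (w m)))"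
      unfolding matvec_def infsum_cnj[symmetric] by simp
    also have "\<dots> = (\<Sum>\<^sub>\<infinity>m. matmul (\<lambda>_::int^'d. \<lambda>i. t i n) (\<lambda>i m. cnj (t i m)) 0 m * cnj (w m))"
      by (rule matmul_vector_assoc[OF col ct, where c = "ell2_norm w" and m = 0]) (simp add: ell2_bounded[OF w])
    also have "\<dots> = (\<Sum>\<^sub>\<infinity>m\<in>{n}. (\<Sum>\<^sub>\<infinity>i. t i n * cnj (t i m)) * cnj (w m))"
      by (rule infsum_cong_neutral) (auto simp: matmul_def orthogonal)
    also have "\<dots> = (\<Sum>\<^sub>\<infinity>i. t i n * cnj (t i n)) * cnj (w n)" by simp
    also have "(\<Sum>\<^sub>\<infinity>i. t i n * cnj (t i n)) = complex_of_real (\<Sum>\<^sub>\<infinity>i. (cmod (t i n))\<^sup>2)"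
    proof -
      have "(\<lambda>i. (cmod (t i n))\<^sup>2) summable_on UNIV" using column_ell2(1)[OF t, of n] by (simp add: ell2_def)
      from infsum_complex_of_real[OF this] show ?thesis by (simp only: complex_norm_square)
    qed
    finally show ?thesis by (simp add: mult.commute)
  qed
  then show ?thesis
    unfolding ell2_inner_def using matvec_inner_swap[OF t y ctw] by simp
qed

text \<open>For \<open>u = t w\<close> the resolvent is \<open>t y\<close> with \<open>y n = w n / (lam n - z)\<close>, and by orthogonality its inner
product with \<open>u\<close> is the sum of \<open>\<omega> n / (lam n - z)\<close> with \<open>\<omega> n = \<bar>w n\<bar>\<^sup>2 q n\<close>, where \<open>q n\<close> is the squared norm of the
\<open>n\<close>-th column.  So the spectral measure consists of the masses \<open>\<omega> n\<close> at the points \<open>lam n\<close>.\<close>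

lemma pure_point: "pure_point_spectrum dom H"
  unfolding pure_point_spectrum_def
proof
  fix u :: "int ^ 'd \<Rightarrow> complex" assume u: "u \<in> ell2"
  define w where "w = matvec s u"
  have w: "w \<in> ell2" unfolding w_def by (rule schur_test(1)[OF s u])
  have uw: "u = matvec t w" unfolding w_def by (rule expansion[OF u, symmetric])
  define q where "q = (\<lambda>n. \<Sum>\<^sub>\<infinity>i. (cmod (t i n))\<^sup>2)"
  define Q where "Q = Kt * (Kt * half_lattice_sum TYPE('d))"
  have q: "0 \<le> q n" "q n \<le> Q" for n
    unfolding q_def Q_def using column_ell2(2)[OF t] by (auto intro: infsum_nonneg)
  define \<omega> where "\<omega> = (\<lambda>n. (cmod (w n))\<^sup>2 * q n)"
  have \<omega>0: "0 \<le> \<omega> n" for n using q by (simp add: \<omega>_def)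
  have \<omega>s: "\<omega> abs_summable_on UNIV"
  proof (rule Infinite_Sum.abs_summable_on_comparison_test')
    show "(\<lambda>n. (cmod (w n))\<^sup>2 * Q) summable_on UNIV" using w by (intro summable_on_cmult_left) (simp add: ell2_def)
    show "norm (\<omega> n) \<le> (cmod (w n))\<^sup>2 * Q" for n using q[of n] by (auto simp: \<omega>_def intro!: mult_left_mono)
  qed
  have integ: "integrable (count_space UNIV) \<omega>"
    using \<omega>s unfolding abs_summable_equivalent Infinite_Set_Sum.abs_summable_on_def .
  define \<nu> where "\<nu> = density (count_space (UNIV :: (int^'d) set)) (\<lambda>n. ennreal (\<omega> n))"
  define \<mu> where "\<mu> = distr \<nu> borel lam"
  have lam_meas: "lam \<in> measurable \<nu> borel" by (simp add: \<nu>_def)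
  have "emeasure \<nu> (space \<nu>) = (\<integral>\<^sup>+ n. ennreal (\<omega> n) \<partial>count_space UNIV)"
    by (simp add: \<nu>_def emeasure_density)
  also have "\<dots> < \<infinity>" using integ \<omega>0 by (simp add: integrable_iff_bounded)
  finally have fin\<nu>: "finite_measure \<nu>" by (intro finite_measureI) auto
  have "is_spectral_measure dom H u \<mu>"
    unfolding is_spectral_measure_def
  proof (intro conjI allI impI)
    show "finite_measure \<mu>" unfolding \<mu>_def by (rule finite_measure.finite_measure_distr[OF fin\<nu> lam_meas])
    show "sets \<mu> = sets borel" by (simp add: \<mu>_def)
    fix z :: complex assume z: "Im z \<noteq> 0"
    have dist: "\<bar>Im z\<bar> \<le> cmod (complex_of_real x - z)" for x
      using abs_Im_le_cmod[of "complex_of_real x - z"] by simp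
    have nz: "complex_of_real x - z \<noteq> 0" for x using dist[of x] z by auto
    define y where "y = (\<lambda>n. w n / (complex_of_real (lam n) - z))"
    have y: "y \<in> ell2"
    proof (rule ell2_dominated[OF w])
      fix n
      have "cmod (w n) / cmod (complex_of_real (lam n) - z) \<le> cmod (w n) / \<bar>Im z\<bar>"
        using dist z by (intro divide_left_mono) (auto intro!: mult_pos_pos simp: nz)
      then show "cmod (y n) \<le> (1 / \<bar>Im z\<bar>) * cmod (w n)" by (simp add: y_def norm_divide)
    qed
    have ly_eq: "(\<lambda>n. complex_of_real (lam n) * y n) = (\<lambda>n. w n + z * y n)"
    proof
      fix n
      have "(complex_of_real (lam n) - z) * y n = w n" using nz by (simp add: y_def)
      then show "complex_of_real (lam n) * y n = w n + z * y n" by (simp add: algebra_simps)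
    qed
    have zy: "(\<lambda>n. z * y n) \<in> ell2" by (rule ell2_cmult[OF y])
    have ly: "(\<lambda>n. complex_of_real (lam n) * y n) \<in> ell2" unfolding ly_eq by (rule ell2_add[OF w zy])
    have "H (matvec t y) i - z * matvec t y i = u i" for i
    proof -
      have "matvec t (\<lambda>n. w n + z * y n) i = matvec t w i + z * matvec t y i"
      proof -
        have "((\<lambda>n. t i n * w n + z * (t i n * y n)) has_sum (matvec t w i + z * matvec t y i)) UNIV"
          unfolding matvec_def
          by (intro has_sum_add has_sum_cmult_right has_sum_infsum abs_summable_summable[OF matvec_abs_summable[OF t w]]
              abs_summable_summable[OF matvec_abs_summable[OF t y]])
        then show ?thesis unfolding matvec_def by (intro infsumI) (simp add: algebra_simps)
      qed
      then show ?thesis unfolding H_matvec(2)[OF y ly] ly_eq uw by simp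
    qed
    moreover have "ell2_inner (matvec t y) u = (\<integral>x. 1 / (complex_of_real x - z) \<partial>\<mu>)"
    proof -
      have "(\<integral>x. 1 / (complex_of_real x - z) \<partial>\<mu>) = (\<integral>n. 1 / (complex_of_real (lam n) - z) \<partial>\<nu>)"
        unfolding \<mu>_def by (rule integral_distr[OF lam_meas]) measurable
      also have "\<dots> = (\<integral>n. \<omega> n *\<^sub>R (1 / (complex_of_real (lam n) - z)) \<partial>count_space UNIV)"
        unfolding \<nu>_def using \<omega>0 by (intro integral_density) auto
      also have "\<dots> = infsetsum (\<lambda>n. \<omega> n *\<^sub>R (1 / (complex_of_real (lam n) - z))) UNIV"
        by (simp add: infsetsum_def)
      also have "\<dots> = (\<Sum>\<^sub>\<infinity>n. \<omega> n *\<^sub>R (1 / (complex_of_real (lam n) - z)))"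
      proof (rule infsetsum_infsum)
        have "(\<lambda>n. \<omega> n *\<^sub>R (1 / (complex_of_real (lam n) - z))) abs_summable_on UNIV"
        proof (rule Infinite_Sum.abs_summable_on_comparison_test')
          show "(\<lambda>n. \<omega> n * (1 / \<bar>Im z\<bar>)) summable_on UNIV"
            using \<omega>s \<omega>0 by (intro summable_on_cmult_left) simp
          fix n
          have "1 / cmod (complex_of_real (lam n) - z) \<le> 1 / \<bar>Im z\<bar>"
            using dist z by (intro divide_left_mono) (auto intro!: mult_pos_pos simp: nz)
          from mult_left_mono[OF this \<omega>0[of n]]
          show "norm (\<omega> n *\<^sub>R (1 / (complex_of_real (lam n) - z))) \<le> \<omega> n * (1 / \<bar>Im z\<bar>)"
            using \<omega>0[of n] by (simp add: norm_divide)
        qed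
        then show "Infinite_Set_Sum.abs_summable_on (\<lambda>n. \<omega> n *\<^sub>R (1 / (complex_of_real (lam n) - z))) UNIV"
          using abs_summable_equivalent by blast
      qed
      also have "\<dots> = ell2_inner (matvec t y) u"
        unfolding uw inner_expansion[OF y w]
      proof (rule infsum_cong)
        fix n
        have "complex_of_real ((cmod (w n))\<^sup>2) = w n * cnj (w n)" by (rule complex_norm_square)
        then show "\<omega> n *\<^sub>R (1 / (complex_of_real (lam n) - z)) = y n * (cnj (w n) * complex_of_real (\<Sum>\<^sub>\<infinity>i. (cmod (t i n))\<^sup>2))"
          by (simp add: \<omega>_def y_def q_def scaleR_conv_of_real)
      qed
      finally show ?thesis by simp
    qed
    ultimately show "\<exists>v\<in>dom. (\<lambda>n. H v n - z * v n) = u \<and> ell2_inner v u = (\<integral>x. 1 / (complex_of_real x - z) \<partial>\<mu>)"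
      using H_matvec(1)[OF y ly] by (intro bexI[of _ "matvec t y"]) auto
  qed
  moreover have "\<exists>S. countable S \<and> emeasure \<mu> (UNIV - S) = 0"
  proof (intro exI conjI)
    show c: "countable (range lam)" by simp
    have "range lam \<in> sets borel" by (rule sets.countable[OF _ c]) simp
    then have "UNIV - range lam \<in> sets borel" by (metis borel_comp Compl_eq_Diff_UNIV)
    then have "emeasure \<mu> (UNIV - range lam) = emeasure \<nu> (lam -` (UNIV - range lam) \<inter> space \<nu>)"
      unfolding \<mu>_def using lam_meas by (intro emeasure_distr) auto
    also have "lam -` (UNIV - range lam) = {}" by auto
    finally show "emeasure \<mu> (UNIV - range lam) = 0" by simp
  qed
  ultimately show "\<exists>\<mu>. is_spectral_measure dom H u \<mu> \<and> (\<exists>S. countable S \<and> emeasure \<mu> (UNIV - S) = 0)" by blast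
qed

end


section \<open>Uniform threshold for finite-range convolutions\<close>

context perturbed_diagonal
begin

lemma exact_orthogonality:
  assumes I: "intertwines G T 0" and \<zeta>: "\<zeta> \<in> disc" "cnj \<zeta> = \<zeta>"
  shows "(level G \<zeta> m - cnj (level G \<zeta> n)) * (\<Sum>\<^sub>\<infinity>i. cnj (ent T \<zeta> i n) * ent T \<zeta> i m) = 0"
  using pairing_identity[OF I \<zeta>(1), where p = 0 and q = 0 and m = m and n = n] \<zeta>(2) by simp

end

text \<open>The admissible size \<open>a0\<close> of the perturbation is chosen before the sequence \<open>v\<close>: it depends only on the dimension
and on the constants of separation and of the chordal estimate.  This yields one threshold for all phases.\<close>

lemma kam_threshold:
  fixes c \<tau> C :: real
  assumes c: "0 < c" and \<tau>: "0 \<le> \<tau>" and C: "0 \<le> C"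
  shows "\<exists>a0>0. \<forall>v (P :: 'd::finite dmat).
    perturbed_diagonal v P c \<tau> C (lattice_sum TYPE('d)) \<longrightarrow> fam_bound 1 a0 P \<longrightarrow>
    (\<exists>G T. norm (T - 1) \<le> 1/10 \<and>
      perturbed_diagonal.intertwines v P G T 0 \<and>
      (\<forall>\<zeta>\<in>disc. \<forall>m n. m \<noteq> n \<longrightarrow> perturbed_diagonal.level v G \<zeta> m \<noteq> perturbed_diagonal.level v G \<zeta> n))"
proof -
  define Z where "Z = lattice_sum TYPE('d)"
  have Z: "1 \<le> Z" unfolding Z_def by (rule lattice_sum_ge_1)
  define \<eta> where "\<eta> = 1 / (72 * (C + 1) * Z)"
  have d1: "72 \<le> 72 * (C + 1) * Z" 
  proof -
    have "1 \<le> (C + 1) * Z" using mult_mono[of 1 "C + 1" 1 Z] C Z by simp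
    then show ?thesis unfolding mult.assoc by linarith
  qed
  have \<eta>0: "0 < \<eta>" and \<eta>1: "\<eta> \<le> 1/72" using d1 by (auto simp: \<eta>_def intro!: divide_left_mono[of 72 _ 1, simplified])
  have CZ: "(C + 1) * (\<eta> * Z) = 1/72" using C Z by (simp add: \<eta>_def)
  have \<eta>Z: "0 \<le> \<eta> * Z" using \<eta>0 Z by simp
  have sq: "\<eta>\<^sup>2 * Z \<le> \<eta> * Z"
    using \<eta>0 \<eta>1 Z by (intro mult_right_mono) (auto simp: power2_eq_square mult_le_cancel_left1)
  have "\<eta> * Z \<le> 1/72" using CZ mult_nonneg_nonneg[OF C \<eta>Z] by (simp add: algebra_simps)
  then have \<eta>2: "\<eta>\<^sup>2 * Z \<le> 1/16" using sq by simp
  have "C * (\<eta> * Z) \<le> 1/72" using CZ \<eta>Z by (simp add: algebra_simps)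
  moreover have "C * (\<eta>\<^sup>2 * Z) \<le> C * (\<eta> * Z)" using sq C by (rule mult_left_mono)
  ultimately have \<eta>3: "9 * C * \<eta>\<^sup>2 * Z \<le> 1/8" by (simp add: ac_simps)
  define \<delta> where "\<delta> = min (\<eta> / 4) (3 / (110 * Z))"
  have \<delta>: "0 < \<delta>" "4 * \<delta> \<le> \<eta>" "\<delta> \<le> 3 / (110 * Z)" using \<eta>0 Z by (auto simp: \<delta>_def)
  then have \<delta>2: "\<delta> \<le> 1/2" "\<delta> \<le> 1" using \<eta>1 by auto
  obtain a N where par: "\<And>k::nat. 0 < a k \<and> a k \<le> \<delta> / 2 ^ Suc k \<and> 1 \<le> N k \<and> 4 / c * N k powr \<tau> * a k \<le> \<delta> / 2 ^ k \<and>
     2 * (exp (- (1 / 2 ^ (k + 2) * N k)) * a k + 2 * (4 / c * N k powr \<tau> * a k) * a k) \<le> a (Suc k)"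
    using kam_parameters[OF c \<tau> \<delta>(1) \<delta>2(2)] by blast
  show ?thesis
  proof (intro exI[of _ "a 0"] conjI allI impI)
    show "0 < a 0" using par by blast
    fix v and P :: "'d dmat"
    assume pd: "perturbed_diagonal v P c \<tau> C (lattice_sum TYPE('d))" and P: "fam_bound 1 (a 0) P"
    interpret perturbed_diagonal v P c \<tau> C Z by (rule pd[folded Z_def])
    have "\<eta> \<le> 1/10" using \<eta>1 by simp
    from kam_diagonalization[OF \<eta>0 this \<eta>2 \<eta>3 \<delta>(1) \<delta>2(1) \<delta>(2,3) par P]
    obtain G T where "intertwines G T 0" "norm (T - 1) \<le> 1/10" "\<forall>\<zeta>\<in>disc. \<forall>m n. m \<noteq> n \<longrightarrow> level G \<zeta> m \<noteq> level G \<zeta> n"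
      by (elim exE conjE)
    then
    show "\<exists>G T. norm (T - 1) \<le> 1/10 \<and> intertwines G T 0 \<and> (\<forall>\<zeta>\<in>disc. \<forall>m n. m \<noteq> n \<longrightarrow> level G \<zeta> m \<noteq> level G \<zeta> n)"
      by (intro exI conjI)
  qed
qed

lemma finite_convolution_dmat:
  fixes \<phi> :: "int ^ 'd::finite \<Rightarrow> complex" and r :: real
  assumes fin: "finite {n. \<phi> n \<noteq> 0}" and r: "0 \<le> r"
  obtains P :: "'d dmat" where "\<And>\<zeta> m n. \<zeta> \<in> disc \<Longrightarrow> ent P \<zeta> m n = \<zeta> * complex_of_real r * \<phi> (m - n)"
    "fam_bound 1 (r * (\<Sum>j | \<phi> j \<noteq> 0. cmod (\<phi> j) * exp (lnorm j))) P"
proof -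
  define A where "A = (\<Sum>j | \<phi> j \<noteq> 0. cmod (\<phi> j) * exp (lnorm j))"
  define M where "M = (\<lambda>\<zeta> m n. if \<zeta> \<in> disc then \<zeta> * complex_of_real r * \<phi> (m - n) else 0)"
  have rb: "row_bound 1 (r * A) (M \<zeta>)" for \<zeta>
    unfolding row_bound_def
  proof (intro allI impI)
    fix m :: "int^'d" and F :: "(int^'d) set" assume F: "finite F"
    have "(\<Sum>n\<in>F. cmod (M \<zeta> m n) * exp (1 * lnorm (m - n))) \<le> (\<Sum>n\<in>F. r * (cmod (\<phi> (m - n)) * exp (lnorm (m - n))))"
    proof (rule sum_mono)
      fix n
      have "cmod \<zeta> * (r * (cmod (\<phi> (m - n)) * exp (lnorm (m - n)))) \<le> 1 * (r * (cmod (\<phi> (m - n)) * exp (lnorm (m - n))))" if "\<zeta> \<in> disc"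
        using that r by (intro mult_right_mono) auto
      then show "cmod (M \<zeta> m n) * exp (1 * lnorm (m - n)) \<le> r * (cmod (\<phi> (m - n)) * exp (lnorm (m - n)))"
        using r by (cases "\<zeta> \<in> disc") (simp_all add: M_def norm_mult ac_simps)
    qed
    also have "\<dots> = r * (\<Sum>j\<in>(\<lambda>n. m - n) ` F. cmod (\<phi> j) * exp (lnorm j))"
      by (subst sum.reindex) (auto simp: inj_on_def sum_distrib_left)
    also have "\<dots> \<le> r * A"
    proof (rule mult_left_mono[OF _ r])
      have "(\<Sum>j\<in>(\<lambda>n. m - n) ` F. cmod (\<phi> j) * exp (lnorm j)) = (\<Sum>j\<in>(\<lambda>n. m - n) ` F \<inter> {j. \<phi> j \<noteq> 0}. cmod (\<phi> j) * exp (lnorm j))"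
        using F by (intro sum.mono_neutral_right) auto
      also have "\<dots> \<le> A" unfolding A_def using fin by (intro sum_mono2) auto
      finally show "(\<Sum>j\<in>(\<lambda>n. m - n) ` F. cmod (\<phi> j) * exp (lnorm j)) \<le> A" .
    qed
    finally show "(\<Sum>n\<in>F. cmod (M \<zeta> m n) * exp (1 * lnorm (m - n))) \<le> r * A" .
  qed
  have "(\<lambda>\<zeta>. M \<zeta> m n) holomorphic_on disc" for m n
    by (rule holomorphic_transform[of "\<lambda>\<zeta>. \<zeta> * complex_of_real r * \<phi> (m - n)"]) (auto simp: M_def intro!: holomorphic_intros)
  moreover have "M \<zeta> m n = 0" if "\<zeta> \<notin> disc" for \<zeta> m n using that by (simp add: M_def)
  moreover have "row_bound (1/2) (r * A) (M \<zeta>)" for \<zeta> using rb by (rule row_bound_mono) auto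
  ultimately have "decaying_family M" unfolding decaying_family_def by blast
  then have e: "ent (Abs_dmat M) = M" by (simp add: Abs_dmat_inverse)
  show thesis
  proof (rule that[of "Abs_dmat M"])
    show "ent (Abs_dmat M) \<zeta> m n = \<zeta> * complex_of_real r * \<phi> (m - n)" if "\<zeta> \<in> disc" for \<zeta> m n
      unfolding e using that by (simp add: M_def)
    show "fam_bound 1 (r * (\<Sum>j | \<phi> j \<noteq> 0. cmod (\<phi> j) * exp (lnorm j))) (Abs_dmat M)"
      unfolding fam_bound_def e using rb by (simp add: A_def)
  qed
qed


section \<open>The Rayleigh--Schroedinger series is the Taylor series of the exact eigenpair\<close>

lemma conv_op_finite:
  assumes "finite {n. \<phi> n \<noteq> 0}"
  shows "conv_op \<phi> u n = (\<Sum>j | \<phi> j \<noteq> 0. \<phi> j * u (n - j))"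
proof -
  have "conv_op \<phi> u n = (\<Sum>\<^sub>\<infinity>m\<in>(\<lambda>j. n - j) ` {j. \<phi> j \<noteq> 0}. \<phi> (n - m) * u m)"
    unfolding conv_op_def
  proof (rule infsum_cong_neutral)
    fix x assume "x \<in> UNIV - (\<lambda>j. n - j) ` {j. \<phi> j \<noteq> 0}"
    then have "\<phi> (n - x) = 0" by (metis (mono_tags, lifting) DiffE diff_diff_eq2 add_diff_cancel_left' image_eqI mem_Collect_eq)
    then show "\<phi> (n - x) * u x = 0" by simp
  qed auto
  also have "\<dots> = (\<Sum>j | \<phi> j \<noteq> 0. \<phi> j * u (n - j))"
    using assms by (simp add: sum.reindex inj_on_def)
  finally show ?thesis .
qed

lemma ell2_inner_basis: "ell2_inner u (basis_vec k) = u k"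
proof -
  have "ell2_inner u (basis_vec k) = (\<Sum>\<^sub>\<infinity>n\<in>{k}. u n)"
    unfolding ell2_inner_def basis_vec_def by (rule infsum_cong_neutral) auto
  then show ?thesis by simp
qed

text \<open>The order \<open>s + 1\<close> of the eigenvalue equation at the origin determines \<open>l (s + 1)\<close>, since all later
\<open>p\<close> vanish there, and at another site it determines \<open>p (s + 1)\<close> up to the factor \<open>f (x + n \<bullet> \<omega>) - f x\<close>.\<close>

lemma RS_series_recursion:
  assumes RS: "is_RS_series \<phi> f \<omega> x l p"
  shows "l (Suc s) = conv_op \<phi> (p s) 0"
    and "n \<noteq> 0 \<Longrightarrow> (complex_of_real (f (x + real_vec n \<bullet> \<omega>)) - complex_of_real (f x)) * p (Suc s) n =
       (\<Sum>j=1..s. l j * p (Suc s - j) n) - conv_op \<phi> (p s) n"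
proof -
  have l0: "l 0 = complex_of_real (f x)" and p0: "p 0 = basis_vec 0" and pS: "\<And>s. s > 0 \<Longrightarrow> p s 0 = 0"
    and rec: "\<And>n. potential_op f \<omega> x (p (Suc s)) n + conv_op \<phi> (p s) n = (\<Sum>j\<le>Suc s. l j * p (Suc s - j) n)"
    using RS by (auto simp: is_RS_series_def ell2_inner_basis)
  have split: "(\<Sum>j\<le>Suc s. l j * p (Suc s - j) n) = l 0 * p (Suc s) n + (\<Sum>j=1..s. l j * p (Suc s - j) n) + l (Suc s) * p 0 n" for n
  proof -
    have "(\<Sum>j\<le>Suc s. l j * p (Suc s - j) n) = (\<Sum>j\<le>s. l j * p (Suc s - j) n) + l (Suc s) * p 0 n" by simp
    also have "(\<Sum>j\<le>s. l j * p (Suc s - j) n) = l 0 * p (Suc s) n + (\<Sum>j=1..s. l j * p (Suc s - j) n)"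
      by (simp add: atMost_atLeast0 sum.atLeast_Suc_atMost[of 0 s])
    finally show ?thesis .
  qed
  have z: "(\<Sum>j=1..s. l j * p (Suc s - j) 0) = 0" by (rule sum.neutral) (auto simp: pS)
  show "l (Suc s) = conv_op \<phi> (p s) 0"
    using rec[of 0] unfolding split z by (simp add: potential_op_def pS p0 basis_vec_def)
  show "(complex_of_real (f (x + real_vec n \<bullet> \<omega>)) - complex_of_real (f x)) * p (Suc s) n =
       (\<Sum>j=1..s. l j * p (Suc s - j) n) - conv_op \<phi> (p s) n" if "n \<noteq> 0"
    using rec[of n] that unfolding split by (simp add: potential_op_def p0 l0 basis_vec_def algebra_simps)
qed

lemma RS_series_unique:
  assumes nz: "\<And>n. n \<noteq> 0 \<Longrightarrow> f (x + real_vec n \<bullet> \<omega>) \<noteq> f x"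
    and RS: "is_RS_series \<phi> f \<omega> x l p" and RS': "is_RS_series \<phi> f \<omega> x l' p'"
  shows "l s = l' s \<and> p s = p' s"
proof (induction s rule: less_induct)
  case (less s)
  show ?case
  proof (cases s)
    case 0
    then show ?thesis using RS RS' by (simp add: is_RS_series_def)
  next
    case (Suc t)
    have IH: "l j = l' j" "p j = p' j" if "j \<le> t" for j using less that Suc by auto
    have "p (Suc t) n = p' (Suc t) n" for n
    proof (cases "n = 0")
      case True
      then show ?thesis using RS RS' by (simp add: is_RS_series_def ell2_inner_basis)
    next
      case False
      have "(\<Sum>j=1..t. l j * p (Suc t - j) n) = (\<Sum>j=1..t. l' j * p' (Suc t - j) n)"
        using IH by (intro sum.cong) auto
      then have "(complex_of_real (f (x + real_vec n \<bullet> \<omega>)) - complex_of_real (f x)) * p (Suc t) n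
         = (complex_of_real (f (x + real_vec n \<bullet> \<omega>)) - complex_of_real (f x)) * p' (Suc t) n"
        using RS_series_recursion(2)[OF RS False, of t] RS_series_recursion(2)[OF RS' False, of t] IH(2)[of t] by simp
      then show ?thesis using nz[OF False] by simp
    qed
    moreover have "l (Suc t) = l' (Suc t)"
      using RS_series_recursion(1)[OF RS, of t] RS_series_recursion(1)[OF RS', of t] IH(2)[of t] by simp
    ultimately show ?thesis using Suc by auto
  qed
qed

text \<open>Equating Taylor coefficients at zero in the eigenvalue equation of a holomorphic eigenpair normalized at the
origin is precisely the recursion; normalization makes all higher coefficients
orthogonal to the initial vector.  At \<open>e = 0\<close> the equation forces the initial data, because
the values of \<open>f\<close> off the origin differ from \<open>f x\<close>.\<close>

lemma RS_series_of_holomorphic_eigenpair: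
  fixes \<phi> :: "int ^ 'd::finite \<Rightarrow> complex" and \<Lambda> :: "complex \<Rightarrow> complex" and \<Psi> :: "int ^ 'd \<Rightarrow> complex \<Rightarrow> complex"
  assumes fin: "finite {n. \<phi> n \<noteq> 0}" and r: "0 < r"
    and nz: "\<And>n. n \<noteq> 0 \<Longrightarrow> f (x + real_vec n \<bullet> \<omega>) \<noteq> f x"
    and hol: "\<Lambda> holomorphic_on ball 0 r" "\<And>m. \<Psi> m holomorphic_on ball 0 r"
    and norm1: "\<And>e. e \<in> ball 0 r \<Longrightarrow> \<Psi> 0 e = 1"
    and eigen: "\<And>e m. e \<in> ball 0 r \<Longrightarrow> complex_of_real (f (x + real_vec m \<bullet> \<omega>)) * \<Psi> m e + e * conv_op \<phi> (\<lambda>k. \<Psi> k e) m = \<Lambda> e * \<Psi> m e"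
    and \<epsilon>: "\<bar>\<epsilon>\<bar> < r"
  shows "RS_lambda_term \<epsilon> \<phi> f \<omega> x sums \<Lambda> (complex_of_real \<epsilon>)"
    "RS_psi_term \<epsilon> \<phi> f \<omega> x m sums \<Psi> m (complex_of_real \<epsilon>)"
proof -
  define l where "l = (\<lambda>s. (deriv ^^ s) \<Lambda> 0 / fact s)"
  define p where "p = (\<lambda>s m. (deriv ^^ s) (\<Psi> m) 0 / fact s)"
  define FL where "FL = fps_expansion \<Lambda> 0"
  define FP where "FP = (\<lambda>m. fps_expansion (\<Psi> m) 0)"
  have nthL: "fps_nth FL s = l s" and nthP: "fps_nth (FP m) s = p s m" for s m
    by (simp_all add: FL_def FP_def l_def p_def fps_expansion_def)
  have FL: "\<Lambda> has_fps_expansion FL" unfolding FL_def using r hol(1) by (intro has_fps_expansion_fps_expansion[of "ball 0 r"]) auto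
  have FP: "\<Psi> m has_fps_expansion FP m" for m
    unfolding FP_def using r hol(2) by (intro has_fps_expansion_fps_expansion[of "ball 0 r"]) auto
  have near: "\<forall>\<^sub>F e in nhds 0. e \<in> ball (0::complex) r" using r by (intro eventually_nhds_in_open) auto
  have fps_eq: "fps_const (complex_of_real (f (x + real_vec m \<bullet> \<omega>))) * FP m + fps_X * (\<Sum>j | \<phi> j \<noteq> 0. fps_const (\<phi> j) * FP (m - j)) = FL * FP m" for m
  proof (rule fps_expansion_unique_complex)
    show "(\<lambda>e. complex_of_real (f (x + real_vec m \<bullet> \<omega>)) * \<Psi> m e + e * (\<Sum>j | \<phi> j \<noteq> 0. \<phi> j * \<Psi> (m - j) e)) has_fps_expansion
      fps_const (complex_of_real (f (x + real_vec m \<bullet> \<omega>))) * FP m + fps_X * (\<Sum>j | \<phi> j \<noteq> 0. fps_const (\<phi> j) * FP (m - j))"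
      by (intro has_fps_expansion_add has_fps_expansion_mult has_fps_expansion_cmult_left has_fps_expansion_sum
          has_fps_expansion_fps_X has_fps_expansion_const FP)
    have "(\<lambda>e. \<Lambda> e * \<Psi> m e) has_fps_expansion FL * FP m" by (intro has_fps_expansion_mult FL FP)
    then show "(\<lambda>e. complex_of_real (f (x + real_vec m \<bullet> \<omega>)) * \<Psi> m e + e * (\<Sum>j | \<phi> j \<noteq> 0. \<phi> j * \<Psi> (m - j) e)) has_fps_expansion FL * FP m"
    proof (rule has_fps_expansion_cong[THEN iffD1, rotated 2])
      show "\<forall>\<^sub>F e in nhds 0. \<Lambda> e * \<Psi> m e = complex_of_real (f (x + real_vec m \<bullet> \<omega>)) * \<Psi> m e + e * (\<Sum>j | \<phi> j \<noteq> 0. \<phi> j * \<Psi> (m - j) e)"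
        using near by eventually_elim (simp only: eigen[symmetric] conv_op_finite[OF fin])
    qed simp
  qed
  have val0: "\<Lambda> 0 * \<Psi> m 0 = complex_of_real (f (x + real_vec m \<bullet> \<omega>)) * \<Psi> m 0" for m
    using eigen[of 0 m] r by auto
  have \<Psi>0: "\<Psi> 0 0 = 1" using norm1[of 0] r by simp
  have rv0: "real_vec (0 :: int^'d) = 0" by (simp add: real_vec_def vec_eq_iff)
  have \<Lambda>0: "\<Lambda> 0 = complex_of_real (f x)" using val0[of 0] by (simp add: \<Psi>0 rv0)
  have \<Psi>m: "\<Psi> m 0 = 0" if "m \<noteq> 0" for m using val0[of m] nz[OF that] by (simp add: \<Lambda>0)
  have one: "FP 0 = 1"
  proof (rule fps_expansion_unique_complex[OF FP])
    have "\<forall>\<^sub>F e in nhds 0. \<Psi> 0 e = 1" using near by eventually_elim (rule norm1)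
    then show "\<Psi> 0 has_fps_expansion 1"
      using has_fps_expansion_cong[of "\<Psi> 0" "\<lambda>_. 1" 1 1] by simp
  qed
  have RS: "is_RS_series \<phi> f \<omega> x l p"
    unfolding is_RS_series_def
  proof (intro conjI allI impI)
    show "l 0 = complex_of_real (f x)" by (simp add: l_def \<Lambda>0)
    show p0: "p 0 = basis_vec 0" by (rule ext) (simp add: p_def basis_vec_def \<Psi>0 \<Psi>m)
    show "ell2_inner (p s) (basis_vec 0) = 0" if "0 < s" for s
      using that nthP[of 0 s] by (simp add: ell2_inner_basis one)
    show "potential_op f \<omega> x (p 0) n = l 0 * p 0 n" for n
      using val0[of n] by (auto simp: potential_op_def p_def l_def)
    fix s n
    have "fps_nth (fps_const (complex_of_real (f (x + real_vec n \<bullet> \<omega>))) * FP n + fps_X * (\<Sum>j | \<phi> j \<noteq> 0. fps_const (\<phi> j) * FP (n - j))) (Suc s) = fps_nth (FL * FP n) (Suc s)"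
      unfolding fps_eq ..
    then show "potential_op f \<omega> x (p (Suc s)) n + conv_op \<phi> (p s) n = (\<Sum>j\<le>Suc s. l j * p (Suc s - j) n)"
      by (simp add: fps_mult_nth[of FL] fps_sum_nth nthL nthP potential_op_def conv_op_finite[OF fin] atMost_atLeast0)
  qed
  have coeffs: "RS_coeffs \<phi> f \<omega> x = (l, p)"
    unfolding RS_coeffs_def
  proof (rule the_equality)
    show "case (l, p) of (l, p) \<Rightarrow> is_RS_series \<phi> f \<omega> x l p" using RS by simp
    fix lp :: "(nat \<Rightarrow> complex) \<times> (nat \<Rightarrow> int ^ 'd \<Rightarrow> complex)"
    assume "case lp of (l, p) \<Rightarrow> is_RS_series \<phi> f \<omega> x l p"
    then obtain l' p' where lp: "lp = (l', p')" and RS': "is_RS_series \<phi> f \<omega> x l' p'" by (cases lp) auto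
    have "l' s = l s \<and> p' s = p s" for s using nz RS' RS by (rule RS_series_unique)
    then show "lp = (l, p)" unfolding lp by (simp add: fun_eq_iff)
  qed
  have \<epsilon>r: "complex_of_real \<epsilon> \<in> ball 0 r" using \<epsilon> by simp
  show "RS_lambda_term \<epsilon> \<phi> f \<omega> x sums \<Lambda> (complex_of_real \<epsilon>)"
    using holomorphic_power_series[OF hol(1) \<epsilon>r]
    by (simp add: RS_lambda_term_def[abs_def] coeffs l_def mult.commute)
  show "RS_psi_term \<epsilon> \<phi> f \<omega> x m sums \<Psi> m (complex_of_real \<epsilon>)"
    using holomorphic_power_series[OF hol(2) \<epsilon>r, of m]
    by (simp add: RS_psi_term_def[abs_def] coeffs p_def mult.commute)
qed


section \<open>The operator along an orbit\<close>

context monotone_potential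
begin

definition rep_mod1 :: "real \<Rightarrow> real" where
  "rep_mod1 x = x - real_of_int \<lfloor>x + 1/2\<rfloor>"

lemma f_add_int:
  assumes "x \<notin> half_integers"
  shows "f (x + real_of_int k) = f x"
proof -
  have shift: "x + real_of_int j \<notin> half_integers" for j
  proof
    assume "x + real_of_int j \<in> half_integers"
    then obtain i where "x + real_of_int j = real_of_int i + 1/2" by (auto simp: half_integers_def)
    then have "x = real_of_int (i - j) + 1/2" by simp
    then show False using assms unfolding half_integers_def by blast
  qed
  show ?thesis
  proof (induction k rule: int_induct[where k = 0])
    case base
    then show ?case by simp
  next
    case (step1 i)
    then show ?case using periodic[OF shift[of i]] by (simp add: add.assoc)
  next
    case (step2 i)
    then show ?case using periodic[OF shift[of "i - 1"]] by (simp add: algebra_simps)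
  qed
qed

lemma rep_mod1:
  assumes "x \<notin> half_integers"
  shows "rep_mod1 x \<in> I" "f (rep_mod1 x) = f x"
proof -
  have "rep_mod1 x \<noteq> -1/2"
  proof
    assume "rep_mod1 x = -1/2"
    then have "x = real_of_int (\<lfloor>x + 1/2\<rfloor> - 1) + 1/2" by (simp add: rep_mod1_def)
    then show False using assms unfolding half_integers_def by blast
  qed
  moreover have "-1/2 \<le> rep_mod1 x" "rep_mod1 x < 1/2" unfolding rep_mod1_def by linarith+
  ultimately show "rep_mod1 x \<in> I" by auto
  show "f (rep_mod1 x) = f x" using f_add_int[OF assms, of "- \<lfloor>x + 1/2\<rfloor>"] by (simp add: rep_mod1_def)
qed

lemma separation:
  assumes "x \<notin> half_integers" "y \<notin> half_integers"
  shows "infdist (x - y) \<int> \<le> \<bar>f x - f y\<bar>"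
proof -
  have "infdist (x - y) \<int> \<le> dist (x - y) (real_of_int (\<lfloor>x + 1/2\<rfloor> - \<lfloor>y + 1/2\<rfloor>))"
    by (rule infdist_le) simp
  also have "\<dots> = \<bar>rep_mod1 x - rep_mod1 y\<bar>" by (simp add: rep_mod1_def dist_real_def algebra_simps)
  also have "\<dots> \<le> \<bar>f (rep_mod1 x) - f (rep_mod1 y)\<bar>"
    using slope_ge_1[OF rep_mod1(1)[OF assms(1)] rep_mod1(1)[OF assms(2)]] slope_ge_1[OF rep_mod1(1)[OF assms(2)] rep_mod1(1)[OF assms(1)]] by linarith
  finally show ?thesis by (simp add: rep_mod1(2) assms)
qed

text \<open>The phases of \<open>m + j\<close> and \<open>n + j\<close> differ by the same amount modulo one as those of \<open>m\<close> and \<open>n\<close>, which is what \<open>chordal_lipschitz\<close>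
requires; the Diophantine condition bounds the distance of the representatives from below.\<close>

lemma orbit_perturbed_diagonal:
  fixes P :: "'d::finite dmat" and \<omega> :: "real ^ 'd"
  assumes c: "0 < c" and \<tau>: "0 \<le> \<tau>" and dio: "diophantine c \<tau> \<omega>"
    and orbit: "\<And>n. x0 + real_vec n \<bullet> \<omega> \<notin> half_integers"
    and P: "\<And>\<zeta> m n j. \<zeta> \<in> disc \<Longrightarrow> ent P \<zeta> (m + j) (n + j) = ent P \<zeta> m n"
      "\<And>\<zeta> m n. \<zeta> \<in> disc \<Longrightarrow> cnj (ent P (cnj \<zeta>) n m) = ent P \<zeta> m n"
  shows "perturbed_diagonal (\<lambda>n. f (x0 + real_vec n \<bullet> \<omega>)) P c \<tau> (1 + 2 * C) (lattice_sum TYPE('d))"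
proof
  show "lattice_sum TYPE('d) = lattice_sum TYPE('d)" ..
  show "0 < c" "0 \<le> \<tau>" by fact+
  show "0 \<le> 1 + 2 * C" using Cgt by simp
  show "ent P \<zeta> (m + j) (n + j) = ent P \<zeta> m n" if "\<zeta> \<in> disc" for \<zeta> m n j using P(1)[OF that] .
  show "cnj (ent P (cnj \<zeta>) n m) = ent P \<zeta> m n" if "\<zeta> \<in> disc" for \<zeta> m n using P(2)[OF that] .
  show "c * lnorm (m - n) powr - \<tau> \<le> \<bar>f (x0 + real_vec m \<bullet> \<omega>) - f (x0 + real_vec n \<bullet> \<omega>)\<bar>" if "m \<noteq> n" for m n
  proof -
    have "c * lnorm (m - n) powr - \<tau> \<le> infdist (real_vec (m - n) \<bullet> \<omega>) \<int>"
      using dio that by (simp add: diophantine_def lnorm_def)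
    also have "real_vec (m - n) \<bullet> \<omega> = (x0 + real_vec m \<bullet> \<omega>) - (x0 + real_vec n \<bullet> \<omega>)"
      by (simp add: real_vec_diff inner_diff_left)
    finally show ?thesis using separation[OF orbit orbit, of m n] by linarith
  qed
  show "\<bar>f (x0 + real_vec (m + j) \<bullet> \<omega>) - f (x0 + real_vec (n + j) \<bullet> \<omega>)\<bar>
    \<le> (1 + 2 * C) * \<bar>f (x0 + real_vec m \<bullet> \<omega>) - f (x0 + real_vec n \<bullet> \<omega>)\<bar> *
       (1 + \<bar>f (x0 + real_vec (m + j) \<bullet> \<omega>) - f (x0 + real_vec m \<bullet> \<omega>)\<bar>) *
       (1 + \<bar>f (x0 + real_vec (n + j) \<bullet> \<omega>) - f (x0 + real_vec n \<bullet> \<omega>)\<bar>)" for m n j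
  proof -
    let ?x = "\<lambda>n. x0 + real_vec n \<bullet> \<omega>"
    have "(rep_mod1 (?x (n + j)) - rep_mod1 (?x (m + j))) - (rep_mod1 (?x n) - rep_mod1 (?x m)) =
      real_of_int (\<lfloor>?x (m + j) + 1/2\<rfloor> - \<lfloor>?x (n + j) + 1/2\<rfloor> - (\<lfloor>?x m + 1/2\<rfloor> - \<lfloor>?x n + 1/2\<rfloor>))"
      by (simp add: rep_mod1_def real_vec_add inner_add_left)
    then have "(rep_mod1 (?x (n + j)) - rep_mod1 (?x (m + j))) - (rep_mod1 (?x n) - rep_mod1 (?x m)) \<in> \<int>" by (metis Ints_of_int)
    from chordal_lipschitz[OF rep_mod1(1)[OF orbit] rep_mod1(1)[OF orbit] rep_mod1(1)[OF orbit] rep_mod1(1)[OF orbit] this]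
    show ?thesis by (simp add: rep_mod1(2) orbit)
  qed
qed

end

text \<open>The parameter of the matrix families is \<open>\<zeta> = \<epsilon> / r\<close>, where \<open>r\<close> makes the convolution as small as \<open>kam_threshold\<close> demands.
The series are started at each site \<open>n\<close> of the one orbit of \<open>x0\<close>, so a single diagonalization
serves all of them: the eigenvector started at \<open>n\<close> is the \<open>n\<close>-th column of \<open>T\<close>, translated by \<open>n\<close>.\<close>

theorem corollary5p13:
  fixes \<phi> :: "int ^ 'd \<Rightarrow> complex"
    and \<omega> :: "real ^ 'd"
    and f :: "real \<Rightarrow> real"
    and C_dio \<tau> C_reg :: real
  assumes phi_finite: "finite {n. \<phi> n \<noteq> 0}"
    and phi_zero: "\<phi> 0 = 0"
    and phi_herm: "\<And>n. \<phi> (- n) = cnj (\<phi> n)"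
    and omega_box: "\<And>i. \<omega> $ i \<in> {-1/2<..<1/2}"
    and C_dio_pos: "C_dio > 0"
    and tau_gt: "\<tau> > 1"
    and omega_dio: "diophantine C_dio \<tau> \<omega>"
    and f_cont: "continuous_on {-1/2<..<1/2} f"
    and f_left: "filterlim f at_bot (at_right (-1/2))"
    and f_right: "filterlim f at_top (at_left (1/2))"
    and f_periodic: "\<And>x. x \<notin> half_integers \<Longrightarrow> f (x + 1) = f x"
    and f_regular: "\<And>x. x \<in> {-1/2<..<1/2} \<Longrightarrow> regular_at C_reg f x"
    and f_Dmin: "\<And>x. x \<in> {-1/2<..<1/2} \<Longrightarrow> D_min f x \<ge> 1"
  shows "\<exists>\<epsilon>0>0. \<forall>\<epsilon> x0. 0 < \<epsilon> \<and> \<epsilon> < \<epsilon>0 \<and> x0 \<in> {-1/2<..<1/2} - singular_phases \<omega> \<longrightarrow>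
     (\<forall>n. summable (RS_lambda_term \<epsilon> \<phi> f \<omega> (x0 + real_vec n \<bullet> \<omega>)) \<and>
          (\<forall>m. summable (RS_psi_term \<epsilon> \<phi> f \<omega> (x0 + real_vec n \<bullet> \<omega>) m))) \<and>
     (\<forall>n. is_eigenvector (H_dom f \<omega> x0) (H_op \<epsilon> \<phi> f \<omega> x0)
            (RS_lambda \<epsilon> \<phi> f \<omega> (x0 + real_vec n \<bullet> \<omega>)) (shifted_psi \<epsilon> \<phi> f \<omega> x0 n)) \<and>
     pure_point_spectrum (H_dom f \<omega> x0) (H_op \<epsilon> \<phi> f \<omega> x0) \<and>
     complete_system (shifted_psi \<epsilon> \<phi> f \<omega> x0)"
proof -
  interpret f: monotone_potential f C_reg
    by unfold_locales (fact f_cont f_left f_right f_periodic f_regular f_Dmin)+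
  have C: "0 \<le> 1 + 2 * C_reg" using f.Cgt by simp
  have \<tau>0: "0 \<le> \<tau>" using tau_gt by simp
  obtain a0 where a0: "0 < a0" and kam: "\<forall>v (P :: 'd dmat).
      perturbed_diagonal v P C_dio \<tau> (1 + 2 * C_reg) (lattice_sum TYPE('d)) \<longrightarrow> fam_bound 1 a0 P \<longrightarrow>
      (\<exists>G T. norm (T - 1) \<le> 1/10 \<and> perturbed_diagonal.intertwines v P G T 0 \<and>
        (\<forall>\<zeta>\<in>disc. \<forall>m n. m \<noteq> n \<longrightarrow> perturbed_diagonal.level v G \<zeta> m \<noteq> perturbed_diagonal.level v G \<zeta> n))"
    using kam_threshold[OF C_dio_pos \<tau>0 C, where 'd = 'd] by (elim exE conjE) (rule that)
  define A where "A = (\<Sum>j | \<phi> j \<noteq> 0. cmod (\<phi> j) * exp (lnorm j))"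
  have A: "0 \<le> A" unfolding A_def by (intro sum_nonneg) auto
  define r where "r = a0 / (A + 1)"
  have r: "0 < r" "r * A \<le> a0" using a0 A by (auto simp: r_def field_simps)
  obtain P :: "'d dmat" where P: "\<And>\<zeta> m n. \<zeta> \<in> disc \<Longrightarrow> ent P \<zeta> m n = \<zeta> * complex_of_real r * \<phi> (m - n)" "fam_bound 1 (r * A) P"
    by (rule finite_convolution_dmat[OF phi_finite less_imp_le[OF r(1)], folded A_def]) (rule that; assumption)
  have Pb: "fam_bound 1 a0 P" using P(2) order_refl r(2) by (rule fam_bound_mono)
  have toeplitz: "ent P \<zeta> (m + j) (n + j) = ent P \<zeta> m n" if "\<zeta> \<in> disc" for \<zeta> m n j
    using that by (simp add: P(1))
  have herm: "cnj (ent P (cnj \<zeta>) n m) = ent P \<zeta> m n" if "\<zeta> \<in> disc" for \<zeta> m n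
    using that phi_herm[of "n - m"] by (simp add: P(1))
  have main: "(\<forall>n. summable (RS_lambda_term \<epsilon> \<phi> f \<omega> (x0 + real_vec n \<bullet> \<omega>)) \<and>
          (\<forall>m. summable (RS_psi_term \<epsilon> \<phi> f \<omega> (x0 + real_vec n \<bullet> \<omega>) m))) \<and>
     (\<forall>n. is_eigenvector (H_dom f \<omega> x0) (H_op \<epsilon> \<phi> f \<omega> x0)
            (RS_lambda \<epsilon> \<phi> f \<omega> (x0 + real_vec n \<bullet> \<omega>)) (shifted_psi \<epsilon> \<phi> f \<omega> x0 n)) \<and>
     pure_point_spectrum (H_dom f \<omega> x0) (H_op \<epsilon> \<phi> f \<omega> x0) \<and>
     complete_system (shifted_psi \<epsilon> \<phi> f \<omega> x0)"
    if \<epsilon>: "0 < \<epsilon>" "\<epsilon> < r" and x0: "x0 \<in> {-1/2<..<1/2} - singular_phases \<omega>" for \<epsilon> x0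
  proof -
    define v where "v = (\<lambda>n :: int ^ 'd. f (x0 + real_vec n \<bullet> \<omega>))"
    have orbit: "x0 + real_vec n \<bullet> \<omega> \<notin> half_integers" for n :: "int ^ 'd"
    proof
      assume h: "x0 + real_vec n \<bullet> \<omega> \<in> half_integers"
      have "x0 = (x0 + real_vec n \<bullet> \<omega>) + real_vec (- n) \<bullet> \<omega>"
        by (simp add: real_vec_def inner_vec_def sum_negf)
      then have "\<exists>a n'. x0 = a + real_vec n' \<bullet> \<omega> \<and> a \<in> half_integers" using h by (intro exI conjI)
      then have "x0 \<in> singular_phases \<omega>" by (simp add: singular_phases_def)
      then show False using x0 by blast
    qed
    interpret K: perturbed_diagonal v P C_dio \<tau> "1 + 2 * C_reg" "lattice_sum TYPE('d)"
      unfolding v_def by (rule f.orbit_perturbed_diagonal[OF C_dio_pos \<tau>0 omega_dio orbit toeplitz herm])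
    obtain G T where T: "norm (T - 1) \<le> 1/10" and eig: "K.intertwines G T 0"
      and simple': "\<forall>\<zeta>\<in>disc. \<forall>m n. m \<noteq> n \<longrightarrow> K.level G \<zeta> m \<noteq> K.level G \<zeta> n"
      using kam[rule_format, OF K.perturbed_diagonal_axioms Pb] by (elim exE conjE)
    have simple: "K.level G \<zeta> m \<noteq> K.level G \<zeta> n" if "\<zeta> \<in> disc" "m \<noteq> n" for \<zeta> m n
      using simple' that by blast
    have eig': "complex_of_real (v i) * ent T \<zeta> i m + ent (P * T) \<zeta> i m = ent T \<zeta> i m * K.level G \<zeta> m" if "\<zeta> \<in> disc" for \<zeta> i m
      using eig that by (auto simp: K.intertwines_def)
    have "fam_bound (1/2) (1/10) (T - 1)" using T unfolding norm_dmat_le_iff .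
    then obtain S where "(1 + (T - 1)) * S = 1" by (rule dmat_neumann[OF _ order_refl]) (simp, rule that)
    then have TS: "T * S = 1" by simp
    have Tdiag: "ent T \<zeta> n n \<noteq> 0" if "\<zeta> \<in> disc" for \<zeta> n
    proof
      assume "ent T \<zeta> n n = 0"
      then have "cmod (ent (T - 1) \<zeta> n n) = 1" using that by (simp add: ent_one)
      then show False using norm_ent_le'[of "T - 1" \<zeta> n n] T by simp
    qed
    define \<zeta> where "\<zeta> = complex_of_real (\<epsilon> / r)"
    have \<zeta>: "\<zeta> \<in> disc" "cnj \<zeta> = \<zeta>" "\<zeta> * complex_of_real r = complex_of_real \<epsilon>"
      using \<epsilon> r by (auto simp: \<zeta>_def norm_divide)

    have gram: "(K.level G \<zeta> m - cnj (K.level G \<zeta> n)) * (\<Sum>\<^sub>\<infinity>i. cnj (ent T \<zeta> i n) * ent T \<zeta> i m) = 0" for m n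
      by (rule K.exact_orthogonality[OF eig \<zeta>(1,2)])
    obtain KT where KT: "\<And>\<zeta>. row_bound (1/2) KT (ent T \<zeta>)" by (rule ent_bounded'[of T]) (rule that)
    obtain KS where KS: "\<And>\<zeta>. row_bound (1/2) KS (ent S \<zeta>)" by (rule ent_bounded'[of S]) (rule that)
    obtain KP where KP: "\<And>\<zeta>. row_bound (1/2) KP (ent P \<zeta>)" by (rule ent_bounded'[of P]) (rule that)
    have real_level: "cnj (K.level G \<zeta> n) = K.level G \<zeta> n" for n
    proof -
      have sq: "(\<lambda>i. (cmod (ent T \<zeta> i n))\<^sup>2) summable_on UNIV"
        using column_ell2(1)[OF KT[of \<zeta>], of n] by (simp add: ell2_def)
      have "(cmod (ent T \<zeta> n n))\<^sup>2 \<le> (\<Sum>\<^sub>\<infinity>i. (cmod (ent T \<zeta> i n))\<^sup>2)"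
        using finite_sum_le_infsum[OF sq, of "{n}"] by simp
      moreover have "0 < (cmod (ent T \<zeta> n n))\<^sup>2" using Tdiag[OF \<zeta>(1), of n] by simp
      ultimately have "(\<Sum>\<^sub>\<infinity>i. (cmod (ent T \<zeta> i n))\<^sup>2) \<noteq> 0" by linarith
      moreover have "(\<Sum>\<^sub>\<infinity>i. cnj (ent T \<zeta> i n) * ent T \<zeta> i n) = complex_of_real (\<Sum>\<^sub>\<infinity>i. (cmod (ent T \<zeta> i n))\<^sup>2)"
        using infsum_complex_of_real[OF sq] by (simp only: complex_norm_square mult.commute)
      ultimately show ?thesis using gram[of n n] by simp
    qed
    define lam where "lam = (\<lambda>n. Re (K.level G \<zeta> n))"
    have lam: "complex_of_real (lam n) = K.level G \<zeta> n" for n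
      using real_level[of n] by (simp add: lam_def complex_eq_iff)
    interpret D: diagonalized_operator v "ent P \<zeta>" "ent T \<zeta>" "ent S \<zeta>" lam KP KT KS
    proof
      show "row_bound (1/2) KP (ent P \<zeta>)" "row_bound (1/2) KT (ent T \<zeta>)" "row_bound (1/2) KS (ent S \<zeta>)" by (fact KP KT KS)+
      show "complex_of_real (v i) * ent T \<zeta> i n + (\<Sum>\<^sub>\<infinity>k. ent P \<zeta> i k * ent T \<zeta> k n) = complex_of_real (lam n) * ent T \<zeta> i n" for i n
        using eig'[OF \<zeta>(1), of i n] by (simp add: ent_times lam mult.commute)
      show "matmul (ent T \<zeta>) (ent S \<zeta>) i n = (if i = n then 1 else 0)" for i n
        using ent_one[OF \<zeta>(1), of i n] unfolding TS[symmetric] by (simp add: times_dmat.rep_eq)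
      show "(\<Sum>\<^sub>\<infinity>i. ent T \<zeta> i n * cnj (ent T \<zeta> i m)) = 0" if "m \<noteq> n" for m n
        using gram[of n m] simple[OF \<zeta>(1) that] real_level[of m] by (simp add: mult.commute)
    qed
    have dom: "H_dom f \<omega> x0 = D.dom"
      unfolding D.dom_def by (simp add: H_dom_def potential_op_def v_def)
    have H: "H_op \<epsilon> \<phi> f \<omega> x0 = D.H"
    proof (intro ext)
      fix u n
      have "complex_of_real \<epsilon> * conv_op \<phi> u n = matvec (ent P \<zeta>) u n"
        unfolding conv_op_def matvec_def infsum_cmult_right'[symmetric] by (simp add: P(1)[OF \<zeta>(1)] \<zeta>(3) mult.assoc)
      then show "H_op \<epsilon> \<phi> f \<omega> x0 u n = D.H u n"
        unfolding D.H_def by (simp add: H_op_def potential_op_def v_def)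
    qed

    define \<Lambda> where "\<Lambda> = (\<lambda>n e. K.level G (e / complex_of_real r) n)"
    define \<Psi> where "\<Psi> = (\<lambda>n m e. ent T (e / complex_of_real r) (n + m) n / ent T (e / complex_of_real r) n n)"
    have scale: "e / complex_of_real r \<in> disc" if "e \<in> ball 0 r" for e
      using that r by (simp add: norm_divide)
    have hol_ent: "(\<lambda>e. ent M (e / complex_of_real r) i j) holomorphic_on ball 0 r" for M :: "'d dmat" and i j
    proof -
      have "((\<lambda>\<zeta>. ent M \<zeta> i j) \<circ> (\<lambda>e. e / complex_of_real r)) holomorphic_on ball 0 r"
        using r scale by (intro holomorphic_on_compose_gen[OF _ ent_holomorphic[of M i j]]) (auto intro!: holomorphic_intros)
      then show ?thesis by (simp add: comp_def)
    qed
    have RS: "RS_lambda_term \<epsilon> \<phi> f \<omega> (x0 + real_vec n \<bullet> \<omega>) sums \<Lambda> n (complex_of_real \<epsilon>)"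
      "RS_psi_term \<epsilon> \<phi> f \<omega> (x0 + real_vec n \<bullet> \<omega>) m sums \<Psi> n m (complex_of_real \<epsilon>)" for n m
    proof -
      have shift: "f (x0 + real_vec n \<bullet> \<omega> + real_vec m \<bullet> \<omega>) = v (n + m)" for m
        by (simp add: v_def real_vec_add inner_add_left add.assoc)
      have nz: "f (x0 + real_vec n \<bullet> \<omega> + real_vec m \<bullet> \<omega>) \<noteq> f (x0 + real_vec n \<bullet> \<omega>)" if "m \<noteq> 0" for m
      proof -
        have "n + m \<noteq> n" using that by simp
        from K.separated[OF this] have "C_dio * lnorm m powr - \<tau> \<le> \<bar>v (n + m) - v n\<bar>" by simp
        moreover have "0 < C_dio * lnorm m powr - \<tau>" using C_dio_pos lnorm_ge_1[OF that] by simp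
        ultimately have "v (n + m) \<noteq> v n" by linarith
        then show ?thesis unfolding shift by (simp add: v_def)
      qed
      have h1: "\<Lambda> n holomorphic_on ball 0 r"
        unfolding \<Lambda>_def K.level_def by (intro holomorphic_intros hol_ent)
      have h2: "\<Psi> n m holomorphic_on ball 0 r" for m
        unfolding \<Psi>_def using Tdiag scale by (intro holomorphic_intros hol_ent) auto
      have one: "\<Psi> n 0 e = 1" if "e \<in> ball 0 r" for e
        using Tdiag[OF scale[OF that], of n] by (simp add: \<Psi>_def)
      have ev: "complex_of_real (f (x0 + real_vec n \<bullet> \<omega> + real_vec m \<bullet> \<omega>)) * \<Psi> n m e + e * conv_op \<phi> (\<lambda>k. \<Psi> n k e) m = \<Lambda> n e * \<Psi> n m e"
        if e: "e \<in> ball 0 r" for e m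
      proof -
        let ?z = "e / complex_of_real r"
        have zr: "?z * complex_of_real r = e" using r by simp
        have "e * conv_op \<phi> (\<lambda>k. \<Psi> n k e) m = (\<Sum>\<^sub>\<infinity>k. ent P ?z (n + m) (n + k) * ent T ?z (n + k) n / ent T ?z n n)"
          unfolding conv_op_def infsum_cmult_right'[symmetric] using zr
          by (simp add: P(1)[OF scale[OF e]] \<Psi>_def mult.assoc)
        also have "\<dots> = (\<Sum>\<^sub>\<infinity>k. ent P ?z (n + m) k * ent T ?z k n / ent T ?z n n)"
          by (rule infsum_reindex_bij_betw[OF bij_plus[of n]])
        also have "\<dots> = ent (P * T) ?z (n + m) n / ent T ?z n n"
          unfolding ent_times divide_inverse by (rule infsum_cmult_left')
        finally show ?thesis
          unfolding shift \<Lambda>_def \<Psi>_def using eig'[OF scale[OF e], of "n + m" n]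
          by (simp add: add_divide_distrib[symmetric] mult.commute)
      qed
      have "\<bar>\<epsilon>\<bar> < r" using \<epsilon> by simp
      from RS_series_of_holomorphic_eigenpair[of \<phi> r f "x0 + real_vec n \<bullet> \<omega>" \<omega> "\<Lambda> n" "\<Psi> n", OF phi_finite r(1) nz h1 h2 one ev this]
      show "RS_lambda_term \<epsilon> \<phi> f \<omega> (x0 + real_vec n \<bullet> \<omega>) sums \<Lambda> n (complex_of_real \<epsilon>)"
        "RS_psi_term \<epsilon> \<phi> f \<omega> (x0 + real_vec n \<bullet> \<omega>) m sums \<Psi> n m (complex_of_real \<epsilon>)" for m
        by blast+
    qed
    have \<zeta>_eq: "complex_of_real \<epsilon> / complex_of_real r = \<zeta>" by (simp add: \<zeta>_def)
    have RS_lambda: "RS_lambda \<epsilon> \<phi> f \<omega> (x0 + real_vec n \<bullet> \<omega>) = complex_of_real (lam n)" for n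
      using sums_unique[OF RS(1)[of n]] by (simp add: RS_lambda_def \<Lambda>_def \<zeta>_eq lam)
    have psi: "shifted_psi \<epsilon> \<phi> f \<omega> x0 n i = ent T \<zeta> i n / ent T \<zeta> n n" for n i
      using sums_unique[OF RS(2)[of n "i - n"]] by (simp add: shifted_psi_def RS_psi_def \<Psi>_def \<zeta>_eq)
    have psi_fun: "shifted_psi \<epsilon> \<phi> f \<omega> x0 = (\<lambda>n i. ent T \<zeta> i n / ent T \<zeta> n n)"
      by (intro ext psi)
    have ev: "is_eigenvector (H_dom f \<omega> x0) (H_op \<epsilon> \<phi> f \<omega> x0) (RS_lambda \<epsilon> \<phi> f \<omega> (x0 + real_vec n \<bullet> \<omega>)) (shifted_psi \<epsilon> \<phi> f \<omega> x0 n)" for n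
    proof -
      define y where "y = (\<lambda>b k. if k = n then b / ent T \<zeta> n n else 0)"
      have y: "y b \<in> ell2" for b
      proof (rule ell2I(1))
        fix F :: "(int^'d) set" assume "finite F"
        have "(\<Sum>k\<in>F. (cmod (y b k))\<^sup>2) = (\<Sum>k\<in>F. if k = n then (cmod (b / ent T \<zeta> n n))\<^sup>2 else 0)"
          by (intro sum.cong) (auto simp: y_def)
        then show "(\<Sum>k\<in>F. (cmod (y b k))\<^sup>2) \<le> (cmod (b / ent T \<zeta> n n))\<^sup>2" using \<open>finite F\<close> by (simp add: sum.delta)
      qed
      have mv: "matvec (ent T \<zeta>) (y b) i = b * shifted_psi \<epsilon> \<phi> f \<omega> x0 n i" for b i
      proof -
        have "matvec (ent T \<zeta>) (y b) i = (\<Sum>\<^sub>\<infinity>k\<in>{n}. ent T \<zeta> i k * y b k)"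
          unfolding matvec_def by (rule infsum_cong_neutral) (auto simp: y_def)
        then show ?thesis by (simp add: y_def psi)
      qed
      have mv1: "matvec (ent T \<zeta>) (y 1) = shifted_psi \<epsilon> \<phi> f \<omega> x0 n" using mv[of 1] by auto
      have ly: "(\<lambda>k. complex_of_real (lam k) * y 1 k) = y (complex_of_real (lam n))" by (auto simp: y_def)
      have ly2: "(\<lambda>k. complex_of_real (lam k) * y 1 k) \<in> ell2" unfolding ly by (rule y)
      have "shifted_psi \<epsilon> \<phi> f \<omega> x0 n \<in> D.dom" using D.H_matvec(1)[OF y ly2] unfolding mv1 .
      moreover have "D.H (shifted_psi \<epsilon> \<phi> f \<omega> x0 n) = (\<lambda>i. complex_of_real (lam n) * shifted_psi \<epsilon> \<phi> f \<omega> x0 n i)"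
        using D.H_matvec(2)[OF y ly2] unfolding mv1 ly by (auto simp: mv)
      moreover have "shifted_psi \<epsilon> \<phi> f \<omega> x0 n n = 1" using Tdiag[OF \<zeta>(1), of n] by (simp add: psi)
      then have "shifted_psi \<epsilon> \<phi> f \<omega> x0 n \<noteq> (\<lambda>_. 0)" by auto
      ultimately show ?thesis unfolding is_eigenvector_def dom H RS_lambda by blast
    qed
    have "complete_system (shifted_psi \<epsilon> \<phi> f \<omega> x0)"
      unfolding psi_fun by (rule D.complete) (rule Tdiag[OF \<zeta>(1)])
    moreover have "pure_point_spectrum (H_dom f \<omega> x0) (H_op \<epsilon> \<phi> f \<omega> x0)"
      unfolding dom H by (rule D.pure_point)
    ultimately show ?thesis using RS sums_summable ev by blast
  qed
  show ?thesis
    by (rule exI[of _ r], rule conjI[OF r(1)], rule allI, rule allI, rule impI, elim conjE, (rule main; assumption))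
qed

end
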